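(* Let $f(\bm x)=\bm x^TF\bm x\in\mathbb{Z}[x_1,\dots,x_s]$ be a non-singular quadratic form satisfying Condition $\mathrm{L}_1$, let $t\in\mathbb{Z}$, and let $\mathcal A=(a_x)$ be a sequence of non-negative reals with $A(X)\to\infty$ satisfying Conditions C, D, K and $\mathrm{L}_2$, such that $A(X)$ is smoothly approximable. Let $K>0$ be any real number. Then $$R_{f,t}(X,\mathcal A)=\mathfrak S\,\mathfrak I(X)+O\big(A(X)^sX^{-2}L^{-K}+\mathfrak I(X)L^{-K}\big),$$ where $\mathfrak S$ is a non-negative constant that can be interpreted as the product over all primes $p$ of the local weighted $p$-adic densities $\lim_{m\to\infty}p^mM(p^m)$.
   Context: Notation: $e(z)=e^{2\pi i z}$, $L=\log X$. $F=(F_{i,j})$ is the symmetric matrix with $f(\bm x)=\sum_{i,j}F_{i,j}x_ix_j$. Let $n=\lfloor s/2\rfloor$ and let $F_2$ be the submatrix of $F$ consisting of rows $1,\dots,n$ and columns $n+1,\dots,s$. Condition $\mathrm{L}_1$: after some permutation of the variables, $\operatorname{rank}(F_2)\ge 5$. The sequence $\mathcal A=(a_x)_{x\in\mathbb{N}}$, $a_x\ge0$; $A(X)=\sum_{1\le x\le X}a_x$ for real $X$; for $q\in\mathbb{N}$ and $h$ mod $q$, $A(q,h;X)=\sum_{1\le x\le X,\ x\equiv h\ (q)}a_x$. For vectors, $a_{\bm x}=\prod_i a_{x_i}$, $\kappa(q,\bm h)=\prod_i\kappa(q,h_i)$, and $0\le\bm x\le X$ means $0\le x_i\le X$ for all $i$.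 Condition $\mathrm{L}_2$: there is $c\ge0$ with $\sum_{x\le X}a_x^2\ll A(X)^2X^{-1}L^c$ for all $X\ge1$. Condition D: there is an increasing function $Q_D(X)$ such that for all $X>1$, all $q\le Q_D$ and all $h$ mod $q$ there is a real $\kappa(q,h)\ge0$ with $A(q,h;X)=\kappa(q,h)A(X)+O_m(A(X)L^{-m})$ for every $m\in\mathbb{N}$. Condition C: $\kappa(qq',qh'+q'h)=\kappa(q,q'h)\kappa(q',qh')$ for all coprime $q,q'$ with $qq'<Q_D$. Condition K: there is $c\ge0$ independent of $q$ with $\kappa(q,h)\ll(\log q)^c/q$ as $q\to\infty$. $A(X)$ is smoothly approximable if for every $m\in\mathbb{N}$ there is a smooth $\Psi$ with derivative $\psi$ such that (1) $\Psi(X)=A(X)+O(A(X)L^{-m})$, (2) $\psi(X)\asymp A(X)/X$, (3) $\int_{yX}^{zX}|\psi'(u)|\,du\ll_{y,z}A(X)/X$ for all $y,z>0$. Counting function: $R_{f,t}(X,\mathcal A)=\sum_{0\le\bm x\le X,\ \bm x\in\mathbb{Z}^s}\mathbf 1_{[f(\bm x)=t]}a_{\bm x}$. Singular series: $S(q,a)=\sum_{\bm h\bmod q}\kappa(q,\bm h)e(\tfrac aq f(\bm h))$, $B(q)=\sum_{1\le a\le q,(a,q)=1}S(q,a)e(-\tfrac aq t)$, $\mathfrak S=\sum_{q\ge1}B(q)$. Also $M(p^m)=\sum_{\bm x\bmod p^m,\ f(\bm x)\equiv t\ (p^m)}\kappa(p^m,\bm x)$. Singular integral: $P=L^B$ for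 a sufficiently large constant $B$ (depending on $K$ and $c$), $Q=X^2/P$; with $\psi$ the derivative of a smooth approximation $\Psi$ of $A$ (for suitable $m$), $I(\lambda,X)=\int_{[0,X]^s}\psi(\bm u)e(\lambda f(\bm u))\,d\bm u$ (where $\psi(\bm u)=\prod\psi(u_i)$) and $\mathfrak I(X)=\int_{-1/Q}^{1/Q}I(\lambda,X)e(-\lambda t)\,d\lambda$.
   Formalization: Condition D is supplemented by the requirement that for every B one has Q_D(X) ≥ (log X)^B for all large X; without growth of Q_D the densities κ(q,h) are not determined and the claim fails. *)

theory Defs
  imports
    "HOL-Analysis.Analysis"
    "HOL-Library.Landau_Symbols"
    "HOL-Library.Real_Mod"
    "HOL-Combinatorics.Permutations"
    "HOL-Number_Theory.Cong"
    "Jordan_Normal_Form.DL_Rank_Submatrix"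
begin

section \<open>The quadratic form\<close>

text \<open>Vectors with \<open>s\<close> entries are functions on \<open>{..<s}\<close>, so the variables
  \<open>x_1, ..., x_s\<close> are indexed by \<open>0, ..., s - 1\<close>.\<close>

definition qform :: "nat \<Rightarrow> real mat \<Rightarrow> (nat \<Rightarrow> real) \<Rightarrow> real" where
  "qform s F x = (\<Sum>i<s. \<Sum>j<s. F $$ (i, j) * x i * x j)"

text \<open>The coefficient of \<open>x_i x_j\<close> in \<open>f\<close> is \<open>F_{ij} + F_{ji} = 2 F_{ij}\<close> for distinct \<open>i, j\<close>, so
  \<open>f\<close> having integer coefficients allows half-integers off the diagonal of \<open>F\<close>.\<close>

definition integral_form_matrix :: "nat \<Rightarrow> real mat \<Rightarrow> bool" where
  "integral_form_matrix s F \<longleftrightarrow>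
     F \<in> carrier_mat s s \<and> transpose_mat F = F \<and>
     (\<forall>i<s. F $$ (i, i) \<in> \<int>) \<and> (\<forall>i<s. \<forall>j<s. i \<noteq> j \<longrightarrow> 2 * F $$ (i, j) \<in> \<int>)"

definition condition_L1 :: "nat \<Rightarrow> real mat \<Rightarrow> bool" where
  "condition_L1 s F \<longleftrightarrow>
     (\<exists>\<sigma>. \<sigma> permutes {..<s} \<and>
        (let n = s div 2;
             F\<^sub>2 = submatrix (mat s s (\<lambda>(i, j). F $$ (\<sigma> i, \<sigma> j))) {..<n} {n..<s}
         in vec_space.rank n F\<^sub>2 \<ge> 5))"


section \<open>The weight sequence\<close>

definition wsum :: "(nat \<Rightarrow> real) \<Rightarrow> real \<Rightarrow> real" where
  "wsum a X = (\<Sum>x\<in>{1..nat \<lfloor>X\<rfloor>}. a x)"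

definition wsum_ap :: "(nat \<Rightarrow> real) \<Rightarrow> nat \<Rightarrow> int \<Rightarrow> real \<Rightarrow> real" where
  "wsum_ap a q h X = (\<Sum>x\<in>{x\<in>{1..nat \<lfloor>X\<rfloor>}. [int x = h] (mod int q)}. a x)"

text \<open>The range starts at \<open>X = 2\<close> and not at \<open>X = 1\<close>: since \<open>ln 1 = 0\<close>, the bound at \<open>X = 1\<close> would
  force \<open>a 1 = 0\<close>.  The condition below is implied by the one with \<open>X \<ge> 1\<close>.\<close>

definition condition_L2 :: "(nat \<Rightarrow> real) \<Rightarrow> bool" where
  "condition_L2 a \<longleftrightarrow>
     (\<exists>c\<ge>0. \<exists>C. \<forall>X\<ge>2. (\<Sum>x\<in>{1..nat \<lfloor>X\<rfloor>}. (a x)\<^sup>2) \<le> C * ((wsum a X)\<^sup>2 / X * ln X powr c))"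

text \<open>The level \<open>Q\<close> and the densities \<open>\<kappa>\<close>, whose existence Condition D asserts, are parameters,
  because Conditions C and K and the main term refer to them.\<close>

definition condition_D :: "(nat \<Rightarrow> real) \<Rightarrow> (real \<Rightarrow> real) \<Rightarrow> (nat \<Rightarrow> int \<Rightarrow> real) \<Rightarrow> bool" where
  "condition_D a Q \<kappa> \<longleftrightarrow>
     mono_on {1<..} Q \<and>
     (\<forall>X>1. \<forall>q\<ge>1. real q \<le> Q X \<longrightarrow> (\<forall>h. \<kappa> q h \<ge> 0)) \<and>
     (\<forall>m::nat. \<exists>C. \<forall>X>1. \<forall>q\<ge>1. real q \<le> Q X \<longrightarrow>
        (\<forall>h. \<bar>wsum_ap a q h X - \<kappa> q h * wsum a X\<bar> \<le> C * (wsum a X / ln X ^ m)))"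

text \<open>The circle method uses Condition D for all moduli up to \<open>P = (ln X)^B\<close>, with \<open>B\<close> arbitrarily
  large.  Monotonicity of the level alone does not provide this: for a level below \<open>1\<close>,
  Condition D is vacuous.\<close>

definition level_beyond_log_powers :: "(real \<Rightarrow> real) \<Rightarrow> bool" where
  "level_beyond_log_powers Q \<longleftrightarrow> (\<forall>B::real. \<forall>\<^sub>F X in at_top. ln X powr B \<le> Q X)"

definition condition_C :: "(real \<Rightarrow> real) \<Rightarrow> (nat \<Rightarrow> int \<Rightarrow> real) \<Rightarrow> bool" where
  "condition_C Q \<kappa> \<longleftrightarrow>
     (\<forall>X>1. \<forall>q\<ge>1. \<forall>q'\<ge>1. coprime q q' \<and> real (q * q') < Q X \<longrightarrow>
        (\<forall>h h'. \<kappa> (q * q') (int q * h' + int q' * h) = \<kappa> q (int q' * h) * \<kappa> q' (int q * h')))"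

definition condition_K :: "(nat \<Rightarrow> int \<Rightarrow> real) \<Rightarrow> bool" where
  "condition_K \<kappa> \<longleftrightarrow>
     (\<exists>c\<ge>0. \<exists>C. \<forall>\<^sub>F q in sequentially. \<forall>h. \<kappa> q h \<le> C * (ln (real q) powr c / real q))"

definition smooth_on_pos :: "(real \<Rightarrow> real) \<Rightarrow> bool" where
  "smooth_on_pos \<Psi> \<longleftrightarrow> (\<forall>k. (deriv ^^ k) \<Psi> differentiable_on {0<..})"

text \<open>Smoothness is only required on the positive reals, so that \<open>\<Psi> X = sqrt X\<close> is allowed;
  integrability of \<open>\<psi> = deriv \<Psi>\<close> near \<open>0\<close>, automatic if \<open>\<Psi>\<close> is smooth at \<open>0\<close>, makes the integrals of
  \<open>\<psi>\<close> over \<open>{0..X}\<close> in the singular integral exist.\<close>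

definition smooth_approximation :: "(nat \<Rightarrow> real) \<Rightarrow> nat \<Rightarrow> (real \<Rightarrow> real) \<Rightarrow> bool" where
  "smooth_approximation a m \<Psi> \<longleftrightarrow>
     smooth_on_pos \<Psi> \<and> set_integrable lborel {0<..1} (deriv \<Psi>) \<and>
     (\<lambda>X. \<Psi> X - wsum a X) \<in> O(\<lambda>X. wsum a X / ln X ^ m) \<and>
     deriv \<Psi> \<in> \<Theta>(\<lambda>X. wsum a X / X) \<and>
     (\<forall>y>0. \<forall>z>0. (\<lambda>X. LINT u:{y * X..z * X}|lborel. \<bar>deriv (deriv \<Psi>) u\<bar>)
                    \<in> O(\<lambda>X. wsum a X / X))"

definition smoothly_approximable :: "(nat \<Rightarrow> real) \<Rightarrow> bool" where
  "smoothly_approximable a \<longleftrightarrow> (\<forall>m. \<exists>\<Psi>. smooth_approximation a m \<Psi>)"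


section \<open>Counting function, singular series and singular integral\<close>

text \<open>Solutions with a zero coordinate are counted with the weight \<open>a 0\<close>, which is unrestricted
  (\<open>wsum\<close> does not involve it); for a sequence indexed by the positive integers take \<open>a 0 = 0\<close>.\<close>

definition rep_count :: "nat \<Rightarrow> real mat \<Rightarrow> int \<Rightarrow> (nat \<Rightarrow> real) \<Rightarrow> real \<Rightarrow> real" where
  "rep_count s F t a X =
     (\<Sum>x\<in>{x \<in> {..<s} \<rightarrow>\<^sub>E {0..nat \<lfloor>X\<rfloor>}. qform s F (\<lambda>i. real (x i)) = of_int t}. \<Prod>i<s. a (x i))"

definition e :: "real \<Rightarrow> complex" where
  "e z = exp (2 * of_real pi * \<i> * of_real z)"

definition residue_vectors :: "nat \<Rightarrow> nat \<Rightarrow> (nat \<Rightarrow> int) set" where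
  "residue_vectors s q = {..<s} \<rightarrow>\<^sub>E {0..<int q}"

definition local_sum ::
  "nat \<Rightarrow> real mat \<Rightarrow> (nat \<Rightarrow> int \<Rightarrow> real) \<Rightarrow> nat \<Rightarrow> nat \<Rightarrow> complex" where
  "local_sum s F \<kappa> q b =
     (\<Sum>h\<in>residue_vectors s q.
        of_real (\<Prod>i<s. \<kappa> q (h i)) * e (real b / real q * qform s F (\<lambda>i. of_int (h i))))"

definition singular_term ::
  "nat \<Rightarrow> real mat \<Rightarrow> int \<Rightarrow> (nat \<Rightarrow> int \<Rightarrow> real) \<Rightarrow> nat \<Rightarrow> complex" where
  "singular_term s F t \<kappa> q =
     (\<Sum>b\<in>{b\<in>{1..q}. coprime b q}. local_sum s F \<kappa> q b * e (- (real b / real q) * of_int t))"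

definition local_mass ::
  "nat \<Rightarrow> real mat \<Rightarrow> int \<Rightarrow> (nat \<Rightarrow> int \<Rightarrow> real) \<Rightarrow> nat \<Rightarrow> real" where
  "local_mass s F t \<kappa> q =
     (\<Sum>x\<in>{x \<in> residue_vectors s q.
             [qform s F (\<lambda>i. of_int (x i)) = of_int t] (rmod real q)}. \<Prod>i<s. \<kappa> q (x i))"

definition osc_integral :: "nat \<Rightarrow> real mat \<Rightarrow> (real \<Rightarrow> real) \<Rightarrow> real \<Rightarrow> real \<Rightarrow> complex" where
  "osc_integral s F \<psi> l X =
     (LINT u:({..<s} \<rightarrow>\<^sub>E {0..X})|(\<Pi>\<^sub>M i\<in>{..<s}. lborel).
        of_real (\<Prod>i<s. \<psi> (u i)) * e (l * qform s F u))"

definition singular_integral ::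
  "nat \<Rightarrow> real mat \<Rightarrow> int \<Rightarrow> (real \<Rightarrow> real) \<Rightarrow> real \<Rightarrow> real \<Rightarrow> complex" where
  "singular_integral s F t \<psi> B X =
     (let P = ln X powr B; Q = X\<^sup>2 / P
      in LINT l:{- 1 / Q..1 / Q}|lborel. osc_integral s F \<psi> l X * e (- l * of_int t))"

end

theory Submission
  imports Defs
    "HOL-Number_Theory.Number_Theory"
    "HOL-Real_Asymp.Real_Asymp"
    "HOL-Analysis.Kronecker_Approximation_Theorem"
begin

text \<open>
  The circle method.  By \<open>condition_L1\<close> there are five variables \<open>y\<close> and five other variables \<open>z\<close>
  whose bilinear part \<open>2 y\<^sup>T G z\<close> has nonsingular \<open>G\<close>.  Fixing the remaining variables, applying
  Cauchy's inequality in \<open>y\<close> and Schur's test in \<open>z\<close> bounds the generating function \<open>S(\<alpha>)\<close> by the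
  fifth power of a sum \<open>T\<close> of linear exponential sums \<open>\<Sum>\<^sub>v \<bar>\<Sum>\<^sub>y e(\<alpha> v y)\<bar>\<close>; the weights enter only
  through \<open>\<Sum> a\<^sub>x\<close> and \<open>\<Sum> a\<^sub>x\<^sup>2\<close>.  Up to logarithms this gives
  \<open>S(\<alpha>) \<lesssim> A(X)\<^sup>s (q max(1, X\<^sup>2 \<bar>\<alpha> - a/q\<bar>))\<close> to the power \<open>-5/2\<close>, enough for the minor arcs, and the same
  inequality modulo \<open>q\<close> gives \<open>B(q) \<lesssim> q\<close> to the power \<open>-5/4\<close> for the singular series.  On the major
  arcs the sum is replaced by the integral one coordinate at a time, by partial summation.
  Since the error is allowed to contain the truncated singular integral itself, no decay of the
  oscillatory integral is needed.
\<close>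

section \<open>Linear exponential sums\<close>

text \<open>Cauchy's inequality followed by Schur's test strips the weights and leaves unweighted
  linear sums.

  Why five variables on each side: with \<tau> = 1 / (q max(1, X^2 \<bar>\<alpha> - a/q\<bar>)),
  rank r saves \<tau> to the power r/2. The integral over the circle of \<tau>^2 taken at the best
  approximation is of order X^-2 up to a logarithm, so r = 4 is exactly borderline. Rank 5 leaves a
  spare factor \<open>sqrt \<tau>\<close>, which off the major arcs is at most L to the power -B/2.
  The same count makes the singular series converge: q numerators times q to the power -5/2.

  The constants are chosen in a fixed order. The exponent c of all logarithmic losses on the minor
  arcs does not depend on B; then B is chosen large in terms of K and c; then m, the precision of
  the smooth approximation, large in terms of B, so that any power of P lost on the major arcs is
  recovered.\<close>

lemma e_eq_cis: "e x = cis (2 * pi * x)"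
  by (simp add: e_def cis_conv_exp mult_ac)

lemma e_add: "e (x + y) = e x * e y"
  by (simp add: e_eq_cis cis_mult ring_distribs)

lemma e_diff: "e (x - y) = e x * cnj (e y)"
  by (simp add: e_eq_cis cis_cnj cis_mult ring_distribs)

lemma e_zero [simp]: "e 0 = 1"
  by (simp add: e_eq_cis)

lemma norm_e [simp]: "cmod (e x) = 1"
  by (simp add: e_eq_cis)

lemma e_int: "x \<in> \<int> \<Longrightarrow> e x = 1"
  by (simp add: e_eq_cis cis_multiple_2pi)

lemma e_add_int: "y \<in> \<int> \<Longrightarrow> e (x + y) = e x"
  by (simp add: e_add e_int)

lemma e_cong: "x - y \<in> \<int> \<Longrightarrow> e x = e y"
  using e_add_int[of "x - y" y] by simp

lemma e_sum: "e (sum f A) = (\<Prod>x\<in>A. e (f x))"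
  by (induction A rule: infinite_finite_induct) (auto simp: e_add)

lemma e_power: "e x ^ n = e (real n * x)"
  by (induction n) (auto simp: e_add ring_distribs)

lemma norm_e_minus_1: "cmod (e x - 1) = 2 * \<bar>sin (pi * x)\<bar>"
proof -
  have "(cmod (e x - 1))\<^sup>2 = (cos (2 * (pi * x)) - 1)\<^sup>2 + (sin (2 * (pi * x)))\<^sup>2"
    by (simp add: e_eq_cis cmod_def mult_ac)
  also have "\<dots> = 2 - 2 * cos (2 * (pi * x))"
    using sin_cos_squared_add[of "2 * (pi * x)"] by (simp add: power2_eq_square algebra_simps)
  also have "\<dots> = (2 * \<bar>sin (pi * x)\<bar>)\<^sup>2"
    unfolding cos_double_sin by (simp add: power_mult_distrib)
  finally show ?thesis
    by (rule power2_eq_imp_eq) auto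
qed

lemma norm_e_diff_le: "cmod (e x - e y) \<le> 2 * pi * \<bar>x - y\<bar>"
proof -
  have "e x - e y = e y * (e (x - y) - 1)"
    using e_add[of y "x - y"] by (simp add: right_diff_distrib)
  then have "cmod (e x - e y) = 2 * \<bar>sin (pi * (x - y))\<bar>"
    by (simp add: norm_mult norm_e_minus_1)
  also have "\<dots> \<le> 2 * \<bar>pi * (x - y)\<bar>"
    using abs_sin_x_le_abs_x[of "pi * (x - y)"] by simp
  finally show ?thesis by (simp add: abs_mult)
qed

text \<open>The cubic Taylor bound is enough: with x = pi d one has \<bar>x\<bar> \<le> 1.6, and
  1.6^2 / 6 < 1/2 leaves at least half of \<bar>x\<bar>. This is weaker than Jordan's constant 2,
  but sufficient here.\<close>

lemma abs_sin_pi_ge: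
  assumes "\<bar>d\<bar> \<le> 1 / 2"
  shows "\<bar>d\<bar> \<le> \<bar>sin (pi * d)\<bar>"
proof -
  define x where "x = pi * d"
  have *: "\<bar>x\<bar> \<le> 1.6"
    using assms pi_less_4 pi_approx mult_mono[of "pi" "3.2" "\<bar>d\<bar>" "1/2"] by (simp add: x_def abs_mult)
  have "\<bar>sin x - x\<bar> \<le> \<bar>x\<bar> ^ 3 / 6"
    using Maclaurin_sin_bound[of x 3] by (simp add: eval_nat_numeral sin_coeff_def)
  also have "\<dots> = \<bar>x\<bar> * (\<bar>x\<bar> * \<bar>x\<bar>) / 6" by (simp add: eval_nat_numeral)
  also have "\<dots> \<le> \<bar>x\<bar> * (1.6 * 1.6) / 6"
    using * by (intro divide_right_mono mult_mono) auto
  finally have "\<bar>sin x\<bar> \<ge> \<bar>x\<bar> / 2" by (simp add: abs_if split: if_splits)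
  moreover have "\<bar>x\<bar> = pi * \<bar>d\<bar>" by (simp add: x_def abs_mult)
  moreover have "pi * \<bar>d\<bar> \<ge> 2 * \<bar>d\<bar>" using pi_ge_two by (intro mult_right_mono) auto
  ultimately show ?thesis by (simp add: x_def)
qed

definition kern :: "nat \<Rightarrow> real \<Rightarrow> real" where
  "kern N \<theta> = cmod (\<Sum>y<N. e (real y * \<theta>))"

lemma kern_nonneg [simp]: "kern N \<theta> \<ge> 0"
  by (simp add: kern_def)

lemma kern_le: "kern N \<theta> \<le> real N"
  unfolding kern_def by (rule order_trans[OF norm_sum]) simp

lemma abs_minus_round_le: "\<bar>\<theta> - of_int (round \<theta>)\<bar> \<le> (1/2 :: real)"
  using of_int_round_abs_le[of \<theta>] by linarith

text \<open>The closed form of a geometric sum. The product form stays true at integers \<theta>,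
  where the distance to the nearest integer is zero.\<close>

lemma kern_le_inverse: "kern N \<theta> * \<bar>\<theta> - of_int (round \<theta>)\<bar> \<le> 1"
proof -
  define d where "d = \<theta> - of_int (round \<theta>)"
  have d: "\<bar>d\<bar> \<le> 1/2" unfolding d_def by (rule abs_minus_round_le)
  have "(e \<theta> - 1) * (\<Sum>y<N. e (real y * \<theta>)) = e (real N * \<theta>) - 1"
    using power_diff_1_eq[of "e \<theta>" N] by (simp add: e_power)
  then have "cmod (e \<theta> - 1) * kern N \<theta> = cmod (e (real N * \<theta>) - 1)"
    by (simp add: kern_def flip: norm_mult)
  moreover have "cmod (e (real N * \<theta>) - 1) \<le> 2"
    using norm_triangle_ineq4[of "e (real N * \<theta>)" 1] by simp
  moreover have "e \<theta> = e d"
    unfolding d_def by (rule e_cong) simp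
  moreover have "2 * \<bar>d\<bar> \<le> cmod (e d - 1)"
    using abs_sin_pi_ge[OF d] by (simp add: norm_e_minus_1)
  ultimately have "2 * \<bar>d\<bar> * kern N \<theta> \<le> 2"
    using mult_right_mono[of "2 * \<bar>d\<bar>" "cmod (e d - 1)" "kern N \<theta>"] by simp
  then show ?thesis by (simp add: d_def mult_ac)
qed

text \<open>Here \<open>v\<close> stands for the value of one integral linear form in the
  differences \<open>z - z'\<close>, and \<open>M\<close> bounds that form; \<open>N\<close> is the
  length of the range of a variable \<open>y\<close>.\<close>

definition Tsum :: "real \<Rightarrow> nat \<Rightarrow> nat \<Rightarrow> real" where
  "Tsum \<alpha> N M = (\<Sum>v\<in>{- int M..int M}. kern N (\<alpha> * of_int v))"

lemma Tsum_nonneg [simp]: "Tsum \<alpha> N M \<ge> 0"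
  by (simp add: Tsum_def sum_nonneg)

text \<open>The fraction \<open>a * n / q\<close> is not an integer and so is at least 1/q away from
  \<open>k\<close>. Replacing \<open>a / q\<close> by \<alpha> moves it by at most (1/q^2)(q/2),
  which is half of that gap.\<close>

lemma approx_separated:
  fixes \<alpha> :: real and a q n k :: int
  assumes "coprime a q" "q > 0" "\<bar>\<alpha> - a / q\<bar> \<le> 1 / q\<^sup>2" "n \<noteq> 0" "2 * \<bar>n\<bar> \<le> q"
  shows "1 / (2 * q) \<le> \<bar>\<alpha> * n - k\<bar>"
proof -
  have "a * n - k * q \<noteq> 0"
  proof
    assume "a * n - k * q = 0"
    then have "q dvd a * n" by simp
    moreover have "coprime q a" using assms(1) by (simp add: coprime_commute)
    ultimately have "q dvd n" by (simp only: coprime_dvd_mult_right_iff)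
    with assms(4) have "\<bar>q\<bar> \<le> \<bar>n\<bar>" by (intro dvd_imp_le_int)
    with assms show False by linarith
  qed
  then have "1 \<le> \<bar>real_of_int (a * n - k * q)\<bar>" by linarith
  also have "real_of_int (a * n - k * q) = q * (a / q * n - k)"
    using assms(2) by (simp add: field_simps)
  also have "\<bar>\<dots>\<bar> = q * \<bar>a / q * n - k\<bar>" using assms(2) by (simp add: abs_mult)
  finally have 1: "1 / q \<le> \<bar>a / q * n - k\<bar>" using assms(2) by (simp add: field_simps)
  have "\<bar>(\<alpha> - a / q) * n\<bar> \<le> 1 / q\<^sup>2 * (q / 2)"
    unfolding abs_mult using assms by (intro mult_mono) auto
  also have "\<dots> = 1 / (2 * q)" by (simp add: power2_eq_square)
  finally have 2: "\<bar>(\<alpha> - a / q) * n\<bar> \<le> 1 / (2 * q)" .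
  have "\<alpha> * n - k = (a / q * n - k) + (\<alpha> - a / q) * n" by (simp add: algebra_simps)
  moreover have "1 / real_of_int q = 1 / (2 * q) + 1 / (2 * q)" by (simp add: field_simps)
  ultimately show ?thesis using 1 2 by linarith
qed

text \<open>Within a block of diameter q/2 the signed distances to the nearest integer are spaced by
  1/(2q), so the cell number \<phi> is injective. Fixing the sign \<sigma> makes the cell number a
  lower bound for the distance itself: cell 0 costs the trivial \<open>N\<close>, cell k costs 2q/k,
  and the cells sum to a harmonic number.\<close>

lemma kern_sum_signed_block:
  fixes \<alpha> \<sigma> :: real and a q :: int
  assumes "coprime a q" "q > 0" "\<bar>\<alpha> - a / q\<bar> \<le> 1 / q\<^sup>2" "finite B"
    and "\<And>v w. v \<in> B \<Longrightarrow> w \<in> B \<Longrightarrow> 2 * \<bar>v - w\<bar> \<le> q" and \<sigma>: "\<bar>\<sigma>\<bar> = 1"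
    and sgn: "\<And>v. v \<in> B \<Longrightarrow> \<sigma> * (\<alpha> * of_int v - of_int (round (\<alpha> * of_int v))) \<ge> 0"
  shows "(\<Sum>v\<in>B. kern N (\<alpha> * of_int v)) \<le> real N + 2 * q * (1 + ln q)"
proof -
  define d where "d v = \<alpha> * of_int v - of_int (round (\<alpha> * of_int v))" for v :: int
  define \<phi> where "\<phi> v = \<lfloor>2 * q * (\<sigma> * d v)\<rfloor>" for v
  define G where "G k = (if k = 0 then real N else 2 * q / real_of_int k)" for k :: int
  have q: "real_of_int q \<ge> 1" using assms(2) by linarith
  have inj: "inj_on \<phi> B"
  proof (rule inj_onI, rule ccontr)
    fix v w assume vw: "v \<in> B" "w \<in> B" "\<phi> v = \<phi> w" "v \<noteq> w"
    have "\<bar>2 * q * (\<sigma> * d v) - 2 * q * (\<sigma> * d w)\<bar> < 1"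
      using vw(3) unfolding \<phi>_def by linarith
    also have "2 * q * (\<sigma> * d v) - 2 * q * (\<sigma> * d w) = \<sigma> * (2 * q * (d v - d w))"
      by (simp add: algebra_simps)
    finally have "\<bar>\<sigma>\<bar> * (2 * q * \<bar>d v - d w\<bar>) < 1"
      using q by (simp add: abs_mult)
    then have "\<bar>d v - d w\<bar> * (2 * q) < 1"
      using \<sigma> by (simp add: mult_ac)
    then have "\<bar>d v - d w\<bar> < 1 / (2 * q)"
      using q by (subst pos_less_divide_eq) auto
    moreover have "d v - d w = \<alpha> * of_int (v - w) - of_int (round (\<alpha> * of_int v) - round (\<alpha> * of_int w))"
      by (simp add: d_def algebra_simps)
    ultimately show False
      using approx_separated[OF assms(1-3), of "v - w" "round (\<alpha> * of_int v) - round (\<alpha> * of_int w)"]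
        assms(5)[OF vw(1,2)] vw(4) by simp
  qed
  have range: "\<phi> ` B \<subseteq> {0..q}"
  proof (rule image_subsetI)
    fix v assume "v \<in> B"
    have "\<sigma> * d v \<le> 1 / 2"
      using abs_minus_round_le[of "\<alpha> * of_int v"] \<sigma> unfolding d_def[symmetric]
      by (metis abs_ge_self abs_mult mult_1 order_trans)
    then have "2 * q * (\<sigma> * d v) \<le> 2 * q * (1/2)" using q by (intro mult_left_mono) auto
    moreover have "0 \<le> 2 * q * (\<sigma> * d v)" using sgn[OF \<open>v \<in> B\<close>] q by (simp add: d_def)
    ultimately show "\<phi> v \<in> {0..q}" unfolding \<phi>_def by (auto simp: floor_le_iff)
  qed
  have "kern N (\<alpha> * of_int v) \<le> G (\<phi> v)" if "v \<in> B" for v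
  proof (cases "\<phi> v = 0")
    case True
    then show ?thesis by (simp add: G_def kern_le)
  next
    case False
    with range that have pos: "\<phi> v > 0" by force
    have "real_of_int (\<phi> v) \<le> 2 * q * (\<sigma> * d v)" unfolding \<phi>_def by linarith
    also have "\<sigma> * d v = \<bar>d v\<bar>"
      using sgn[OF that] \<sigma> by (metis abs_mult abs_of_nonneg d_def mult_1)
    finally have *: "\<phi> v / (2 * q) \<le> \<bar>d v\<bar>" using q by (simp add: field_simps)
    have "kern N (\<alpha> * of_int v) * (\<phi> v / (2 * q)) \<le> kern N (\<alpha> * of_int v) * \<bar>d v\<bar>"
      using * by (intro mult_left_mono) auto
    also have "\<dots> \<le> 1" unfolding d_def by (rule kern_le_inverse)
    finally show ?thesis using pos q False by (simp add: G_def field_simps)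
  qed
  then have "(\<Sum>v\<in>B. kern N (\<alpha> * of_int v)) \<le> (\<Sum>v\<in>B. G (\<phi> v))" by (rule sum_mono)
  also have "\<dots> = sum G (\<phi> ` B)" using inj by (simp add: sum.reindex)
  also have "\<dots> \<le> sum G {0..q}"
    using range q by (intro sum_mono2) (auto simp: G_def)
  also have "{0..q} = insert 0 {1..q}" using assms(2) by auto
  also have "sum G \<dots> = real N + (\<Sum>k\<in>{1..q}. G k)" by (simp add: G_def)
  also have "(\<Sum>k\<in>{1..q}. G k) = (\<Sum>k\<in>{1..nat q}. 2 * q * inverse (real k))"
    by (rule sum.reindex_bij_witness[of _ int nat]) (auto simp: G_def field_simps)
  also have "\<dots> = 2 * q * harm (nat q)" by (simp add: harm_def sum_distrib_left)
  \<comment> \<open>The sequence \<open>harm n - ln n\<close> decreases from the value 1 at n =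
    1.\<close>
  also have "harm (nat q) \<le> 1 + ln q"
    using decseqD[OF decseq_harm_diff_ln, of 0 "nat q - 1"] assms(2)
    by (simp add: harm_def)
  finally show ?thesis using q by (simp add: mult_left_mono)
qed

lemma kern_sum_block:
  fixes \<alpha> :: real and a q :: int
  assumes "coprime a q" "q > 0" "\<bar>\<alpha> - a / q\<bar> \<le> 1 / q\<^sup>2" "finite B"
    and "\<And>v w. v \<in> B \<Longrightarrow> w \<in> B \<Longrightarrow> 2 * \<bar>v - w\<bar> \<le> q"
  shows "(\<Sum>v\<in>B. kern N (\<alpha> * of_int v)) \<le> 4 * (real N + q * (1 + ln q))"
proof -
  define d where "d v = \<alpha> * of_int v - of_int (round (\<alpha> * of_int v))" for v :: int
  have "(\<Sum>v\<in>B. kern N (\<alpha> * of_int v)) =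
      (\<Sum>v\<in>{v\<in>B. d v \<ge> 0}. kern N (\<alpha> * of_int v)) + (\<Sum>v\<in>{v\<in>B. \<not> d v \<ge> 0}. kern N (\<alpha> * of_int v))"
    using assms(4) by (subst sum.union_disjoint[symmetric]) (auto intro!: sum.cong)
  also have "(\<Sum>v\<in>{v\<in>B. d v \<ge> 0}. kern N (\<alpha> * of_int v)) \<le> real N + 2 * q * (1 + ln q)"
    using assms by (intro kern_sum_signed_block[where \<sigma> = 1]) (auto simp: d_def)
  also have "(\<Sum>v\<in>{v\<in>B. \<not> d v \<ge> 0}. kern N (\<alpha> * of_int v)) \<le> real N + 2 * q * (1 + ln q)"
    using assms by (intro kern_sum_signed_block[where \<sigma> = "-1"]) (auto simp: d_def)
  finally show ?thesis by (simp add: algebra_simps)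
qed

text \<open>The classical estimate: cut the range of \<open>v\<close> into blocks short enough for
  the spacing argument and add the bounds of the blocks.\<close>

lemma Tsum_le:
  fixes \<alpha> :: real and a q :: int
  assumes "coprime a q" "q > 0" "\<bar>\<alpha> - a / q\<bar> \<le> 1 / q\<^sup>2"
  shows "Tsum \<alpha> N M \<le> (4 * M / q + 2) * (4 * (real N + q * (1 + ln q)))"
proof -
  \<comment> \<open>Blocks of \<open>b\<close> consecutive integers have differences at most
    \<open>b - 1 = q div 2\<close>, as the block lemma demands, while 2b > q keeps their number at
    most 4M/q + 2.\<close>
  define b where "b = q div 2 + 1"
  have b: "b > 0" "q < 2 * b" "2 * (b - 1) \<le> q" using assms(2) by (auto simp: b_def)
  define J where "J = {(- int M) div b..int M div b}"
  have "Tsum \<alpha> N M = (\<Sum>j\<in>J. \<Sum>v\<in>{v\<in>{- int M..int M}. v div b = j}. kern N (\<alpha> * of_int v))"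
    unfolding Tsum_def using b
    by (intro sum.group[symmetric]) (auto simp: J_def zdiv_mono1)
  also have "\<dots> \<le> (\<Sum>j\<in>J. 4 * (real N + q * (1 + ln q)))"
  proof (intro sum_mono kern_sum_block[OF assms])
    fix j v w assume "v \<in> {v\<in>{- int M..int M}. v div b = j}" "w \<in> {v\<in>{- int M..int M}. v div b = j}"
    then have "v = b * j + v mod b" "w = b * j + w mod b"
      using mult_div_mod_eq[of b v, symmetric] mult_div_mod_eq[of b w, symmetric] by simp_all
    moreover have "0 \<le> v mod b" "v mod b < b" "0 \<le> w mod b" "w mod b < b" using b by auto
    ultimately have "\<bar>v - w\<bar> \<le> b - 1" by linarith
    then have "2 * \<bar>v - w\<bar> \<le> 2 * (b - 1)" by (rule mult_left_mono) simp
    then show "2 * \<bar>v - w\<bar> \<le> q" using b(3) by (rule order_trans)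
  qed (rule finite_subset[of _ "{- int M..int M}"], auto)
  also have "\<dots> = real (card J) * (4 * (real N + q * (1 + ln q)))" by simp
  also have "real (card J) \<le> 4 * M / q + 2"
  proof -
    have "real_of_int (int M div b) \<le> M / b"
      using real_of_int_div4[of "int M" b] by simp
    moreover have "real_of_int ((- int M) div b) \<ge> - (M / b) - 1"
      using b real_of_int_div3[of "- int M" b] by (simp add: field_simps)
    moreover have "real M / b \<le> 2 * M / q"
    proof -
      have "real M / b \<le> real M / (q / 2)"
        using b assms(2) by (intro divide_left_mono) auto
      then show ?thesis by (simp add: mult.commute)
    qed
    moreover have "(- int M) div b \<le> int M div b" using b by (intro zdiv_mono1) auto
    ultimately show ?thesis unfolding J_def by simp
  qed
  finally show ?thesis using assms(2)
    by (simp add: mult_right_mono)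
qed

section \<open>The quadratic form\<close>

text \<open>Gaussian elimination, by induction on the columns. Some row \<open>r\<close> has a
  nonzero entry in the new column \<open>c\<close>, since otherwise the unit vector at
  \<open>c\<close> would be in the kernel. \<open>G'\<close> clears that column with the pivot, and
  a kernel vector of \<open>G'\<close> extends to one of \<open>G\<close> by solving row
  \<open>r\<close> for its entry at \<open>c\<close>. Nonsingularity is phrased as a trivial kernel
  because this is the form in which injectivity is used later.\<close>

lemma square_subsystem:
  fixes G :: "nat \<Rightarrow> nat \<Rightarrow> real"
  assumes "finite J" "finite R"
    and "\<And>w. (\<forall>i\<in>R. (\<Sum>j\<in>J. G i j * w j) = 0) \<Longrightarrow> \<forall>j\<in>J. w j = 0"
  shows "\<exists>I\<subseteq>R. card I = card J \<and>
    (\<forall>w. (\<forall>i\<in>I. (\<Sum>j\<in>J. G i j * w j) = 0) \<longrightarrow> (\<forall>j\<in>J. w j = 0))"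
  using assms
proof (induction J arbitrary: G R rule: finite_induct)
  case empty
  then show ?case by (intro exI[of _ "{}"]) auto
next
  case (insert c J)
  have "\<exists>r\<in>R. G r c \<noteq> 0"
  proof (rule ccontr)
    assume *: "\<not> (\<exists>r\<in>R. G r c \<noteq> 0)"
    have "\<forall>i\<in>R. (\<Sum>j\<in>insert c J. G i j * (if j = c then 1 else 0)) = 0"
    proof
      fix i assume "i \<in> R"
      with * have "G i c = 0" by auto
      moreover have "(\<Sum>j\<in>J. G i j * (if j = c then 1 else 0)) = 0"
        using insert.hyps by (intro sum.neutral) auto
      ultimately show "(\<Sum>j\<in>insert c J. G i j * (if j = c then 1 else 0)) = 0"
        using insert.hyps by simp
    qed
    from insert.prems(2)[OF this] show False by auto
  qed
  then obtain r where r: "r \<in> R" "G r c \<noteq> 0" by blast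
  define G' where "G' i j = G i j - G i c * G r j / G r c" for i j
  have elim: "(\<Sum>j\<in>J. G' i j * w j) = (\<Sum>j\<in>insert c J. G i j * w j) - G i c / G r c * (\<Sum>j\<in>insert c J. G r j * w j)"
    for i w
    using r insert.hyps
    by (simp add: G'_def sum_subtractf ring_distribs sum_distrib_left left_diff_distrib mult_ac)
  have "\<exists>I\<subseteq>R - {r}. card I = card J \<and>
    (\<forall>w. (\<forall>i\<in>I. (\<Sum>j\<in>J. G' i j * w j) = 0) \<longrightarrow> (\<forall>j\<in>J. w j = 0))"
  proof (rule insert.IH)
    fix w assume w: "\<forall>i\<in>R - {r}. (\<Sum>j\<in>J. G' i j * w j) = 0"
    define w' where "w' = w(c := - (\<Sum>j\<in>J. G r j * w j) / G r c)"
    have eq: "(\<Sum>j\<in>J. H j * w' j) = (\<Sum>j\<in>J. H j * w j)" for H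
      using insert.hyps by (intro sum.cong) (auto simp: w'_def)
    have rr: "(\<Sum>j\<in>insert c J. G r j * w' j) = 0"
      using insert.hyps r by (simp add: eq) (simp add: w'_def)
    have "\<forall>i\<in>R. (\<Sum>j\<in>insert c J. G i j * w' j) = 0"
    proof
      fix i assume "i \<in> R"
      show "(\<Sum>j\<in>insert c J. G i j * w' j) = 0"
      proof (cases "i = r")
        case False
        with w \<open>i \<in> R\<close> have "(\<Sum>j\<in>J. G' i j * w' j) = 0" unfolding eq by auto
        then show ?thesis unfolding elim rr by simp
      qed (use rr in simp)
    qed
    from insert.prems(2)[OF this] show "\<forall>j\<in>J. w j = 0"
      using insert.hyps by (auto simp: w'_def split: if_splits)
  qed (use insert.prems in auto)
  then obtain I where I: "I \<subseteq> R - {r}" "card I = card J"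
    "\<And>w. (\<forall>i\<in>I. (\<Sum>j\<in>J. G' i j * w j) = 0) \<Longrightarrow> (\<forall>j\<in>J. w j = 0)" by blast
  have "finite I" using I(1) insert.prems(1) finite_subset by blast
  show ?case
  proof (intro exI[of _ "insert r I"] conjI allI impI)
    show "card (insert r I) = card (insert c J)"
      using I \<open>finite I\<close> insert.hyps by (subst card_insert_disjoint) auto
  next
    fix w assume w: "\<forall>i\<in>insert r I. (\<Sum>j\<in>insert c J. G i j * w j) = 0"
    then have "\<forall>i\<in>I. (\<Sum>j\<in>J. G' i j * w j) = 0" unfolding elim by auto
    from I(3)[OF this] have *: "\<forall>j\<in>J. w j = 0" .
    moreover have "(\<Sum>j\<in>insert c J. G r j * w j) = 0" using w by simp
    then have "G r c * w c = 0" using * insert.hyps by simp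
    ultimately show "\<forall>j\<in>insert c J. w j = 0" using r by simp
  qed (use I r in auto)
qed

text \<open>Translates the rank into index sets: a maximal independent set of column vectors has at
  least \<open>k\<close> elements, and \<open>c\<close> picks a position for each of
  \<open>k\<close> of them. Distinct vectors have distinct positions, so a relation among the
  positions is a relation among the vectors.\<close>

lemma rank_ge_imp_indep_columns:
  fixes A :: "real mat"
  assumes A: "A \<in> carrier_mat n m" and rank: "vec_space.rank n A \<ge> k"
  shows "\<exists>J\<subseteq>{..<m}. card J = k \<and>
    (\<forall>w. (\<forall>i<n. (\<Sum>j\<in>J. A $$ (i, j) * w j) = 0) \<longrightarrow> (\<forall>j\<in>J. w j = 0))"
proof -
  interpret V: vec_space "TYPE(real)" n .
  have "\<exists>S. finite S \<and> maximal S (\<lambda>T. T \<subseteq> set (cols A) \<and> V.lin_indpt T) \<and> {} \<subseteq> S"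
    by (rule maximal_exists_superset[of "set (cols A)"]) (auto simp: V.lin_dep_def)
  then obtain S where S: "finite S" "maximal S (\<lambda>T. T \<subseteq> set (cols A) \<and> V.lin_indpt T)" by blast
  have "card S \<ge> k" using rank V.rank_card_indpt[OF A S(2)] by simp
  then obtain S' where S': "S' \<subseteq> S" "card S' = k" by (meson obtain_subset_with_card_n)
  have ind: "V.lin_indpt S" and cols: "S \<subseteq> set (cols A)" using S(2) by (auto simp: maximal_def)
  have ind': "V.lin_indpt S'" using ind S'(1) V.supset_ld_is_ld by blast
  have car: "S' \<subseteq> carrier_vec n" using cols S'(1) A cols_dim by blast
  have "\<forall>v\<in>S'. \<exists>j<m. col A j = v"
    using cols S' A by (force simp: cols_def)
  then obtain c where c: "\<And>v. v \<in> S' \<Longrightarrow> c v < m \<and> col A (c v) = v" by metis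
  have inj: "inj_on c S'" by (rule inj_onI) (metis c)
  have fin: "finite S'" using S S' finite_subset by blast
  show ?thesis
  proof (intro exI[of _ "c ` S'"] conjI allI impI)
    show "c ` S' \<subseteq> {..<m}" using c by auto
    show "card (c ` S') = k" using inj S' by (simp add: card_image)
  next
    fix w assume w: "\<forall>i<n. (\<Sum>j\<in>c ` S'. A $$ (i, j) * w j) = 0"
    have "V.lincomb (w \<circ> c) S' = 0\<^sub>v n"
    proof (rule eq_vecI)
      show "dim_vec (V.lincomb (w \<circ> c) S') = dim_vec (0\<^sub>v n)"
        using car by (simp add: V.lincomb_dim fin)
      fix i assume i: "i < dim_vec (0\<^sub>v n :: real vec)"
      then have "V.lincomb (w \<circ> c) S' $ i = (\<Sum>v\<in>S'. w (c v) * v $ i)"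
        using V.lincomb_index[OF _ car] by simp
      also have "\<dots> = (\<Sum>v\<in>S'. A $$ (i, c v) * w (c v))"
      proof (rule sum.cong[OF refl])
        fix v assume "v \<in> S'"
        from c[OF this] have "v $ i = A $$ (i, c v)"
          using A i by (metis carrier_matD(1) carrier_matD(2) index_col index_zero_vec(2))
        then show "w (c v) * v $ i = A $$ (i, c v) * w (c v)" by simp
      qed
      also have "\<dots> = (\<Sum>j\<in>c ` S'. A $$ (i, j) * w j)"
        using inj by (simp add: sum.reindex)
      finally show "V.lincomb (w \<circ> c) S' $ i = 0\<^sub>v n $ i" using w i by simp
    qed
    then have "\<forall>v\<in>S'. (w \<circ> c) v = 0"
      using ind' fin V.not_lindepD[OF ind' fin subset_refl, of "w \<circ> c"] by (auto simp: Pi_def)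
    then show "\<forall>j\<in>c ` S'. w j = 0" by auto
  qed
qed

text \<open>First five independent columns of \<open>F\<^sub>2\<close> are chosen, then five rows on
  which they remain independent; both sets are carried back by \<sigma>. They are disjoint because
  the rows of \<open>F\<^sub>2\<close> have indices below n and its columns have indices from n
  on.\<close>

lemma condition_L1_nonsingular_block:
  assumes "condition_L1 s F"
  obtains I J where "I \<subseteq> {..<s}" "J \<subseteq> {..<s}" "I \<inter> J = {}" "card I = 5" "card J = 5"
    "\<And>w. \<forall>i\<in>I. (\<Sum>j\<in>J. F $$ (i, j) * w j) = 0 \<Longrightarrow> \<forall>j\<in>J. w j = 0"
proof -
  define n where "n = s div 2"
  obtain \<sigma> where \<sigma>: "\<sigma> permutes {..<s}"
    "vec_space.rank n (submatrix (mat s s (\<lambda>(i, j). F $$ (\<sigma> i, \<sigma> j))) {..<n} {n..<s}) \<ge> 5"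
    using assms by (auto simp: condition_L1_def n_def Let_def)
  define A where "A = submatrix (mat s s (\<lambda>(i, j). F $$ (\<sigma> i, \<sigma> j))) {..<n} {n..<s}"
  have ns: "n \<le> s" by (simp add: n_def)
  have c1: "{i. i < s \<and> i \<in> {..<n}} = {..<n}" and c2: "{i. i < s \<and> i \<in> {n..<s}} = {n..<s}"
    using ns by auto
  have A: "A \<in> carrier_mat n (s - n)"
    unfolding A_def carrier_mat_def using dim_submatrix[of "mat s s (\<lambda>(i, j). F $$ (\<sigma> i, \<sigma> j))" "{..<n}" "{n..<s}"]
    by (simp add: c1[simplified] c2[simplified])
  \<comment> \<open>\<open>pick\<close> enumerates a set by successive least elements, so for an
    interval it is a shift.\<close>
  have p1: "pick {..<n} i = i" if "i < n" for i
    using that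
  proof (induction i)
    case 0
    then show ?case by (auto intro!: Least_equality)
  next
    case (Suc i)
    then show ?case by (auto intro!: Least_equality)
  qed
  have p2: "pick {n..<s} j = n + j" if "j < s - n" for j
    using that
  proof (induction j)
    case 0
    then show ?case by (auto intro!: Least_equality)
  next
    case (Suc i)
    then show ?case by (auto intro!: Least_equality)
  qed
  have entry: "A $$ (i, j) = F $$ (\<sigma> i, \<sigma> (n + j))" if "i < n" "j < s - n" for i j
    unfolding A_def using that ns
    by (subst submatrix_index) (auto simp: c1[simplified] c2[simplified] p1 p2)
  obtain J where J: "J \<subseteq> {..<s - n}" "card J = 5"
    "\<And>w. (\<forall>i<n. (\<Sum>j\<in>J. A $$ (i, j) * w j) = 0) \<Longrightarrow> (\<forall>j\<in>J. w j = 0)"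
    using rank_ge_imp_indep_columns[OF A \<sigma>(2)[folded A_def]] by blast
  have "finite J" using J(1) finite_subset by blast
  then obtain I where I: "I \<subseteq> {..<n}" "card I = 5"
    "\<And>w. (\<forall>i\<in>I. (\<Sum>j\<in>J. A $$ (i, j) * w j) = 0) \<Longrightarrow> (\<forall>j\<in>J. w j = 0)"
    using square_subsystem[of J "{..<n}" "\<lambda>i j. A $$ (i, j)"] J by auto
  have inj: "inj \<sigma>" using \<sigma>(1) permutes_inj by blast
  have injJ: "inj_on (\<lambda>j. \<sigma> (n + j)) J" by (rule inj_onI) (use injD[OF inj] in fastforce)
  show ?thesis
  proof
    show "\<sigma> ` I \<subseteq> {..<s}" "(\<lambda>j. \<sigma> (n + j)) ` J \<subseteq> {..<s}"
      using I J ns permutes_in_image[OF \<sigma>(1)] by fastforce+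
    show "\<sigma> ` I \<inter> (\<lambda>j. \<sigma> (n + j)) ` J = {}"
      using I(1) inj by (auto simp: inj_def)
    show "card (\<sigma> ` I) = 5" using I inj by (metis card_image inj_on_subset subset_UNIV)
    show "card ((\<lambda>j. \<sigma> (n + j)) ` J) = 5" using J injJ by (simp add: card_image)
  next
    fix w assume w: "\<forall>i\<in>\<sigma> ` I. (\<Sum>j\<in>(\<lambda>j. \<sigma> (n + j)) ` J. F $$ (i, j) * w j) = 0"
    have "\<forall>i\<in>I. (\<Sum>j\<in>J. A $$ (i, j) * w (\<sigma> (n + j))) = 0"
    proof
      fix i assume i: "i \<in> I"
      have "(\<Sum>j\<in>J. A $$ (i, j) * w (\<sigma> (n + j))) = (\<Sum>j\<in>J. F $$ (\<sigma> i, \<sigma> (n + j)) * w (\<sigma> (n + j)))"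
        using I(1) J(1) i by (intro sum.cong) (auto simp: entry subset_iff)
      also have "\<dots> = 0" using w i injJ by (simp add: sum.reindex o_def)
      finally show "(\<Sum>j\<in>J. A $$ (i, j) * w (\<sigma> (n + j))) = 0" .
    qed
    from I(3)[OF this] show "\<forall>j\<in>(\<lambda>j. \<sigma> (n + j)) ` J. w j = 0" by auto
  qed
qed

section \<open>Polarization and integrality of the form\<close>

text \<open>The cross term of \<open>qform\<close> is twice this form. The factor 2 is kept outside
  because only \<open>2 * bform\<close> is integral on integer vectors: the off-diagonal entries of
  \<open>F\<close> may be half-integers.\<close>

definition bform :: "nat \<Rightarrow> real mat \<Rightarrow> (nat \<Rightarrow> real) \<Rightarrow> (nat \<Rightarrow> real) \<Rightarrow> real" where
  "bform s F x y = (\<Sum>i<s. \<Sum>j<s. F $$ (i, j) * x i * y j)"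

lemma qform_eq_bform: "qform s F x = bform s F x x"
  by (simp add: qform_def bform_def)

lemma bform_add_left: "bform s F (\<lambda>i. x i + y i) z = bform s F x z + bform s F y z"
  by (simp add: bform_def ring_distribs sum.distrib)

lemma bform_add_right: "bform s F z (\<lambda>i. x i + y i) = bform s F z x + bform s F z y"
  by (simp add: bform_def ring_distribs sum.distrib)

lemma qform_cong: "(\<And>i. i < s \<Longrightarrow> x i = y i) \<Longrightarrow> qform s F x = qform s F y"
  by (simp add: qform_def)

lemma bform_commute:
  assumes "integral_form_matrix s F"
  shows "bform s F x y = bform s F y x"
proof -
  have sym: "F $$ (i, j) = F $$ (j, i)" if "i < s" "j < s" for i j
    using assms that unfolding integral_form_matrix_def
    by (metis carrier_matD(1) carrier_matD(2) index_transpose_mat(1))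
  have "bform s F x y = (\<Sum>j<s. \<Sum>i<s. F $$ (i, j) * x i * y j)"
    unfolding bform_def by (rule sum.swap)
  also have "\<dots> = bform s F y x"
    unfolding bform_def by (intro sum.cong refl) (auto simp: sym)
  finally show ?thesis .
qed

lemma two_F_Ints:
  assumes "integral_form_matrix s F" "i < s" "j < s"
  shows "2 * F $$ (i, j) \<in> \<int>"
  using assms by (cases "i = j") (auto simp: integral_form_matrix_def intro: Ints_mult)

lemma two_bform_Ints:
  assumes "integral_form_matrix s F" "\<And>i. i < s \<Longrightarrow> x i \<in> \<int>" "\<And>i. i < s \<Longrightarrow> y i \<in> \<int>"
  shows "2 * bform s F x y \<in> \<int>"
proof -
  have "2 * bform s F x y = (\<Sum>i<s. \<Sum>j<s. (2 * F $$ (i, j)) * x i * y j)"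
    by (simp add: bform_def sum_distrib_left mult_ac)
  also have "\<dots> \<in> \<int>"
    using assms by (intro Ints_sum Ints_mult two_F_Ints[OF assms(1)]) auto
  finally show ?thesis .
qed

lemma qform_add:
  assumes "integral_form_matrix s F"
  shows "qform s F (\<lambda>i. x i + y i) = qform s F x + qform s F y + 2 * bform s F x y"
  by (simp add: qform_eq_bform bform_add_left bform_add_right bform_commute[OF assms, of y x])

text \<open>The double sum is not integral term by term. Switching on one coordinate at a time adds
  a diagonal term and twice a bilinear value, and both are integers.\<close>

lemma qform_Ints:
  assumes F: "integral_form_matrix s F" and x: "\<And>i. i < s \<Longrightarrow> x i \<in> \<int>"
  shows "qform s F x \<in> \<int>"
proof -
  define y where "y n i = (if i < n then x i else 0)" for n i
  have "qform s F (y n) \<in> \<int>" if "n \<le> s" for n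
    using that
  proof (induction n)
    case 0
    then show ?case by (simp add: y_def qform_def)
  next
    case (Suc n)
    define d where "d i = (if i = n then x n else 0)" for i
    have "y (Suc n) = (\<lambda>i. y n i + d i)"
      by (auto simp: y_def d_def fun_eq_iff less_Suc_eq)
    then have "qform s F (y (Suc n)) = qform s F (y n) + qform s F d + 2 * bform s F (y n) d"
      using qform_add[OF F] by simp
    moreover have "qform s F d = F $$ (n, n) * x n * x n"
      unfolding qform_def d_def using Suc.prems
      by (simp add: if_distrib[of "\<lambda>z. _ * z"] if_distrib[of "\<lambda>z. z * _"] sum.delta cong: if_cong)
    moreover have "F $$ (n, n) \<in> \<int>" "x n \<in> \<int>"
      using F x Suc.prems by (auto simp: integral_form_matrix_def)
    moreover have "2 * bform s F (y n) d \<in> \<int>"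
      using x Suc.prems by (intro two_bform_Ints[OF F]) (auto simp: y_def d_def)
    ultimately show ?case using Suc by (auto intro!: Ints_add Ints_mult)
  qed
  from this[of s] show ?thesis
    by (simp add: y_def cong: qform_cong)
qed

text \<open>By polarization f(y + qk) = f(y) + q (q f(k) + 2 B(y, k)), with an integral
  bracket.\<close>

lemma qform_cong_mod:
  assumes F: "integral_form_matrix s F" and xy: "\<And>i. i < s \<Longrightarrow> [x i = y i] (mod q)"
  shows "\<exists>k::int. qform s F (\<lambda>i. of_int (x i)) = qform s F (\<lambda>i. of_int (y i)) + of_int (q * k)"
proof -
  have "\<forall>i. \<exists>k. i < s \<longrightarrow> x i = y i + q * k"
    using xy by (metis cong_iff_lin cong_sym)
  then obtain k where k: "\<And>i. i < s \<Longrightarrow> x i = y i + q * k i" by metis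
  have "qform s F (\<lambda>i. of_int (x i)) = qform s F (\<lambda>i. of_int (y i) + of_int q * of_int (k i))"
    by (rule qform_cong) (simp add: k)
  also have "\<dots> = qform s F (\<lambda>i. of_int (y i)) + of_int q * (of_int q * qform s F (\<lambda>i. of_int (k i))
      + 2 * bform s F (\<lambda>i. of_int (y i)) (\<lambda>i. of_int (k i)))"
    unfolding qform_add[OF F]
    by (simp add: qform_def bform_def sum_distrib_left ring_distribs mult_ac)
  finally have *: "qform s F (\<lambda>i. of_int (x i)) = qform s F (\<lambda>i. of_int (y i)) + of_int q * (of_int q * qform s F (\<lambda>i. of_int (k i))
      + 2 * bform s F (\<lambda>i. of_int (y i)) (\<lambda>i. of_int (k i)))" .
  have "of_int q * qform s F (\<lambda>i. of_int (k i)) + 2 * bform s F (\<lambda>i. of_int (y i)) (\<lambda>i. of_int (k i)) \<in> \<int>"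
    by (intro Ints_add Ints_mult Ints_of_int qform_Ints[OF F] two_bform_Ints[OF F])
  then obtain l where "of_int q * qform s F (\<lambda>i. of_int (k i)) + 2 * bform s F (\<lambda>i. of_int (y i)) (\<lambda>i. of_int (k i)) = of_int l"
    by (auto elim: Ints_cases)
  with * show ?thesis by (intro exI[of _ l]) simp
qed

section \<open>A Weyl-type inequality\<close>

text \<open>Cauchy's inequality in \<open>y\<close> removes \<beta>. Expanding the remaining square
  in pairs \<open>z, z'\<close> leaves a symmetric kernel whose row sums are at most
  \<open>K\<close>, and Schur's test bounds its quadratic form. The coefficients survive only
  through their square sums.\<close>

lemma bilinear_sum_schur:
  fixes \<beta> :: "'a \<Rightarrow> complex" and \<gamma> :: "'b \<Rightarrow> complex" and \<theta> :: "'a \<Rightarrow> 'b \<Rightarrow> real"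
  assumes K: "\<And>z. z \<in> Z \<Longrightarrow> (\<Sum>z'\<in>Z. cmod (\<Sum>y\<in>Y. e (\<theta> y z - \<theta> y z'))) \<le> K"
  shows "(cmod (\<Sum>y\<in>Y. \<Sum>z\<in>Z. \<beta> y * \<gamma> z * e (\<theta> y z)))\<^sup>2
    \<le> (\<Sum>y\<in>Y. (cmod (\<beta> y))\<^sup>2) * ((\<Sum>z\<in>Z. (cmod (\<gamma> z))\<^sup>2) * K)"
proof -
  define G where "G y = (\<Sum>z\<in>Z. \<gamma> z * e (\<theta> y z))" for y
  define k where "k z z' = cmod (\<Sum>y\<in>Y. e (\<theta> y z - \<theta> y z'))" for z z'
  have sym: "k z z' = k z' z" for z z'
  proof -
    have "cnj (e x) = e (- x)" for x using e_diff[of 0 x] by simp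
    then have "cnj (\<Sum>y\<in>Y. e (\<theta> y z - \<theta> y z')) = (\<Sum>y\<in>Y. e (\<theta> y z' - \<theta> y z))" by simp
    then show ?thesis unfolding k_def by (metis complex_mod_cnj)
  qed
  have "(\<Sum>y\<in>Y. \<Sum>z\<in>Z. \<beta> y * \<gamma> z * e (\<theta> y z)) = (\<Sum>y\<in>Y. \<beta> y * G y)"
    by (simp add: G_def sum_distrib_left mult_ac)
  then have "cmod (\<Sum>y\<in>Y. \<Sum>z\<in>Z. \<beta> y * \<gamma> z * e (\<theta> y z)) \<le> (\<Sum>y\<in>Y. cmod (\<beta> y) * cmod (G y))"
    using norm_sum[of "\<lambda>y. \<beta> y * G y" Y] by (simp add: norm_mult)
  then have "(cmod (\<Sum>y\<in>Y. \<Sum>z\<in>Z. \<beta> y * \<gamma> z * e (\<theta> y z)))\<^sup>2 \<le> (\<Sum>y\<in>Y. cmod (\<beta> y) * cmod (G y))\<^sup>2"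
    by (intro power_mono) auto
  also have "\<dots> \<le> (\<Sum>y\<in>Y. (cmod (\<beta> y))\<^sup>2) * (\<Sum>y\<in>Y. (cmod (G y))\<^sup>2)"
    by (rule Cauchy_Schwarz_ineq_sum)
  also have "(\<Sum>y\<in>Y. (cmod (G y))\<^sup>2) \<le> (\<Sum>z\<in>Z. (cmod (\<gamma> z))\<^sup>2) * K"
  proof -
    have "complex_of_real (\<Sum>y\<in>Y. (cmod (G y))\<^sup>2) = (\<Sum>y\<in>Y. G y * cnj (G y))"
      by (simp add: complex_norm_square flip: of_real_power)
    also have "\<dots> = (\<Sum>y\<in>Y. \<Sum>z\<in>Z. \<Sum>z'\<in>Z. \<gamma> z * cnj (\<gamma> z') * e (\<theta> y z - \<theta> y z'))"
      by (simp add: G_def sum_product e_diff mult_ac)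
    also have "\<dots> = (\<Sum>z\<in>Z. \<Sum>y\<in>Y. \<Sum>z'\<in>Z. \<gamma> z * cnj (\<gamma> z') * e (\<theta> y z - \<theta> y z'))"
      by (rule sum.swap)
    also have "\<dots> = (\<Sum>z\<in>Z. \<Sum>z'\<in>Z. \<Sum>y\<in>Y. \<gamma> z * cnj (\<gamma> z') * e (\<theta> y z - \<theta> y z'))"
      by (intro sum.cong refl sum.swap)
    finally have "\<bar>\<Sum>y\<in>Y. (cmod (G y))\<^sup>2\<bar> = cmod (\<Sum>z\<in>Z. \<Sum>z'\<in>Z. \<gamma> z * cnj (\<gamma> z') * (\<Sum>y\<in>Y. e (\<theta> y z - \<theta> y z')))"
      by (metis (no_types, lifting) norm_of_real sum.cong sum_distrib_left)
    also have "\<dots> \<le> (\<Sum>z\<in>Z. \<Sum>z'\<in>Z. cmod (\<gamma> z) * cmod (\<gamma> z') * k z z')"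
      by (intro sum_norm_le) (simp add: norm_mult k_def)
    \<comment> \<open>Schur's test: by the arithmetic-geometric mean inequality and the symmetry of
      \<open>k\<close>, both halves equal the same sum over rows.\<close>
    also have "\<dots> \<le> (\<Sum>z\<in>Z. \<Sum>z'\<in>Z. ((cmod (\<gamma> z))\<^sup>2 / 2 + (cmod (\<gamma> z'))\<^sup>2 / 2) * k z z')"
      using sum_squares_bound[of "cmod (\<gamma> _)" "cmod (\<gamma> _)"]
      by (intro sum_mono mult_right_mono) (auto simp: k_def field_simps)
    also have "\<dots> = (\<Sum>z\<in>Z. \<Sum>z'\<in>Z. (cmod (\<gamma> z))\<^sup>2 / 2 * k z z') + (\<Sum>z\<in>Z. \<Sum>z'\<in>Z. (cmod (\<gamma> z'))\<^sup>2 / 2 * k z z')"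
      by (simp add: ring_distribs sum.distrib)
    also have "(\<Sum>z\<in>Z. \<Sum>z'\<in>Z. (cmod (\<gamma> z'))\<^sup>2 / 2 * k z z') = (\<Sum>z\<in>Z. \<Sum>z'\<in>Z. (cmod (\<gamma> z))\<^sup>2 / 2 * k z z')"
      by (subst sum.swap) (simp add: sym)
    also have "(\<Sum>z\<in>Z. \<Sum>z'\<in>Z. (cmod (\<gamma> z))\<^sup>2 / 2 * k z z') \<le> (\<Sum>z\<in>Z. (cmod (\<gamma> z))\<^sup>2 / 2 * K)"
      unfolding sum_distrib_left[symmetric] k_def using K
      by (intro sum_mono mult_left_mono) auto
    finally show ?thesis by (simp add: sum_distrib_right flip: sum_divide_distrib)
  qed
  finally show ?thesis by (simp add: mult_left_mono sum_nonneg)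
qed

lemma sum_PiE_Un:
  assumes "A \<inter> B = {}"
  shows "(\<Sum>x\<in>A \<union> B \<rightarrow>\<^sub>E D. g x) = (\<Sum>u\<in>A \<rightarrow>\<^sub>E D. \<Sum>v\<in>B \<rightarrow>\<^sub>E D. g (\<lambda>i. if i \<in> A then u i else v i))"
  unfolding sum.cartesian_product
  by (rule sum.reindex_bij_witness[of _ "\<lambda>(u, v). \<lambda>i. if i \<in> A then u i else v i" "\<lambda>x. (restrict x A, restrict x B)"])
    (use assms in \<open>auto simp: PiE_def extensional_def fun_eq_iff restrict_def intro!: arg_cong[of _ _ g]\<close>)

lemma sum_PiE_prod:
  fixes f :: "'b \<Rightarrow> 'c :: comm_semiring_1"
  assumes "finite A" "finite D"
  shows "(\<Sum>x\<in>A \<rightarrow>\<^sub>E D. \<Prod>i\<in>A. f (x i)) = (\<Sum>d\<in>D. f d) ^ card A"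
  using prod_sum_PiE[of A "\<lambda>_. D" "\<lambda>_. f"] assms by simp

text \<open>Serves twice: as a bound for the linear forms with coefficients
  \<open>2 * F $$ (i, j)\<close>, and as the constant in the Lipschitz bound for f on a box.\<close>

definition coeff_norm :: "nat \<Rightarrow> real mat \<Rightarrow> real" where
  "coeff_norm s F = (\<Sum>i<s. \<Sum>j<s. \<bar>2 * F $$ (i, j)\<bar>)"

lemma coeff_norm_nonneg: "coeff_norm s F \<ge> 0"
  by (simp add: coeff_norm_def sum_nonneg)

text \<open>By nonsingularity the map \<phi> from \<open>z'\<close> to the integer vector of linear
  forms is injective, with image in a box of half-width \<open>M\<close>. As all terms are
  nonnegative, the sum may be extended to the whole box, where it factors into copies of
  \<open>Tsum\<close>. The labelling \<iota> lets \<open>D\<close> be a set of naturals or a set of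
  residues.\<close>

lemma kern_sum_system:
  fixes \<iota> :: "'a \<Rightarrow> int"
  assumes F: "integral_form_matrix s F"
    and IJ: "I \<subseteq> {..<s}" "J \<subseteq> {..<s}"
    and nonsing: "\<And>w. \<forall>i\<in>I. (\<Sum>j\<in>J. F $$ (i, j) * w j) = 0 \<Longrightarrow> \<forall>j\<in>J. w j = 0"
    and \<iota>: "bij_betw \<iota> D {0..<int N}" and M: "coeff_norm s F * N \<le> M"
    and z: "z \<in> J \<rightarrow>\<^sub>E D"
  shows "(\<Sum>z'\<in>J \<rightarrow>\<^sub>E D. \<Prod>i\<in>I. kern N (\<alpha> * (\<Sum>j\<in>J. 2 * F $$ (i, j) * (of_int (\<iota> (z j)) - of_int (\<iota> (z' j))))))
    \<le> Tsum \<alpha> N M ^ card I"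
proof -
  have fin: "finite I" "finite J" using IJ finite_subset by blast+
  have finD: "finite D" using \<iota> bij_betw_finite by blast
  define V where "V z' i = (\<Sum>j\<in>J. 2 * F $$ (i, j) * (of_int (\<iota> (z j)) - of_int (\<iota> (z' j))))" for z' i
  have Vint: "V z' i \<in> \<int>" if "i \<in> I" for z' i
    unfolding V_def using that IJ by (intro Ints_sum Ints_mult two_F_Ints[OF F]) auto
  have V: "of_int \<lfloor>V z' i\<rfloor> = V z' i" if "i \<in> I" for z' i
    using Vint[OF that, of z'] by (auto elim!: Ints_cases)
  have range: "\<bar>V z' i\<bar> \<le> M" if "i \<in> I" "z' \<in> J \<rightarrow>\<^sub>E D" for z' i
  proof -
    have "\<bar>V z' i\<bar> \<le> (\<Sum>j\<in>J. \<bar>2 * F $$ (i, j)\<bar> * N)"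
      unfolding V_def
    proof (rule order_trans[OF sum_abs], intro sum_mono)
      fix j assume j: "j \<in> J"
      have "\<iota> (z j) \<in> {0..<int N}" "\<iota> (z' j) \<in> {0..<int N}"
        using \<iota> z that(2) j by (auto simp: bij_betw_def PiE_iff)
      then have "\<bar>real_of_int (\<iota> (z j)) - real_of_int (\<iota> (z' j))\<bar> \<le> N" by auto
      then show "\<bar>2 * F $$ (i, j) * (real_of_int (\<iota> (z j)) - real_of_int (\<iota> (z' j)))\<bar> \<le> \<bar>2 * F $$ (i, j)\<bar> * N"
        unfolding abs_mult by (intro mult_left_mono) auto
    qed
    also have "\<dots> \<le> (\<Sum>j<s. \<bar>2 * F $$ (i, j)\<bar> * N)" using IJ by (intro sum_mono2) auto
    also have "\<dots> \<le> (\<Sum>i<s. \<Sum>j<s. \<bar>2 * F $$ (i, j)\<bar> * N)"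
      using that IJ by (intro member_le_sum) (auto intro!: sum_nonneg)
    also have "\<dots> = coeff_norm s F * N" by (simp add: coeff_norm_def sum_distrib_right)
    finally show ?thesis using M by simp
  qed
  define \<phi> where "\<phi> z' = restrict (\<lambda>i. \<lfloor>V z' i\<rfloor>) I" for z'
  have inj: "inj_on \<phi> (J \<rightarrow>\<^sub>E D)"
  proof (rule inj_onI)
    fix u v assume uv: "u \<in> J \<rightarrow>\<^sub>E D" "v \<in> J \<rightarrow>\<^sub>E D" "\<phi> u = \<phi> v"
    have eq: "V u i = V v i" if "i \<in> I" for i
    proof -
      have "\<lfloor>V u i\<rfloor> = \<lfloor>V v i\<rfloor>" using fun_cong[OF uv(3), of i] that by (simp add: \<phi>_def)
      then show ?thesis using V[OF that, of u] V[OF that, of v] by metis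
    qed
    have "\<forall>i\<in>I. (\<Sum>j\<in>J. F $$ (i, j) * (of_int (\<iota> (v j)) - of_int (\<iota> (u j)))) = 0"
    proof
      fix i assume "i \<in> I"
      have "2 * (\<Sum>j\<in>J. F $$ (i, j) * (of_int (\<iota> (v j)) - of_int (\<iota> (u j)))) = V u i - V v i"
        by (simp add: V_def sum_distrib_left ring_distribs sum_subtractf sum.distrib mult.assoc)
      then show "(\<Sum>j\<in>J. F $$ (i, j) * (of_int (\<iota> (v j)) - of_int (\<iota> (u j)))) = 0"
        using eq[OF \<open>i \<in> I\<close>] by simp
    qed
    from nonsing[OF this] have "\<iota> (v j) = \<iota> (u j)" if "j \<in> J" for j using that by auto
    then have "v j = u j" if "j \<in> J" for j
      using that PiE_mem[OF uv(1) that] PiE_mem[OF uv(2) that] \<iota>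
      by (auto simp: bij_betw_def dest: inj_onD)
    then show "u = v" by (intro PiE_ext[OF uv(1,2)]) simp
  qed
  have "(\<Sum>z'\<in>J \<rightarrow>\<^sub>E D. \<Prod>i\<in>I. kern N (\<alpha> * V z' i)) = (\<Sum>z'\<in>J \<rightarrow>\<^sub>E D. \<Prod>i\<in>I. kern N (\<alpha> * of_int (\<phi> z' i)))"
    by (intro sum.cong prod.cong refl) (simp add: \<phi>_def V)
  also have "\<dots> = (\<Sum>v\<in>\<phi> ` (J \<rightarrow>\<^sub>E D). \<Prod>i\<in>I. kern N (\<alpha> * of_int (v i)))"
    using inj by (simp add: sum.reindex)
  also have "\<dots> \<le> (\<Sum>v\<in>I \<rightarrow>\<^sub>E {- int M..int M}. \<Prod>i\<in>I. kern N (\<alpha> * of_int (v i)))"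
  proof (intro sum_mono2)
    show "\<phi> ` (J \<rightarrow>\<^sub>E D) \<subseteq> I \<rightarrow>\<^sub>E {- int M..int M}"
    proof (rule image_subsetI)
      fix z' assume z': "z' \<in> J \<rightarrow>\<^sub>E D"
      have "\<lfloor>V z' i\<rfloor> \<in> {- int M..int M}" if "i \<in> I" for i
      proof -
        have "\<bar>real_of_int \<lfloor>V z' i\<rfloor>\<bar> \<le> real_of_int (int M)" unfolding V[OF that] using range[OF that z'] by simp
        then show ?thesis by (simp only: atLeastAtMost_iff) linarith
      qed
      then show "\<phi> z' \<in> I \<rightarrow>\<^sub>E {- int M..int M}" by (auto simp: \<phi>_def)
    qed
  qed (auto intro!: finite_PiE fin prod_nonneg)
  also have "\<dots> = Tsum \<alpha> N M ^ card I"
    unfolding Tsum_def using fin by (intro sum_PiE_prod) auto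
  finally show ?thesis by (simp add: V_def)
qed

lemma bform_supported:
  assumes "I \<subseteq> {..<s}" "J \<subseteq> {..<s}"
  shows "bform s F (\<lambda>i. if i \<in> I then y i else 0) (\<lambda>j. if j \<in> J then z j else 0)
    = (\<Sum>i\<in>I. \<Sum>j\<in>J. F $$ (i, j) * y i * z j)"
proof -
  have "bform s F (\<lambda>i. if i \<in> I then y i else 0) (\<lambda>j. if j \<in> J then z j else 0)
    = (\<Sum>i\<in>I. \<Sum>j<s. F $$ (i, j) * y i * (if j \<in> J then z j else 0))"
    unfolding bform_def using assms(1) by (intro sum.mono_neutral_cong_right) auto
  also have "\<dots> = (\<Sum>i\<in>I. \<Sum>j\<in>J. F $$ (i, j) * y i * z j)"
    using assms(2) by (intro sum.cong refl sum.mono_neutral_cong_right) auto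
  finally show ?thesis .
qed

text \<open>For fixed \<open>w\<close> outside the two blocks, Cauchy's inequality and Schur's test
  give a square bounded by two factors, each a fifth power of the sum of squares of
  \<open>b\<close>, times \<open>Tsum\<close> to the fifth power; the root explains the exponents.
  The remaining \<open>s - 10\<close> variables are summed trivially.\<close>

lemma weyl_sum_bound:
  fixes b :: "'a \<Rightarrow> real" and \<iota> :: "'a \<Rightarrow> int"
  assumes F: "integral_form_matrix s F"
    and IJ: "I \<subseteq> {..<s}" "J \<subseteq> {..<s}" "I \<inter> J = {}" "card I = 5" "card J = 5"
    and nonsing: "\<And>w. \<forall>i\<in>I. (\<Sum>j\<in>J. F $$ (i, j) * w j) = 0 \<Longrightarrow> \<forall>j\<in>J. w j = 0"
    and \<iota>: "bij_betw \<iota> D {0..<int N}" and M: "coeff_norm s F * N \<le> M"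
    and b: "\<And>x. x \<in> D \<Longrightarrow> b x \<ge> 0"
  shows "cmod (\<Sum>x\<in>{..<s} \<rightarrow>\<^sub>E D. of_real (\<Prod>i<s. b (x i)) * e (\<alpha> * qform s F (\<lambda>i. of_int (\<iota> (x i)))))
    \<le> (\<Sum>x\<in>D. b x) ^ (s - 10) * (\<Sum>x\<in>D. (b x)\<^sup>2) ^ 5 * sqrt (Tsum \<alpha> N M ^ 5)"
proof -
  have fin: "finite I" "finite J" using IJ finite_subset by blast+
  have finD: "finite D" using \<iota> bij_betw_finite by blast
  define R where "R = {..<s} - (I \<union> J)"
  have finR: "finite R" by (simp add: R_def)
  have s_eq: "{..<s} = R \<union> (I \<union> J)" and disj: "R \<inter> (I \<union> J) = {}" using IJ by (auto simp: R_def)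
  have cardR: "card R = s - 10"
    using IJ fin by (simp add: R_def card_Diff_subset card_Un_disjoint)
  define vec where "vec A x i = (if i \<in> A then real_of_int (\<iota> (x i)) else 0)" for A and x :: "nat \<Rightarrow> 'a" and i
  define mk where "mk w y z = (\<lambda>i. if i \<in> R then w i else if i \<in> I then y i else z i)" for w y z :: "nat \<Rightarrow> 'a"
  \<comment> \<open>Every phase that does not couple \<open>y\<close> with \<open>z\<close> has
    modulus one and is absorbed: \<beta> takes the form in \<open>w\<close> and \<open>y\<close>,
    \<gamma> the form in \<open>z\<close> with its coupling to \<open>w\<close>. Only the bilinear
    phase \<theta> is left.\<close>
  define \<beta> where "\<beta> w y = of_real (\<Prod>i\<in>I. b (y i)) * e (\<alpha> * qform s F (\<lambda>i. vec R w i + vec I y i))" for w y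
  define \<gamma> where "\<gamma> w z = of_real (\<Prod>i\<in>J. b (z i)) * e (\<alpha> * (qform s F (vec J z) + 2 * bform s F (vec R w) (vec J z)))" for w z
  define \<theta> where "\<theta> y z = \<alpha> * (2 * bform s F (vec I y) (vec J z))" for y z
  have split: "of_real (\<Prod>i<s. b (mk w y z i)) * e (\<alpha> * qform s F (\<lambda>i. of_int (\<iota> (mk w y z i))))
      = of_real (\<Prod>i\<in>R. b (w i)) * (\<beta> w y * \<gamma> w z * e (\<theta> y z))" for w y z
  proof -
    have "(\<Prod>i<s. b (mk w y z i)) = (\<Prod>i\<in>R. b (mk w y z i)) * ((\<Prod>i\<in>I. b (mk w y z i)) * (\<Prod>i\<in>J. b (mk w y z i)))"
      unfolding s_eq using disj IJ fin finR by (subst prod.union_disjoint) (auto simp: prod.union_disjoint)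
    also have "(\<Prod>i\<in>R. b (mk w y z i)) = (\<Prod>i\<in>R. b (w i))" by (simp add: mk_def)
    also have "(\<Prod>i\<in>I. b (mk w y z i)) = (\<Prod>i\<in>I. b (y i))"
      using disj by (intro prod.cong) (auto simp: mk_def)
    also have "(\<Prod>i\<in>J. b (mk w y z i)) = (\<Prod>i\<in>J. b (z i))"
      using disj IJ(3) by (intro prod.cong) (auto simp: mk_def)
    finally have 1: "(\<Prod>i<s. b (mk w y z i)) = (\<Prod>i\<in>R. b (w i)) * ((\<Prod>i\<in>I. b (y i)) * (\<Prod>i\<in>J. b (z i)))" .
    have "qform s F (\<lambda>i. of_int (\<iota> (mk w y z i))) = qform s F (\<lambda>i. (vec R w i + vec I y i) + vec J z i)"
      using s_eq disj IJ(3) by (intro qform_cong) (auto simp: mk_def vec_def)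
    also have "\<dots> = qform s F (\<lambda>i. vec R w i + vec I y i) + (qform s F (vec J z) + 2 * bform s F (vec R w) (vec J z))
        + 2 * bform s F (vec I y) (vec J z)"
      unfolding qform_add[OF F, of "\<lambda>i. vec R w i + vec I y i" "vec J z"] bform_add_left by simp
    finally have 2: "e (\<alpha> * qform s F (\<lambda>i. of_int (\<iota> (mk w y z i)))) = e (\<alpha> * qform s F (\<lambda>i. vec R w i + vec I y i))
      * e (\<alpha> * (qform s F (vec J z) + 2 * bform s F (vec R w) (vec J z))) * e (\<theta> y z)"
      by (simp add: \<theta>_def distrib_left e_add)
    show ?thesis unfolding 1 2 \<beta>_def \<gamma>_def by simp
  qed
  have K: "(\<Sum>z'\<in>J \<rightarrow>\<^sub>E D. cmod (\<Sum>y\<in>I \<rightarrow>\<^sub>E D. e (\<theta> y z - \<theta> y z'))) \<le> Tsum \<alpha> N M ^ 5"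
    if z: "z \<in> J \<rightarrow>\<^sub>E D" for z
  proof -
    \<comment> \<open>The phase difference is linear in \<open>y\<close>, so the sum over
      \<open>y\<close> is a product of geometric sums.\<close>
    have "cmod (\<Sum>y\<in>I \<rightarrow>\<^sub>E D. e (\<theta> y z - \<theta> y z')) = (\<Prod>i\<in>I. kern N (\<alpha> * (\<Sum>j\<in>J. 2 * F $$ (i, j) * (of_int (\<iota> (z j)) - of_int (\<iota> (z' j))))))"
      for z'
    proof -
      define V where "V i = \<alpha> * (\<Sum>j\<in>J. 2 * F $$ (i, j) * (of_int (\<iota> (z j)) - of_int (\<iota> (z' j))))" for i
      have "\<theta> y z - \<theta> y z' = (\<Sum>i\<in>I. of_int (\<iota> (y i)) * V i)" for y
        unfolding \<theta>_def vec_def V_def bform_supported[OF IJ(1,2)]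
        by (simp add: sum_distrib_left right_diff_distrib sum_subtractf mult_ac)
      then have "(\<Sum>y\<in>I \<rightarrow>\<^sub>E D. e (\<theta> y z - \<theta> y z')) = (\<Sum>y\<in>I \<rightarrow>\<^sub>E D. \<Prod>i\<in>I. e (of_int (\<iota> (y i)) * V i))"
        by (simp add: e_sum)
      also have "\<dots> = (\<Prod>i\<in>I. \<Sum>d\<in>D. e (of_int (\<iota> d) * V i))"
        using prod_sum_PiE[of I "\<lambda>_. D" "\<lambda>i d. e (of_int (\<iota> d) * V i)"] fin finD by simp
      also have "\<dots> = (\<Prod>i\<in>I. \<Sum>y<N. e (real y * V i))"
      proof (intro prod.cong refl)
        fix i
        have "(\<Sum>d\<in>D. e (of_int (\<iota> d) * V i)) = (\<Sum>k\<in>{0..<int N}. e (of_int k * V i))"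
          using \<iota> by (rule sum.reindex_bij_betw)
        also have "\<dots> = (\<Sum>y<N. e (real y * V i))"
          by (rule sum.reindex_bij_witness[of _ int nat]) auto
        finally show "(\<Sum>d\<in>D. e (of_int (\<iota> d) * V i)) = (\<Sum>y<N. e (real y * V i))" .
      qed
      finally show ?thesis by (simp add: kern_def prod_norm[symmetric] V_def)
    qed
    then show ?thesis
      using kern_sum_system[OF F IJ(1,2) nonsing \<iota> M z, of \<alpha>] IJ by simp
  qed
  have inner: "cmod (\<Sum>y\<in>I \<rightarrow>\<^sub>E D. \<Sum>z\<in>J \<rightarrow>\<^sub>E D. \<beta> w y * \<gamma> w z * e (\<theta> y z)) \<le> (\<Sum>x\<in>D. (b x)\<^sup>2) ^ 5 * sqrt (Tsum \<alpha> N M ^ 5)" for w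
  proof (rule power2_le_imp_le)
    have "(\<Sum>y\<in>I \<rightarrow>\<^sub>E D. (cmod (\<beta> w y))\<^sup>2) = (\<Sum>y\<in>I \<rightarrow>\<^sub>E D. \<Prod>i\<in>I. (b (y i))\<^sup>2)"
      by (simp add: \<beta>_def norm_mult prod_power_distrib[symmetric] flip: of_real_prod)
    also have "\<dots> = (\<Sum>x\<in>D. (b x)\<^sup>2) ^ 5"
      using sum_PiE_prod[of I D "\<lambda>x. (b x)\<^sup>2"] fin finD IJ by simp
    finally have 1: "(\<Sum>y\<in>I \<rightarrow>\<^sub>E D. (cmod (\<beta> w y))\<^sup>2) = (\<Sum>x\<in>D. (b x)\<^sup>2) ^ 5" .
    have "(\<Sum>z\<in>J \<rightarrow>\<^sub>E D. (cmod (\<gamma> w z))\<^sup>2) = (\<Sum>z\<in>J \<rightarrow>\<^sub>E D. \<Prod>i\<in>J. (b (z i))\<^sup>2)"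
      by (simp add: \<gamma>_def norm_mult prod_power_distrib[symmetric] flip: of_real_prod)
    also have "\<dots> = (\<Sum>x\<in>D. (b x)\<^sup>2) ^ 5"
      using sum_PiE_prod[of J D "\<lambda>x. (b x)\<^sup>2"] fin finD IJ by simp
    finally have 2: "(\<Sum>z\<in>J \<rightarrow>\<^sub>E D. (cmod (\<gamma> w z))\<^sup>2) = (\<Sum>x\<in>D. (b x)\<^sup>2) ^ 5" .
    have "(cmod (\<Sum>y\<in>I \<rightarrow>\<^sub>E D. \<Sum>z\<in>J \<rightarrow>\<^sub>E D. \<beta> w y * \<gamma> w z * e (\<theta> y z)))\<^sup>2
        \<le> (\<Sum>y\<in>I \<rightarrow>\<^sub>E D. (cmod (\<beta> w y))\<^sup>2) * ((\<Sum>z\<in>J \<rightarrow>\<^sub>E D. (cmod (\<gamma> w z))\<^sup>2) * Tsum \<alpha> N M ^ 5)"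
      by (rule bilinear_sum_schur) (rule K)
    also have "\<dots> = ((\<Sum>x\<in>D. (b x)\<^sup>2) ^ 5 * sqrt (Tsum \<alpha> N M ^ 5))\<^sup>2"
      unfolding 1 2 by (simp add: power_mult_distrib flip: power_add power_mult)
    finally show "(cmod (\<Sum>y\<in>I \<rightarrow>\<^sub>E D. \<Sum>z\<in>J \<rightarrow>\<^sub>E D. \<beta> w y * \<gamma> w z * e (\<theta> y z)))\<^sup>2
        \<le> ((\<Sum>x\<in>D. (b x)\<^sup>2) ^ 5 * sqrt (Tsum \<alpha> N M ^ 5))\<^sup>2" .
  qed (auto intro!: mult_nonneg_nonneg sum_nonneg)
  have "(\<Sum>x\<in>{..<s} \<rightarrow>\<^sub>E D. of_real (\<Prod>i<s. b (x i)) * e (\<alpha> * qform s F (\<lambda>i. of_int (\<iota> (x i)))))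
     = (\<Sum>w\<in>R \<rightarrow>\<^sub>E D. \<Sum>y\<in>I \<rightarrow>\<^sub>E D. \<Sum>z\<in>J \<rightarrow>\<^sub>E D.
        of_real (\<Prod>i<s. b (mk w y z i)) * e (\<alpha> * qform s F (\<lambda>i. of_int (\<iota> (mk w y z i)))))"
    unfolding s_eq[THEN arg_cong[of _ _ "\<lambda>A. sum _ (A \<rightarrow>\<^sub>E D)"]] sum_PiE_Un[OF disj] sum_PiE_Un[OF IJ(3)] mk_def
    by (rule refl)
  also have "\<dots> = (\<Sum>w\<in>R \<rightarrow>\<^sub>E D. of_real (\<Prod>i\<in>R. b (w i)) *
       (\<Sum>y\<in>I \<rightarrow>\<^sub>E D. \<Sum>z\<in>J \<rightarrow>\<^sub>E D. \<beta> w y * \<gamma> w z * e (\<theta> y z)))"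
    unfolding split by (simp only: sum_distrib_left)
  also have "cmod \<dots> \<le> (\<Sum>w\<in>R \<rightarrow>\<^sub>E D. (\<Prod>i\<in>R. b (w i)) * ((\<Sum>x\<in>D. (b x)\<^sup>2) ^ 5 * sqrt (Tsum \<alpha> N M ^ 5)))"
  proof (rule sum_norm_le)
    fix w assume w: "w \<in> R \<rightarrow>\<^sub>E D"
    then have nn: "(\<Prod>i\<in>R. b (w i)) \<ge> 0" by (intro prod_nonneg b) auto
    show "cmod (of_real (\<Prod>i\<in>R. b (w i)) * (\<Sum>y\<in>I \<rightarrow>\<^sub>E D. \<Sum>z\<in>J \<rightarrow>\<^sub>E D. \<beta> w y * \<gamma> w z * e (\<theta> y z)))
      \<le> (\<Prod>i\<in>R. b (w i)) * ((\<Sum>x\<in>D. (b x)\<^sup>2) ^ 5 * sqrt (Tsum \<alpha> N M ^ 5))"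
      unfolding norm_mult norm_of_real using nn inner[of w] by (intro mult_mono) auto
  qed
  also have "\<dots> = (\<Sum>x\<in>D. b x) ^ (s - 10) * ((\<Sum>x\<in>D. (b x)\<^sup>2) ^ 5 * sqrt (Tsum \<alpha> N M ^ 5))"
    using sum_PiE_prod[OF finR finD, of b] cardR by (simp flip: sum_distrib_right)
  finally show ?thesis by (simp add: mult_ac)
qed

section \<open>Densities of the weight sequence\<close>

lemma bigo_imp_bound_from_1:
  fixes f g :: "nat \<Rightarrow> real"
  assumes "f \<in> O(g)" "\<And>n. n \<ge> 1 \<Longrightarrow> g n > 0"
  shows "\<exists>C\<ge>0. \<forall>n\<ge>1. \<bar>f n\<bar> \<le> C * g n"
proof -
  obtain c where c: "c > 0" "eventually (\<lambda>n. \<bar>f n\<bar> \<le> c * \<bar>g n\<bar>) sequentially"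
    using assms(1) by (auto elim!: landau_o.bigE)
  then obtain N where N: "\<And>n. n \<ge> N \<Longrightarrow> \<bar>f n\<bar> \<le> c * \<bar>g n\<bar>" by (auto simp: eventually_sequentially)
  define C where "C = c + (\<Sum>n\<in>{1..N}. \<bar>f n\<bar> / g n)"
  have nn: "(\<Sum>n\<in>{1..N}. \<bar>f n\<bar> / g n) \<ge> 0" using assms(2) by (intro sum_nonneg) (simp add: less_imp_le)
  have "\<bar>f n\<bar> \<le> C * g n" if n: "n \<ge> 1" for n
  proof (cases "n \<ge> N")
    case True
    have "\<bar>f n\<bar> \<le> c * g n" using N[OF True] assms(2)[OF n] by simp
    also have "\<dots> \<le> C * g n" using nn assms(2)[OF n] by (intro mult_right_mono) (auto simp: C_def)
    finally show ?thesis .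
  next
    case False
    have "\<bar>f n\<bar> / g n \<le> (\<Sum>n\<in>{1..N}. \<bar>f n\<bar> / g n)"
      using False n assms(2) by (intro member_le_sum) (auto simp: less_imp_le)
    also have "\<dots> \<le> C" using c by (simp add: C_def)
    finally show ?thesis using assms(2)[OF n] by (simp add: field_simps)
  qed
  moreover have "C \<ge> 0" using nn c by (simp add: C_def)
  ultimately show ?thesis by blast
qed

locale weight_densities =
  fixes a :: "nat \<Rightarrow> real" and QD :: "real \<Rightarrow> real" and \<kappa> :: "nat \<Rightarrow> int \<Rightarrow> real"
  assumes a_nonneg: "\<And>x. a x \<ge> 0"
    and wsum_at_top: "filterlim (wsum a) at_top at_top"
    and D: "condition_D a QD \<kappa>"
    and level: "level_beyond_log_powers QD"
    and C: "condition_C QD \<kappa>"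
    and K: "condition_K \<kappa>"
begin

lemma eventually_wsum_ge: "eventually (\<lambda>X. wsum a X \<ge> c) at_top"
  using wsum_at_top by (simp add: filterlim_at_top)

lemma eventually_QD_ge: "eventually (\<lambda>X. QD X \<ge> c) at_top"
proof -
  have "eventually (\<lambda>X. ln X powr 1 \<le> QD X) at_top"
    using level unfolding level_beyond_log_powers_def by blast
  moreover have "eventually (\<lambda>X::real. ln X \<ge> max c 1) at_top"
    using ln_at_top unfolding filterlim_at_top by blast
  ultimately show ?thesis by eventually_elim auto
qed

lemma D_bound:
  "\<exists>C. \<forall>X>1. \<forall>q\<ge>1. real q \<le> QD X \<longrightarrow>
     (\<forall>h. \<bar>wsum_ap a q h X - \<kappa> q h * wsum a X\<bar> \<le> C * (wsum a X / ln X ^ m))"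
  by (rule conjunct2[OF conjunct2[OF D[unfolded condition_D_def]], THEN spec])

text \<open>For fixed \<open>q\<close> the level eventually exceeds \<open>q\<close>, so Condition D
  identifies \<kappa> as the actual density of a residue class. Uniqueness of limits then yields
  periodicity, additivity and total mass 1, none of which is assumed.\<close>

lemma kappa_tendsto:
  assumes "q \<ge> 1"
  shows "((\<lambda>X. wsum_ap a q h X / wsum a X) \<longlongrightarrow> \<kappa> q h) at_top"
proof -
  obtain B where B: "\<And>X q h. X > 1 \<Longrightarrow> q \<ge> 1 \<Longrightarrow> real q \<le> QD X \<Longrightarrow>
      \<bar>wsum_ap a q h X - \<kappa> q h * wsum a X\<bar> \<le> B * (wsum a X / ln X ^ 1)"
    using D_bound[of 1] by blast
  have "eventually (\<lambda>X. norm (wsum_ap a q h X / wsum a X - \<kappa> q h) \<le> B / ln X) at_top"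
    using eventually_wsum_ge[of 1] eventually_QD_ge[of "real q"] eventually_gt_at_top[of "1::real"]
  proof eventually_elim
    case (elim X)
    have "norm (wsum_ap a q h X / wsum a X - \<kappa> q h) = \<bar>wsum_ap a q h X - \<kappa> q h * wsum a X\<bar> / wsum a X"
      using elim by (simp add: field_simps abs_divide[symmetric])
    also have "\<dots> \<le> (B * (wsum a X / ln X ^ 1)) / wsum a X"
      using B[OF _ assms elim(2), of h] elim by (intro divide_right_mono) auto
    finally show ?case using elim by simp
  qed
  moreover have "((\<lambda>X::real. B / ln X) \<longlongrightarrow> 0) at_top" by real_asymp
  ultimately have "((\<lambda>X. wsum_ap a q h X / wsum a X - \<kappa> q h) \<longlongrightarrow> 0) at_top"
    by (rule Lim_null_comparison)
  then show ?thesis by (rule LIM_zero_cancel)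
qed

lemma kappa_nonneg:
  assumes "q \<ge> 1"
  shows "\<kappa> q h \<ge> 0"
proof -
  obtain X where "X > 1" "real q \<le> QD X"
    using eventually_happens'[OF _ eventually_conj[OF eventually_gt_at_top[of "1::real"] eventually_QD_ge[of "real q"]]]
    by auto
  then show ?thesis using conjunct1[OF conjunct2[OF D[unfolded condition_D_def]]] assms by blast
qed

lemma kappa_cong:
  assumes "q \<ge> 1" "[h = h'] (mod int q)"
  shows "\<kappa> q h = \<kappa> q h'"
proof -
  have "wsum_ap a q h = wsum_ap a q h'"
    using assms(2) by (auto simp: wsum_ap_def fun_eq_iff cong_def)
  then show ?thesis
    using kappa_tendsto[OF assms(1), of h] kappa_tendsto[OF assms(1), of h']
    by (intro tendsto_unique[of at_top]) auto
qed

text \<open>A class modulo \<open>d\<close> is the disjoint union of the classes modulo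
  \<open>q\<close> above it. The identity holds for the weighted counts at every X and passes to the
  limit.\<close>

lemma kappa_sum:
  assumes "q \<ge> 1" "d dvd q"
  shows "\<kappa> d h = (\<Sum>x\<in>{x\<in>{0..<int q}. [x = h] (mod int d)}. \<kappa> q x)"
proof -
  have d: "d \<ge> 1" using assms by (metis dvd_0_left_iff less_one not_less)
  have "wsum_ap a d h X = (\<Sum>x\<in>{x\<in>{0..<int q}. [x = h] (mod int d)}. wsum_ap a q x X)" for X
  proof -
    define S where "S = {n\<in>{1..nat \<lfloor>X\<rfloor>}. [int n = h] (mod int d)}"
    define T where "T = {x\<in>{0..<int q}. [x = h] (mod int d)}"
    have dq: "int d dvd int q" using assms(2) by simp
    have modcong: "[int n mod int q = int n] (mod int d)" for n
      using dq by (simp add: cong_def mod_mod_cancel)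
    have "wsum_ap a d h X = sum a S" by (simp add: wsum_ap_def S_def)
    also have "\<dots> = (\<Sum>x\<in>T. sum a {n\<in>S. int n mod int q = x})"
    proof (rule sum.group[symmetric])
      show "finite T" by (rule finite_subset[of _ "{0..<int q}"]) (auto simp: T_def)
      show "(\<lambda>n. int n mod int q) ` S \<subseteq> T"
        using assms(1) modcong by (auto simp: S_def T_def intro: cong_trans)
    qed (simp add: S_def)
    also have "\<dots> = (\<Sum>x\<in>T. wsum_ap a q x X)"
    proof (rule sum.cong[OF refl])
      fix x assume x: "x \<in> T"
      have "{n\<in>S. int n mod int q = x} = {n\<in>{1..nat \<lfloor>X\<rfloor>}. [int n = x] (mod int q)}"
      proof (intro Set.set_eqI iffI)
        fix n assume "n \<in> {n\<in>S. int n mod int q = x}"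
        then show "n \<in> {n\<in>{1..nat \<lfloor>X\<rfloor>}. [int n = x] (mod int q)}"
          by (auto simp: S_def cong_def)
      next
        fix n assume n: "n \<in> {n\<in>{1..nat \<lfloor>X\<rfloor>}. [int n = x] (mod int q)}"
        then have "[int n = x] (mod int d)" using dq by (auto intro: cong_dvd_modulus)
        then have "[int n = h] (mod int d)" using x by (auto simp: T_def intro: cong_trans)
        then show "n \<in> {n\<in>S. int n mod int q = x}"
          using n x by (auto simp: S_def T_def cong_def)
      qed
      then show "sum a {n\<in>S. int n mod int q = x} = wsum_ap a q x X" by (simp add: wsum_ap_def)
    qed
    finally show ?thesis by (simp add: T_def)
  qed
  then have "((\<lambda>X. wsum_ap a d h X / wsum a X) \<longlongrightarrow> (\<Sum>x\<in>{x\<in>{0..<int q}. [x = h] (mod int d)}. \<kappa> q x)) at_top"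
    unfolding sum_divide_distrib by (auto intro!: tendsto_sum kappa_tendsto assms(1) simp: sum_divide_distrib)
  with kappa_tendsto[OF d] show ?thesis by (intro tendsto_unique[of at_top]) auto
qed

lemma kappa_1 [simp]: "\<kappa> (Suc 0) h = 1"
proof -
  have "{x\<in>{1..N}. [int x = h] (mod int 1)} = {1..N}" for N by (auto simp: cong_def)
  then have "wsum_ap a 1 h X = wsum a X" for X by (simp only: wsum_ap_def wsum_def)
  then have "eventually (\<lambda>X. 1 = wsum_ap a 1 h X / wsum a X) at_top"
    by (intro eventually_mono[OF eventually_wsum_ge[of 1]]) auto
  then have "((\<lambda>X. wsum_ap a 1 h X / wsum a X) \<longlongrightarrow> 1) at_top"
    by (rule tendsto_eventually[OF eventually_mono]) auto
  with kappa_tendsto[of 1 h] show ?thesis by (intro tendsto_unique[of at_top]) auto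
qed

lemma sum_kappa:
  assumes "q \<ge> 1"
  shows "(\<Sum>x\<in>{0..<int q}. \<kappa> q x) = 1"
proof -
  have "{x\<in>{0..<int q}. [x = 0] (mod int 1)} = {0..<int q}" by (auto simp: cong_def)
  then show ?thesis using kappa_sum[OF assms, of 1 0] by simp
qed

lemma kappa_le_1:
  assumes "q \<ge> 1"
  shows "\<kappa> q h \<le> 1"
proof -
  have "\<kappa> q h = \<kappa> q (h mod int q)" using assms by (intro kappa_cong) (auto simp: cong_def)
  also have "\<dots> \<le> (\<Sum>x\<in>{0..<int q}. \<kappa> q x)"
    using assms by (intro member_le_sum) (auto simp: kappa_nonneg)
  finally show ?thesis using sum_kappa[OF assms] by simp
qed

text \<open>Bezout writes an arbitrary \<open>c\<close> in the shape q h' + q' h demanded by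
  Condition C; each of the two arguments on the right is then congruent to \<open>c\<close> modulo
  its own modulus.\<close>

lemma kappa_mult:
  assumes "coprime q q'" "q \<ge> 1" "q' \<ge> 1"
  shows "\<kappa> (q * q') c = \<kappa> q c * \<kappa> q' c"
proof -
  obtain X where X: "X > 1" "real (q * q') < QD X"
    using eventually_happens'[OF _ eventually_conj[OF eventually_gt_at_top[of "1::real"] eventually_QD_ge[of "real (q * q') + 1"]]]
    by force
  have "coprime (int q) (int q')" using assms(1) by simp
  then have "gcd (int q) (int q') = 1" by (rule coprime_imp_gcd_eq_1)
  with bezout_int[of "int q" "int q'"] obtain u v where "u * int q + v * int q' = 1" by metis
  then have "c * (u * int q + v * int q') = c" by simp
  then have c: "int q * (c * u) + int q' * (c * v) = c" by (simp add: algebra_simps)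
  have "\<kappa> (q * q') (int q * (c * u) + int q' * (c * v)) = \<kappa> q (int q' * (c * v)) * \<kappa> q' (int q * (c * u))"
    using C X assms unfolding condition_C_def by blast
  moreover have "\<kappa> q (int q' * (c * v)) = \<kappa> q c"
    using c by (intro kappa_cong assms) (metis cong_add_lcancel_0 cong_mult_self_left cong_sym mult.commute cong_0_iff dvd_triv_left cong_add_rcancel_0)
  moreover have "\<kappa> q' (int q * (c * u)) = \<kappa> q' c"
    using c by (intro kappa_cong assms) (metis cong_add_lcancel_0 cong_mult_self_left cong_sym mult.commute cong_0_iff dvd_triv_left cong_add_rcancel_0)
  ultimately show ?thesis by (simp add: c)
qed

end

section \<open>The singular series\<close>

lemma finite_residue_vectors [simp]: "finite (residue_vectors s q)"
  by (auto simp: residue_vectors_def intro: finite_PiE)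

text \<open>Orthogonality of additive characters; it detects the congruence f = t in the local
  mass.\<close>

lemma sum_e_multiples:
  assumes "q \<ge> 1"
  shows "(\<Sum>b\<in>{1..q}. e (real b / real q * of_int k)) = (if int q dvd k then of_nat q else 0)"
proof (cases "int q dvd k")
  case True
  then obtain l where l: "k = int q * l" by blast
  have "e (real b / real q * of_int k) = 1" for b
    using assms by (intro e_int) (auto simp: l)
  then show ?thesis using True by simp
next
  case False
  define z where "z = e (of_int k / real q)"
  have "z \<noteq> 1"
  proof
    assume "z = 1"
    then obtain n where "2 * pi * (of_int k / real q) = of_int n * (2 * pi)"
      unfolding z_def e_eq_cis cis_eq_1_iff by blast
    then have "of_int k / real q = of_int n"
      by (metis mult.commute mult_left_cancel pi_neq_zero mult_eq_0_iff zero_neq_numeral)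
    then have "real_of_int k = real_of_int (int q * n)" using assms by (simp add: field_simps)
    then have "k = int q * n" by (simp only: of_int_eq_iff)
    with False show False by simp
  qed
  have zb: "e (real b / real q * of_int k) = z ^ b" for b
    by (simp add: z_def e_power)
  have "z ^ q = 1" using zb[of q] assms e_int[of "of_int k"] by simp
  have "(\<Sum>b\<in>{1..q}. e (real b / real q * of_int k)) = (\<Sum>b\<in>{1..q}. z ^ b)" by (simp only: zb)
  also have "\<dots> = (\<Sum>b<q. z ^ Suc b)"
    by (rule sum.reindex_bij_witness[of _ Suc "\<lambda>b. b - 1"]) auto
  also have "\<dots> = z * (\<Sum>b<q. z ^ b)" by (simp add: sum_distrib_left)
  also have "(\<Sum>b<q. z ^ b) = 0"
    using power_diff_1_eq[of z q] \<open>z ^ q = 1\<close> \<open>z \<noteq> 1\<close> by simp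
  finally show ?thesis using False by simp
qed

locale quadratic_problem = weight_densities +
  fixes s :: nat and F :: "real mat" and t :: int
  assumes F: "integral_form_matrix s F"
    and L1: "condition_L1 s F"
begin

abbreviation "f x \<equiv> qform s F (\<lambda>i. of_int (x i))"

lemma e_qform_cong:
  assumes "q \<ge> 1" "\<And>i. i < s \<Longrightarrow> [x i = y i] (mod int q)"
  shows "e (real b / real q * f x) = e (real b / real q * f y)"
proof -
  obtain k where "f x = f y + of_int (int q * k)" using qform_cong_mod[OF F, of x y "int q"] assms(2) by blast
  then have "real b / real q * f x - real b / real q * f y = real_of_int (int b * k)"
    using assms(1) by (simp add: field_simps)
  then show ?thesis by (intro e_cong) simp
qed

text \<open>The numerator comes from b/q + b'/q' = (b q' + b' q)/(q q'). Residue vectors correspond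
  by the Chinese remainder theorem, proved as an injection between sets of equal size.\<close>

lemma local_sum_crt:
  assumes "coprime q q'" "q \<ge> 1" "q' \<ge> 1"
  shows "local_sum s F \<kappa> (q * q') (b * q' + b' * q) = local_sum s F \<kappa> q b * local_sum s F \<kappa> q' b'"
proof -
  define \<phi> where "\<phi> c = (restrict (\<lambda>i. c i mod int q) {..<s}, restrict (\<lambda>i. c i mod int q') {..<s})" for c :: "nat \<Rightarrow> int"
  define T where "T q b h = of_real (\<Prod>i<s. \<kappa> q (h i)) * e (real b / real q * f h)" for q b and h :: "nat \<Rightarrow> int"
  have bij: "bij_betw \<phi> (residue_vectors s (q * q')) (residue_vectors s q \<times> residue_vectors s q')"
  proof -
    have "inj_on \<phi> (residue_vectors s (q * q'))"
    proof (rule inj_onI)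
      fix c c' assume c: "c \<in> residue_vectors s (q * q')" "c' \<in> residue_vectors s (q * q')" "\<phi> c = \<phi> c'"
      have "c i = c' i" if i: "i < s" for i
      proof -
        have "c i mod int q = c' i mod int q" "c i mod int q' = c' i mod int q'"
          using c(3) i by (auto simp: \<phi>_def fun_eq_iff restrict_def split: if_splits)
        then have "[c i = c' i] (mod int q * int q')"
          using assms(1) by (intro coprime_cong_mult) (auto simp: cong_def)
        moreover have "c i \<in> {0..<int (q * q')}" "c' i \<in> {0..<int (q * q')}"
          using c i by (auto simp: residue_vectors_def PiE_iff)
        ultimately show ?thesis by (auto simp: cong_def)
      qed
      then show "c = c'" using c(1,2) unfolding residue_vectors_def by (intro PiE_ext) auto
    qed
    moreover have "\<phi> ` residue_vectors s (q * q') \<subseteq> residue_vectors s q \<times> residue_vectors s q'"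
      using assms(2,3) by (intro image_subsetI) (simp add: \<phi>_def residue_vectors_def PiE_iff)
    moreover have "card (residue_vectors s (q * q')) = card (residue_vectors s q \<times> residue_vectors s q')"
      by (simp add: residue_vectors_def card_PiE card_cartesian_product power_mult_distrib del: of_nat_mult)
    ultimately show ?thesis
      by (metis bij_betw_def card_image card_subset_eq finite_SigmaI finite_residue_vectors)
  qed
  have "local_sum s F \<kappa> q b * local_sum s F \<kappa> q' b'
      = (\<Sum>u\<in>residue_vectors s q \<times> residue_vectors s q'. T q b (fst u) * T q' b' (snd u))"
    by (simp add: local_sum_def T_def sum_product sum.cartesian_product case_prod_unfold)
  also have "\<dots> = (\<Sum>c\<in>residue_vectors s (q * q'). T q b (fst (\<phi> c)) * T q' b' (snd (\<phi> c)))"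
    using bij by (rule sum.reindex_bij_betw[symmetric])
  also have "\<dots> = (\<Sum>c\<in>residue_vectors s (q * q'). T (q * q') (b * q' + b' * q) c)"
  proof (rule sum.cong[OF refl])
    fix c :: "nat \<Rightarrow> int"
    have "(\<Prod>i<s. \<kappa> (q * q') (c i)) = (\<Prod>i<s. \<kappa> q (fst (\<phi> c) i)) * (\<Prod>i<s. \<kappa> q' (snd (\<phi> c) i))"
      unfolding prod.distrib[symmetric]
    proof (rule prod.cong[OF refl])
      fix i assume "i \<in> {..<s}"
      then show "\<kappa> (q * q') (c i) = \<kappa> q (fst (\<phi> c) i) * \<kappa> q' (snd (\<phi> c) i)"
        unfolding kappa_mult[OF assms]
        using assms by (intro arg_cong2[of _ _ _ _ "(*)"] kappa_cong) (auto simp: \<phi>_def cong_def)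
    qed
    moreover have "e (real b / real q * f (fst (\<phi> c))) = e (real b / real q * f c)"
      using assms by (intro e_qform_cong) (auto simp: \<phi>_def cong_def)
    moreover have "e (real b' / real q' * f (snd (\<phi> c))) = e (real b' / real q' * f c)"
      using assms by (intro e_qform_cong) (auto simp: \<phi>_def cong_def)
    moreover have "real (b * q' + b' * q) / real (q * q') * f c = real b / real q * f c + real b' / real q' * f c"
      using assms by (simp add: field_simps)
    ultimately show "T q b (fst (\<phi> c)) * T q' b' (snd (\<phi> c)) = T (q * q') (b * q' + b' * q) c"
      by (simp add: T_def e_add)
  qed
  finally show ?thesis by (simp add: local_sum_def T_def)
qed

text \<open>One summand of the singular term, defined for every numerator: coprime ones give
  \<open>singular_term\<close>, all of them together count solutions of the congruence.\<close>

definition st :: "nat \<Rightarrow> nat \<Rightarrow> complex" where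
  "st q b = local_sum s F \<kappa> q b * e (- (real b / real q) * of_int t)"

lemma singular_term_eq: "singular_term s F t \<kappa> q = (\<Sum>b\<in>totatives q. st q b)"
proof -
  have "{b\<in>{1..q}. coprime b q} = totatives q" by (auto simp: totatives_def)
  then show ?thesis by (simp add: singular_term_def st_def)
qed

lemma st_crt:
  assumes "coprime q q'" "q \<ge> 1" "q' \<ge> 1"
  shows "st (q * q') (b * q' + b' * q) = st q b * st q' b'"
proof -
  have "- (real (b * q' + b' * q) / real (q * q')) * of_int t = - (real b / real q) * of_int t + - (real b' / real q') * of_int t"
    using assms by (simp add: field_simps)
  then show ?thesis unfolding st_def local_sum_crt[OF assms] by (simp only: e_add mult_ac)
qed

lemma f_Ints: "f x \<in> \<int>"
  by (rule qform_Ints[OF F]) simp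

lemma st_cong:
  assumes "q \<ge> 1" "[b = b'] (mod q)"
  shows "st q b = st q b'"
proof -
  have "[int b = int b'] (mod int q)" using assms(2) by (simp add: cong_int_iff)
  then obtain k where k: "int b = int b' + int q * k" by (metis cong_iff_lin cong_sym)
  have "real b = real b' + real q * of_int k"
    using arg_cong[OF k, of real_of_int] by simp
  then have *: "real b / real q = real b' / real q + of_int k" using assms(1) by (simp add: field_simps)
  have e: "e (real b / real q * y) = e (real b' / real q * y)" if "y \<in> \<int>" for y
    unfolding * by (rule e_cong) (use that in \<open>auto simp: ring_distribs intro: Ints_mult\<close>)
  have "e (- (real b / real q) * of_int t) = e (- (real b' / real q) * of_int t)"
    using e[of "- of_int t"] by simp
  then show ?thesis unfolding st_def local_sum_def e[OF f_Ints] by simp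
qed

lemma singular_term_1: "singular_term s F t \<kappa> (Suc 0) = 1"
proof -
  have "residue_vectors s (Suc 0) = {\<lambda>i\<in>{..<s}. 0}"
  proof (intro Set.set_eqI iffI)
    fix x assume "x \<in> residue_vectors s (Suc 0)"
    then have x: "x \<in> {..<s} \<rightarrow>\<^sub>E {0..<int (Suc 0)}" by (simp add: residue_vectors_def)
    have "x i = (\<lambda>i\<in>{..<s}. 0) i" for i
    proof (cases "i < s")
      case True
      then show ?thesis using PiE_mem[OF x, of i] by simp
    next
      case False
      then show ?thesis using x by (simp add: PiE_iff extensional_def)
    qed
    then show "x \<in> {\<lambda>i\<in>{..<s}. 0}" by auto
  qed (simp add: residue_vectors_def)
  then have "local_sum s F \<kappa> (Suc 0) (Suc 0) = 1"
    using e_int[OF f_Ints, of "\<lambda>i\<in>{..<s}. 0"] by (simp add: local_sum_def)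
  then show ?thesis by (simp add: singular_term_eq st_def e_int)
qed

lemma totatives_cong_imp_eq:
  assumes "b \<in> totatives q" "c \<in> totatives q" "[b = c] (mod q)"
  shows "b = c"
proof -
  have "b = c" if "b \<in> totatives q" "c \<in> totatives q" "[b = c] (mod q)" "b \<le> c" for b c
  proof (rule ccontr)
    assume "b \<noteq> c"
    with that have "q dvd c - b" by (metis cong_altdef_nat cong_sym)
    with that \<open>b \<noteq> c\<close> have "q \<le> c - b" by (intro dvd_imp_le) auto
    with that show False by (auto simp: totatives_def)
  qed
  with assms show ?thesis by (metis cong_sym nat_le_linear)
qed

text \<open>As b and b' run over reduced residues, b/q + b'/q' runs modulo 1 over the reduced
  fractions with denominator q q'.\<close>

lemma singular_term_mult:
  assumes "coprime q q'" "q \<ge> 1" "q' \<ge> 1"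
  shows "singular_term s F t \<kappa> (q * q') = singular_term s F t \<kappa> q * singular_term s F t \<kappa> q'"
\<comment> \<open>\<open>totatives\<close> takes representatives from 1 on, whereas the reduction in
  \<open>g\<close> produces 0 exactly when the modulus is 1; that case is treated apart.\<close>
proof (cases "q = 1 \<and> q' = 1")
  case True
  then show ?thesis using singular_term_1 by simp
next
  case False
  then have gt1: "q * q' > 1" using assms by (metis One_nat_def Suc_lessI mult_is_0 nat_mult_eq_1_iff not_gr_zero not_one_le_zero)
  define g where "g u = (fst u * q' + snd u * q) mod (q * q')" for u
  have g_cong: "[g (b, b') = b * q' + b' * q] (mod q * q')" for b b'
    by (simp add: g_def cong_def)
  have bij: "bij_betw g (totatives q \<times> totatives q') (totatives (q * q'))"
  proof -
    have "inj_on g (totatives q \<times> totatives q')"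
    proof (rule inj_onI, clarify)
      fix b b' c c' assume bc: "b \<in> totatives q" "b' \<in> totatives q'" "c \<in> totatives q" "c' \<in> totatives q'"
        and eq: "g (b, b') = g (c, c')"
      have cong: "[b * q' + b' * q = c * q' + c' * q] (mod q * q')"
        using g_cong[of b b'] g_cong[of c c'] eq by (metis cong_sym cong_trans)
      have "[b * q' + b' * q = c * q' + c' * q] (mod q)" using cong by (rule cong_modulus_mult_nat)
      then have "[b * q' = c * q'] (mod q)" by (simp add: cong_def)
      then have "[b = c] (mod q)" using assms(1) by (simp add: cong_mult_rcancel_nat coprime_commute)
      moreover have "[b * q' + b' * q = c * q' + c' * q] (mod q')"
        using cong by (metis cong_modulus_mult_nat mult.commute)
      then have "[b' * q = c' * q] (mod q')" by (simp add: cong_def)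
      then have "[b' = c'] (mod q')" using assms(1) by (simp add: cong_mult_rcancel_nat)
      ultimately show "b = c \<and> b' = c'" using bc totatives_cong_imp_eq by blast
    qed
    moreover have "g ` (totatives q \<times> totatives q') \<subseteq> totatives (q * q')"
    proof safe
      fix b b' assume b: "b \<in> totatives q" "b' \<in> totatives q'"
      have "coprime (b * q' + b' * q) q" "coprime (b * q' + b' * q) q'"
      proof -
        have "coprime (b * q') q" using b assms(1) by (simp add: totatives_def coprime_commute)
        then show "coprime (b * q' + b' * q) q"
          unfolding coprime_iff_gcd_eq_1 using gcd_add_mult[of q b' "b * q'"]
          by (simp only: gcd.commute add.commute)
        have "coprime (b' * q) q'" using b assms(1) by (simp add: totatives_def)
        then show "coprime (b * q' + b' * q) q'"
          unfolding coprime_iff_gcd_eq_1 using gcd_add_mult[of q' b "b' * q"]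
          by (simp only: gcd.commute)
      qed
      then have "coprime (b * q' + b' * q) (q * q')" by simp
      then have cop: "coprime (g (b, b')) (q * q')"
        using g_cong[of b b'] cong_imp_coprime cong_sym by blast
      have "g (b, b') \<noteq> 0"
      proof
        assume "g (b, b') = 0"
        with cop have "is_unit (q * q')" by simp
        with gt1 show False by simp
      qed
      moreover have "g (b, b') \<le> q * q'" using assms by (simp add: g_def less_imp_le)
      ultimately show "g (b, b') \<in> totatives (q * q')" using cop by (simp add: totatives_def)
    qed
    moreover have "card (totatives (q * q')) = card (totatives q \<times> totatives q')"
      using totient_mult_coprime[OF assms(1)] by (simp add: card_cartesian_product totient_def)
    ultimately show ?thesis
      by (metis bij_betw_def card_image card_subset_eq finite_totatives)
  qed
  have "singular_term s F t \<kappa> (q * q') = (\<Sum>u\<in>totatives q \<times> totatives q'. st (q * q') (g u))"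
    unfolding singular_term_eq using bij by (rule sum.reindex_bij_betw[symmetric])
  also have "\<dots> = (\<Sum>(b, b')\<in>totatives q \<times> totatives q'. st q b * st q' b')"
  proof (rule sum.cong[OF refl], clarify)
    fix b b'
    have "st (q * q') (g (b, b')) = st (q * q') (b * q' + b' * q)"
      using assms by (intro st_cong g_cong) simp
    then show "st (q * q') (g (b, b')) = st q b * st q' b'" using st_crt[OF assms] by simp
  qed
  also have "\<dots> = singular_term s F t \<kappa> q * singular_term s F t \<kappa> q'"
    by (simp add: singular_term_eq sum_product sum.cartesian_product)
  finally show ?thesis .
qed

text \<open>With numerator \<open>r * b\<close> the phase depends only on the vector modulo
  \<open>d\<close>, and over each fibre the densities modulo \<open>d * r\<close> add up to the
  density modulo \<open>d\<close>.\<close>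

lemma local_sum_lift:
  assumes "d \<ge> 1" "r \<ge> 1"
  shows "local_sum s F \<kappa> (d * r) (r * b) = local_sum s F \<kappa> d b"
proof -
  define g where "g x = restrict (\<lambda>i. x i mod int d) {..<s}" for x :: "nat \<Rightarrow> int"
  define T where "T x = of_real (\<Prod>i<s. \<kappa> (d * r) (x i)) * e (real b / real d * f x)" for x :: "nat \<Rightarrow> int"
  have "local_sum s F \<kappa> (d * r) (r * b) = (\<Sum>x\<in>residue_vectors s (d * r). T x)"
    unfolding local_sum_def T_def using assms by simp
  also have "\<dots> = (\<Sum>y\<in>residue_vectors s d. \<Sum>x\<in>{x\<in>residue_vectors s (d * r). g x = y}. T x)"
    using assms by (intro sum.group[symmetric] finite_residue_vectors image_subsetI)
      (simp add: g_def residue_vectors_def PiE_iff)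
  also have "\<dots> = (\<Sum>y\<in>residue_vectors s d. of_real (\<Prod>i<s. \<kappa> d (y i)) * e (real b / real d * f y))"
  proof (rule sum.cong[OF refl])
    fix y assume y: "y \<in> residue_vectors s d"
    have set_eq: "{x\<in>residue_vectors s (d * r). g x = y}
        = (\<Pi>\<^sub>E i\<in>{..<s}. {u\<in>{0..<int (d * r)}. [u = y i] (mod int d)})" (is "?A = ?B")
    proof (intro Set.set_eqI iffI)
      fix x assume x: "x \<in> ?A"
      have "[x i = y i] (mod int d)" if "i < s" for i
        using x that by (auto simp: g_def cong_def)
      then show "x \<in> ?B" using x by (auto simp: residue_vectors_def PiE_iff)
    next
      fix x assume x: "x \<in> ?B"
      have "x i mod int d = y i" if "i < s" for i
        using x y that by (auto simp: residue_vectors_def PiE_iff cong_def)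
      then have "g x = y" using y by (auto simp: g_def residue_vectors_def PiE_iff extensional_def fun_eq_iff)
      then show "x \<in> ?A" using x by (auto simp: residue_vectors_def PiE_iff)
    qed
    have "(\<Sum>x\<in>?A. T x) = (\<Sum>x\<in>?A. of_real (\<Prod>i<s. \<kappa> (d * r) (x i)) * e (real b / real d * f y))"
    proof (rule sum.cong[OF refl])
      fix x assume "x \<in> ?A"
      then have "e (real b / real d * f x) = e (real b / real d * f y)"
        using assms by (intro e_qform_cong) (auto simp: g_def cong_def)
      then show "T x = of_real (\<Prod>i<s. \<kappa> (d * r) (x i)) * e (real b / real d * f y)" by (simp add: T_def)
    qed
    also have "\<dots> = of_real (\<Sum>x\<in>?A. \<Prod>i<s. \<kappa> (d * r) (x i)) * e (real b / real d * f y)"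
      by (simp add: sum_distrib_right)
    also have "(\<Sum>x\<in>?A. \<Prod>i<s. \<kappa> (d * r) (x i)) = (\<Prod>i<s. \<Sum>u\<in>{u\<in>{0..<int (d * r)}. [u = y i] (mod int d)}. \<kappa> (d * r) u)"
      unfolding set_eq by (rule prod_sum_PiE[symmetric]) (auto intro: finite_subset[of _ "{0..<int (d * r)}"])
    also have "\<dots> = (\<Prod>i<s. \<kappa> d (y i))"
      using assms by (intro prod.cong refl kappa_sum[symmetric]) auto
    finally show "(\<Sum>x\<in>?A. T x) = of_real (\<Prod>i<s. \<kappa> d (y i)) * e (real b / real d * f y)" .
  qed
  finally show ?thesis by (simp add: local_sum_def)
qed

lemma st_lift:
  assumes "d \<ge> 1" "r \<ge> 1"
  shows "st (d * r) (r * b) = st d b"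
  using assms by (simp add: st_def local_sum_lift)

text \<open>The sum over all numerators, not only the coprime ones, is q times the indicator of the
  congruence.\<close>

lemma local_mass_eq_sum_st:
  assumes "q \<ge> 1"
  shows "of_real (real q * local_mass s F t \<kappa> q) = (\<Sum>b\<in>{1..q}. st q b)"
proof -
  define w where "w x = complex_of_real (\<Prod>i<s. \<kappa> q (x i))" for x :: "nat \<Rightarrow> int"
  have ind: "(\<Sum>b\<in>{1..q}. e (real b / real q * (f x - of_int t)))
      = (if [f x = of_int t] (rmod real q) then of_nat q else 0)" for x
  proof -
    obtain k where k: "f x = of_int k" using f_Ints[of x] by (auto elim: Ints_cases)
    have "[f x = of_int t] (rmod real q) \<longleftrightarrow> (\<exists>n. real_of_int t = real_of_int (k + n * int q))"
      unfolding rcong_altdef k by simp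
    also have "\<dots> \<longleftrightarrow> (\<exists>n. t = k + n * int q)" by (simp only: of_int_eq_iff)
    also have "\<dots> \<longleftrightarrow> int q dvd (k - t)"
    proof
      assume "int q dvd (k - t)"
      then obtain n where "k - t = int q * n" by blast
      then have "t = k + (- n) * int q" by (simp add: algebra_simps)
      then show "\<exists>n. t = k + n * int q" by blast
    qed auto
    finally show ?thesis using sum_e_multiples[OF assms, of "k - t"] by (simp add: k)
  qed
  have "(\<Sum>b\<in>{1..q}. st q b) = (\<Sum>b\<in>{1..q}. \<Sum>x\<in>residue_vectors s q. w x * e (real b / real q * (f x - of_int t)))"
    unfolding st_def local_sum_def w_def sum_distrib_right
    by (intro sum.cong refl) (simp add: right_diff_distrib flip: e_add)
  also have "\<dots> = (\<Sum>x\<in>residue_vectors s q. \<Sum>b\<in>{1..q}. w x * e (real b / real q * (f x - of_int t)))"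
    by (rule sum.swap)
  also have "\<dots> = (\<Sum>x\<in>residue_vectors s q. w x * (if [f x = of_int t] (rmod real q) then of_nat q else 0))"
    by (simp only: ind flip: sum_distrib_left)
  also have "\<dots> = (\<Sum>x\<in>{x\<in>residue_vectors s q. [f x = of_int t] (rmod real q)}. w x * of_nat q)"
    by (rule sum.mono_neutral_cong_right) auto
  also have "\<dots> = of_real (real q * local_mass s F t \<kappa> q)"
    by (simp add: local_mass_def w_def sum_distrib_left mult_ac)
  finally show ?thesis by simp
qed

text \<open>Sort the numerators modulo a power of p by divisibility by p: the coprime ones form a
  singular term, the others reduce to the previous power. So the normalized local masses are the
  partial sums of the p-part of the singular series, and their limit is its sum.\<close>

lemma local_mass_prime_power:
  assumes p: "prime p"
  shows "of_real (real (p ^ m) * local_mass s F t \<kappa> (p ^ m)) = (\<Sum>j\<le>m. singular_term s F t \<kappa> (p ^ j))"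
proof -
  have p1: "p ^ m \<ge> 1" for m using p prime_gt_0_nat[of p] by simp
  have "(\<Sum>b\<in>{1..p ^ m}. st (p ^ m) b) = (\<Sum>j\<le>m. singular_term s F t \<kappa> (p ^ j))"
  proof (induction m)
    case 0
    then show ?case by (simp add: singular_term_eq)
  next
    case (Suc m)
    have sub: "(\<lambda>m. p * m) ` {0<..p ^ m} \<subseteq> {0<..p ^ Suc m}" using p prime_gt_0_nat by auto
    have "{1..p ^ Suc m} = {0<..p ^ Suc m}" by auto
    then have "(\<Sum>b\<in>{1..p ^ Suc m}. st (p ^ Suc m) b) = (\<Sum>b\<in>totatives (p ^ Suc m). st (p ^ Suc m) b)
        + (\<Sum>b\<in>(\<lambda>m. p * m) ` {0<..p ^ m}. st (p ^ Suc m) b)"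
      unfolding totatives_prime_power_Suc[OF p] using sum.subset_diff[OF sub, of "st (p ^ Suc m)"] by simp
    also have "(\<Sum>b\<in>(\<lambda>m. p * m) ` {0<..p ^ m}. st (p ^ Suc m) b) = (\<Sum>b\<in>{0<..p ^ m}. st (p ^ m * p) (p * b))"
      using p prime_gt_0_nat[of p] by (subst sum.reindex) (auto simp: inj_on_def mult.commute)
    also have "\<dots> = (\<Sum>b\<in>{1..p ^ m}. st (p ^ m) b)"
      using p1[of m] p1[of 1] by (intro sum.cong) (auto simp: st_lift)
    finally show ?case using Suc.IH by (simp add: singular_term_eq)
  qed
  with local_mass_eq_sum_st[OF p1] show ?thesis by simp
qed

end

section \<open>Euler products of absolutely summable multiplicative functions\<close>

text \<open>The positive integers composed of primes from \<open>T\<close> only.\<close>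

definition smooth_numbers :: "nat set \<Rightarrow> nat set" where
  "smooth_numbers T = {n. n \<ge> 1 \<and> (\<forall>p. prime p \<longrightarrow> p dvd n \<longrightarrow> p \<in> T)}"

lemma smooth_numbers_empty: "smooth_numbers {} = {1}"
  using prime_factor_nat by (auto simp: smooth_numbers_def)

text \<open>Unique factorization at one prime: the inverse splits off the exact power of
  \<open>p\<close>.\<close>

lemma bij_betw_smooth_numbers_insert:
  assumes p: "prime (p :: nat)" "p \<notin> T"
  shows "bij_betw (\<lambda>(j, n). p ^ j * n) (UNIV \<times> smooth_numbers T) (smooth_numbers (insert p T))"
proof (rule bij_betw_byWitness[where f' = "\<lambda>m. (multiplicity p m, m div p ^ multiplicity p m)"])
  have p0: "p > 0" using p prime_gt_0_nat by blast
  have nd: "\<not> p dvd n" if "n \<in> smooth_numbers T" for n using that p by (auto simp: smooth_numbers_def)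
  have n0: "n \<noteq> 0" if "n \<in> smooth_numbers T" for n T using that by (auto simp: smooth_numbers_def)
  have mult: "multiplicity p (p ^ j * n) = j" if "n \<in> smooth_numbers T" for j n
    using p nd[OF that] n0[OF that] p0
    by (subst prime_elem_multiplicity_mult_distrib) (auto simp: not_dvd_imp_multiplicity_0)
  show "\<forall>u\<in>UNIV \<times> smooth_numbers T. (\<lambda>m. (multiplicity p m, m div p ^ multiplicity p m)) ((\<lambda>(j, n). p ^ j * n) u) = u"
    using mult p0 by auto
  show "\<forall>m\<in>smooth_numbers (insert p T). (\<lambda>(j, n). p ^ j * n) (multiplicity p m, m div p ^ multiplicity p m) = m"
    by (simp add: multiplicity_dvd)
  show "(\<lambda>(j, n). p ^ j * n) ` (UNIV \<times> smooth_numbers T) \<subseteq> smooth_numbers (insert p T)"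
  proof clarify
    fix j n assume n: "n \<in> smooth_numbers T"
    show "p ^ j * n \<in> smooth_numbers (insert p T)"
      unfolding smooth_numbers_def
    proof (intro CollectI conjI allI impI)
      show "1 \<le> p ^ j * n" using n p0 by (simp add: smooth_numbers_def Suc_le_eq)
      fix r assume r: "prime r" "r dvd p ^ j * n"
      then have "r dvd p \<or> r dvd n" using prime_dvd_mult_iff prime_dvd_power by blast
      then show "r \<in> insert p T"
        using r p n primes_dvd_imp_eq[of r p] by (auto simp: smooth_numbers_def)
    qed
  qed
  show "(\<lambda>m. (multiplicity p m, m div p ^ multiplicity p m)) ` smooth_numbers (insert p T) \<subseteq> UNIV \<times> smooth_numbers T"
  proof (rule image_subsetI)
    fix m assume m: "m \<in> smooth_numbers (insert p T)"
    define k where "k = m div p ^ multiplicity p m"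
    have mk: "m = p ^ multiplicity p m * k" by (simp add: k_def multiplicity_dvd)
    have npk: "\<not> p dvd k"
      using multiplicity_decompose[of m p] n0[OF m] p prime_gt_Suc_0_nat[of p] by (simp add: k_def)
    have "k \<in> smooth_numbers T"
      unfolding smooth_numbers_def
    proof (intro CollectI conjI allI impI)
      show "1 \<le> k" using mk n0[OF m] by (metis One_nat_def Suc_leI mult_0_right neq0_conv)
      fix r assume r: "prime r" "r dvd k"
      then have "r dvd m" using mk by (metis dvd_mult)
      with m r have "r \<in> insert p T" by (auto simp: smooth_numbers_def)
      with npk r show "r \<in> T" by auto
    qed
    then show "(multiplicity p m, m div p ^ multiplicity p m) \<in> UNIV \<times> smooth_numbers T"
      by (simp add: k_def)
  qed
qed

text \<open>Induction on the set of primes: each new prime contributes a double sum over its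
  exponent and the old smooth numbers, which factors by multiplicativity. Summability justifies the
  iterated sum.\<close>

lemma prod_infsum_prime_powers:
  fixes g :: "nat \<Rightarrow> complex"
  assumes "g (Suc 0) = 1"
    and mult: "\<And>m n. coprime m n \<Longrightarrow> m \<ge> 1 \<Longrightarrow> n \<ge> 1 \<Longrightarrow> g (m * n) = g m * g n"
    and summ: "g summable_on {1..}"
    and T: "finite T" "\<And>p. p \<in> T \<Longrightarrow> prime p"
  shows "(\<Prod>p\<in>T. \<Sum>\<^sub>\<infinity>j. g (p ^ j)) = infsum g (smooth_numbers T)"
  using T
proof (induction T rule: finite_induct)
  case empty
  then show ?case using assms(1) by (simp add: smooth_numbers_empty)
next
  case (insert p T)
  have p: "prime p" using insert.prems by simp
  have gm: "g (p ^ j * n) = g (p ^ j) * g n" if "n \<in> smooth_numbers T" for j n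
  proof (rule mult)
    have "\<not> p dvd n" using that p insert.hyps by (auto simp: smooth_numbers_def)
    then show "coprime (p ^ j) n" using p by (simp add: prime_imp_coprime coprime_power_left_iff)
    show "p ^ j \<ge> 1" using p prime_gt_0_nat[of p] by simp
  qed (use that in \<open>auto simp: smooth_numbers_def\<close>)
  have "g summable_on smooth_numbers (insert p T)"
    by (rule summable_on_subset_banach[OF summ]) (auto simp: smooth_numbers_def)
  then have "(\<lambda>u. g ((\<lambda>(j, n). p ^ j * n) u)) summable_on (UNIV \<times> smooth_numbers T)"
    using bij_betw_smooth_numbers_insert[OF p insert.hyps(2)] summable_on_reindex_bij_betw by blast
  then have s: "(\<lambda>(j, n). g (p ^ j * n)) summable_on (UNIV \<times> smooth_numbers T)"
    by (simp add: case_prod_unfold)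
  have "infsum g (smooth_numbers (insert p T)) = infsum (\<lambda>u. g ((\<lambda>(j, n). p ^ j * n) u)) (UNIV \<times> smooth_numbers T)"
    using infsum_reindex_bij_betw[OF bij_betw_smooth_numbers_insert[OF p insert.hyps(2)]] by metis
  also have "\<dots> = infsum (\<lambda>(j, n). g (p ^ j * n)) (UNIV \<times> smooth_numbers T)"
    by (simp add: case_prod_unfold)
  also have "\<dots> = (\<Sum>\<^sub>\<infinity>j. \<Sum>\<^sub>\<infinity>n\<in>smooth_numbers T. g (p ^ j * n))"
    using s by (rule infsum_Sigma'_banach[symmetric])
  also have "\<dots> = (\<Sum>\<^sub>\<infinity>j. \<Sum>\<^sub>\<infinity>n\<in>smooth_numbers T. g (p ^ j) * g n)"
    using gm by (intro infsum_cong) auto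
  also have "\<dots> = (\<Sum>\<^sub>\<infinity>j. g (p ^ j)) * infsum g (smooth_numbers T)"
    by (simp add: infsum_cmult_right' infsum_cmult_left')
  finally show ?case using insert by simp
qed

lemma infsum_tail_tendsto_0:
  fixes h :: "nat \<Rightarrow> real"
  assumes "h summable_on {1..}"
  shows "(\<lambda>N. infsum h {N<..}) \<longlonglongrightarrow> 0"
proof -
  have sub: "h summable_on {N<..}" for N by (rule summable_on_subset_banach[OF assms]) auto
  have "infsum h {1..} = (\<Sum>n\<in>{1..N}. h n) + infsum h {N<..}" for N
  proof -
    have eq: "{1..} = {1..N} \<union> {N<..}" and disj: "{1..N} \<inter> {N<..} = {}" by auto
    show ?thesis unfolding eq using sub disj by (subst infsum_Un_disjoint) auto
  qed
  then have eq: "infsum h {N<..} = infsum h {1..} - (\<Sum>n\<in>{1..N}. h n)" for N by (simp add: algebra_simps)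
  have bij: "bij_betw Suc UNIV {1..}"
    by (rule bij_betw_byWitness[where f' = "\<lambda>n. n - 1"]) auto
  have "(\<lambda>n. h (Suc n)) summable_on UNIV" using assms summable_on_reindex_bij_betw[OF bij, of h] by simp
  then have "((\<lambda>n. h (Suc n)) has_sum infsum h {1..}) UNIV"
    using infsum_reindex_bij_betw[OF bij, of h] by (metis has_sum_infsum)
  then have "(\<lambda>n. h (Suc n)) sums infsum h {1..}" by (rule has_sum_imp_sums)
  then have "(\<lambda>N. \<Sum>n<N. h (Suc n)) \<longlonglongrightarrow> infsum h {1..}" by (simp add: sums_def)
  moreover have "(\<Sum>n<N. h (Suc n)) = (\<Sum>n\<in>{1..N}. h n)" for N
    by (rule sum.reindex_bij_witness[of _ "\<lambda>n. n - 1" Suc]) auto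
  ultimately have "(\<lambda>N. \<Sum>n\<in>{1..N}. h n) \<longlonglongrightarrow> infsum h {1..}" by simp
  from tendsto_diff[OF tendsto_const this, of "infsum h {1..}"] show ?thesis unfolding eq by simp
qed

text \<open>Every n up to N has only prime factors up to N, so the finite product misses only terms
  beyond N, and it differs from the full sum by at most a tail of the absolute series.\<close>

lemma euler_product_tendsto:
  fixes g :: "nat \<Rightarrow> complex"
  assumes "g (Suc 0) = 1"
    and mult: "\<And>m n. coprime m n \<Longrightarrow> m \<ge> 1 \<Longrightarrow> n \<ge> 1 \<Longrightarrow> g (m * n) = g m * g n"
    and summ: "(\<lambda>n. cmod (g n)) summable_on {1..}"
  shows "(\<lambda>N. \<Prod>p\<in>{p. prime p \<and> p \<le> N}. \<Sum>\<^sub>\<infinity>j. g (p ^ j)) \<longlonglongrightarrow> infsum g {1..}"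
proof -
  have summ': "g summable_on {1..}" using summ by (rule abs_summable_summable)
  have fin: "finite {p. prime p \<and> p \<le> N}" for N :: nat by simp
  have "cmod ((\<Prod>p\<in>{p. prime p \<and> p \<le> N}. \<Sum>\<^sub>\<infinity>j. g (p ^ j)) - infsum g {1..}) \<le> infsum (\<lambda>n. cmod (g n)) {N<..}" for N
  proof -
    define S where "S = smooth_numbers {p. prime p \<and> p \<le> N}"
    have sub: "{1..} - S \<subseteq> {N<..}"
      by (auto simp: S_def smooth_numbers_def not_le dest!: dvd_imp_le)
    have "S \<subseteq> {1..}" by (auto simp: S_def smooth_numbers_def)
    then have eq: "{1..} = S \<union> ({1..} - S)" by auto
    have s1: "g summable_on S" "g summable_on ({1..} - S)"
      by (rule summable_on_subset_banach[OF summ']; use \<open>S \<subseteq> {1..}\<close> in auto)+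
    have "infsum g {1..} = infsum g S + infsum g ({1..} - S)"
      using infsum_Un_disjoint[OF s1] eq by auto
    moreover have "(\<Prod>p\<in>{p. prime p \<and> p \<le> N}. \<Sum>\<^sub>\<infinity>j. g (p ^ j)) = infsum g S"
      unfolding S_def by (rule prod_infsum_prime_powers[OF assms(1) mult summ' fin]) auto
    ultimately have "cmod ((\<Prod>p\<in>{p. prime p \<and> p \<le> N}. \<Sum>\<^sub>\<infinity>j. g (p ^ j)) - infsum g {1..}) = cmod (infsum g ({1..} - S))"
      by (simp add: norm_minus_commute)
    also have "\<dots> \<le> infsum (\<lambda>n. cmod (g n)) ({1..} - S)"
      by (rule norm_infsum_bound) (rule summable_on_subset_banach[OF summ], auto)
    also have "\<dots> \<le> infsum (\<lambda>n. cmod (g n)) {N<..}"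
      using sub by (intro infsum_mono_neutral summable_on_subset_banach[OF summ]) auto
    finally show ?thesis .
  qed
  then have "(\<lambda>N. (\<Prod>p\<in>{p. prime p \<and> p \<le> N}. \<Sum>\<^sub>\<infinity>j. g (p ^ j)) - infsum g {1..}) \<longlonglongrightarrow> 0"
    by (intro Lim_null_comparison[OF _ infsum_tail_tendsto_0[OF summ]] always_eventually) auto
  then show ?thesis by (rule LIM_zero_cancel)
qed

text \<open>Splits 5/4 as 1/8 + 9/8: the first part becomes an explicit rate in N, the second still
  gives a convergent series. The rate is not optimal, but any power of N suffices.\<close>

lemma powr_tail:
  assumes "n \<ge> 1" "N \<ge> 1"
  shows "real (n + N) powr (-5/4) \<le> real N powr (-1/8) * real n powr (-9/8)"
proof -
  have "real (n + N) powr (-5/4) = real (n + N) powr (-1/8) * real (n + N) powr (-9/8)"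
    by (simp flip: powr_add)
  also have "\<dots> \<le> real N powr (-1/8) * real n powr (-9/8)"
    using assms by (intro mult_mono powr_mono2') auto
  finally show ?thesis .
qed

section \<open>Convergence and positivity of the singular series\<close>

context quadratic_problem
begin

lemma weyl:
  fixes b :: "'a \<Rightarrow> real" and \<iota> :: "'a \<Rightarrow> int"
  assumes "bij_betw \<iota> D {0..<int N}" "coeff_norm s F * N \<le> M" "\<And>x. x \<in> D \<Longrightarrow> b x \<ge> 0"
  shows "cmod (\<Sum>x\<in>{..<s} \<rightarrow>\<^sub>E D. of_real (\<Prod>i<s. b (x i)) * e (\<alpha> * f (\<lambda>i. \<iota> (x i))))
    \<le> (\<Sum>x\<in>D. b x) ^ (s - 10) * (\<Sum>x\<in>D. (b x)\<^sup>2) ^ 5 * sqrt (Tsum \<alpha> N M ^ 5)"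
proof (rule condition_L1_nonsingular_block[OF L1])
  fix I J
  assume IJ: "I \<subseteq> {..<s}" "J \<subseteq> {..<s}" "I \<inter> J = {}" "card I = 5" "card J = 5"
    and ns: "\<And>w. \<forall>i\<in>I. (\<Sum>j\<in>J. F $$ (i, j) * w j) = 0 \<Longrightarrow> \<forall>j\<in>J. w j = 0"
  show ?thesis by (rule weyl_sum_bound[OF F IJ ns assms])
qed

text \<open>The Weyl inequality modulo \<open>q\<close> with the densities as weights: their sum is
  1, their square sum at most \<open>k\<close>, and at \<alpha> = b/q with length \<open>q\<close>
  the kernel sum is of order q log q. For \<open>k\<close> near 1/q this is q to the power -5/2 up
  to logarithms.\<close>

lemma local_sum_bound:
  assumes "q \<ge> 1" "coprime b q" and k: "\<And>h. \<kappa> q h \<le> k"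
  shows "cmod (local_sum s F \<kappa> q b)
    \<le> k ^ 5 * sqrt (((16 * coeff_norm s F + 24) * (real q * (2 + ln (real q)))) ^ 5)"
proof -
  \<comment> \<open>Since M \<le> c q + 1 with c = \<open>coeff_norm s F\<close>, the first factor
    of \<open>Tsum_le\<close> is at most 4 c + 6; four times this is the constant 16 c + 24 of the
    statement.\<close>
  define M where "M = nat \<lceil>coeff_norm s F * q\<rceil>"
  have cn: "coeff_norm s F \<ge> 0" by (rule coeff_norm_nonneg)
  have q: "real q \<ge> 1" using assms(1) by simp
  have M: "coeff_norm s F * q \<le> M" "M \<le> coeff_norm s F * q + 1"
    using cn q by (auto simp: M_def)
  have "Tsum (real b / real q) q M \<le> (4 * M / q + 2) * (4 * (real q + q * (1 + ln q)))"
    using Tsum_le[of "int b" "int q" "real b / real q" q M] assms(1,2) by simp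
  also have "\<dots> = (4 * M / q + 2) * (4 * (real q * (2 + ln q)))" by (simp add: algebra_simps)
  also have "\<dots> \<le> (4 * coeff_norm s F + 6) * (4 * (real q * (2 + ln q)))"
  proof (rule mult_right_mono)
    have "4 * M / q \<le> 4 * (coeff_norm s F * q + 1) / q" using M q by (intro divide_right_mono) auto
    also have "\<dots> = 4 * coeff_norm s F + 4 / q" using q by (simp add: field_simps)
    also have "4 / q \<le> 4" using q by (simp add: field_simps)
    finally show "4 * M / q + 2 \<le> 4 * coeff_norm s F + 6" by simp
  qed (use q in auto)
  also have "\<dots> = (16 * coeff_norm s F + 24) * (real q * (2 + ln q))" by (simp add: algebra_simps)
  finally have T: "Tsum (real b / real q) q M \<le> (16 * coeff_norm s F + 24) * (real q * (2 + ln q))" .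
  have "(\<Sum>x\<in>{0..<int q}. (\<kappa> q x)\<^sup>2) \<le> (\<Sum>x\<in>{0..<int q}. k * \<kappa> q x)"
    unfolding power2_eq_square using k kappa_nonneg[OF assms(1)] by (intro sum_mono mult_right_mono) auto
  also have "\<dots> = k" using sum_kappa[OF assms(1)] by (simp flip: sum_distrib_left)
  finally have S: "(\<Sum>x\<in>{0..<int q}. (\<kappa> q x)\<^sup>2) \<le> k" .
  have "cmod (local_sum s F \<kappa> q b) \<le> (\<Sum>x\<in>{0..<int q}. \<kappa> q x) ^ (s - 10) * (\<Sum>x\<in>{0..<int q}. (\<kappa> q x)\<^sup>2) ^ 5
      * sqrt (Tsum (real b / real q) q M ^ 5)"
    unfolding local_sum_def residue_vectors_def
    by (rule weyl[of "\<lambda>x. x", OF _ M(1)]) (auto simp: kappa_nonneg[OF assms(1)] bij_betw_def)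
  also have "\<dots> \<le> k ^ 5 * sqrt (((16 * coeff_norm s F + 24) * (real q * (2 + ln (real q)))) ^ 5)"
    unfolding sum_kappa[OF assms(1)] using S T order_trans[OF kappa_nonneg[OF assms(1), of 0] k]
    by (intro mult_mono real_sqrt_le_mono power_mono) (auto intro!: sum_nonneg mult_nonneg_nonneg power_mono)
  finally show ?thesis .
qed

abbreviation "sterm \<equiv> singular_term s F t \<kappa>"

text \<open>At most q numerators, each of size q to the power -5/2 up to logarithms, give -3/2; the
  exponent -5/4 absorbs all logarithms whatever the constant of Condition K is.\<close>

lemma singular_term_bound: "\<exists>c\<ge>0. \<forall>q\<ge>1. cmod (sterm q) \<le> c * real q powr (-5/4)"
proof -
  obtain c0 k0 where k0: "c0 \<ge> 0" "eventually (\<lambda>q. \<forall>h. \<kappa> q h \<le> k0 * (ln (real q) powr c0 / real q)) sequentially"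
    using K unfolding condition_K_def by blast
  \<comment> \<open>Enlarging the constants makes both strictly positive, so that the asymptotic
    comparison below has factors of known sign.\<close>
  define c k where "c = c0 + 1" and "k = \<bar>k0\<bar> + 1"
  have ck: "c > 0" "k > 0" using k0(1) by (auto simp: c_def k_def)
  have "eventually (\<lambda>q::nat. ln (real q) \<ge> 1) sequentially" by real_asymp
  with k0(2) have k: "eventually (\<lambda>q. \<forall>h. \<kappa> q h \<le> k * (ln (real q) powr c / real q)) sequentially"
  proof eventually_elim
    case (elim q)
    have "k0 * (ln (real q) powr c0 / real q) \<le> k * (ln (real q) powr c / real q)"
      using elim by (intro mult_mono divide_right_mono powr_mono) (auto simp: c_def k_def)
    with elim show ?case by (meson order_trans)
  qed
  define C1 where "C1 = 16 * coeff_norm s F + 24"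
  have C1: "C1 > 0" using coeff_norm_nonneg[of s F] by (simp add: C1_def)
  have "eventually (\<lambda>q. cmod (sterm q) \<le> real q * ((k * (ln (real q) powr c / real q)) ^ 5 * sqrt ((C1 * (real q * (2 + ln (real q)))) ^ 5))) sequentially"
    using k eventually_ge_at_top[of 1]
  proof eventually_elim
    case (elim q)
    have "cmod (sterm q) \<le> (\<Sum>b\<in>totatives q. cmod (st q b))" unfolding singular_term_eq by (rule norm_sum)
    also have "\<dots> \<le> (\<Sum>b\<in>totatives q. (k * (ln (real q) powr c / real q)) ^ 5 * sqrt ((C1 * (real q * (2 + ln (real q)))) ^ 5))"
    proof (rule sum_mono)
      fix b assume b: "b \<in> totatives q"
      show "cmod (st q b) \<le> (k * (ln (real q) powr c / real q)) ^ 5 * sqrt ((C1 * (real q * (2 + ln (real q)))) ^ 5)"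
        using local_sum_bound[of q b "k * (ln (real q) powr c / real q)"] elim b
        by (simp add: st_def norm_mult C1_def totatives_def)
    qed
    also have "\<dots> = real (totient q) * ((k * (ln (real q) powr c / real q)) ^ 5 * sqrt ((C1 * (real q * (2 + ln (real q)))) ^ 5))"
      by (simp add: totient_def)
    also have "\<dots> \<le> real q * ((k * (ln (real q) powr c / real q)) ^ 5 * sqrt ((C1 * (real q * (2 + ln (real q)))) ^ 5))"
    proof (rule mult_right_mono)
      have "0 \<le> k * (ln (real q) powr c / real q)"
        using elim kappa_nonneg[of q 0] by (meson order_trans)
      then show "0 \<le> (k * (ln (real q) powr c / real q)) ^ 5 * sqrt ((C1 * (real q * (2 + ln (real q)))) ^ 5)"
        using elim C1 by (intro mult_nonneg_nonneg) auto
    qed (simp add: totient_le)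
    finally show ?case .
  qed
  then have "(\<lambda>q. cmod (sterm q)) \<in> O(\<lambda>q. real q * ((k * (ln (real q) powr c / real q)) ^ 5 * sqrt ((C1 * (real q * (2 + ln (real q)))) ^ 5)))"
    by (intro bigoI[where c = 1]) (auto elim!: eventually_mono)
  also have "(\<lambda>q. real q * ((k * (ln (real q) powr c / real q)) ^ 5 * sqrt ((C1 * (real q * (2 + ln (real q)))) ^ 5)))
      \<in> O(\<lambda>q. real q powr (-5/4))"
    using C1 ck by real_asymp
  finally show ?thesis using bigo_imp_bound_from_1[of "\<lambda>q. cmod (sterm q)" "\<lambda>q. real q powr (-5/4)"] by simp
qed

text \<open>That the sum is real and nonnegative is not visible from the series; it is read off from
  the Euler product, whose factors are limits of the nonnegative local masses. The last clause, with
  an explicit rate, is what the truncation at P in the circle method consumes.\<close>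

theorem singular_series:
  obtains SS c :: real where "SS \<ge> 0" "(\<lambda>q. sterm (Suc q)) sums of_real SS"
    "\<And>p. prime p \<Longrightarrow> convergent (\<lambda>m. real (p ^ m) * local_mass s F t \<kappa> (p ^ m))"
    "(\<lambda>p. if prime p then lim (\<lambda>m. real (p ^ m) * local_mass s F t \<kappa> (p ^ m)) else 1) has_prod SS"
    "c \<ge> 0" "\<And>N. N \<ge> 1 \<Longrightarrow> cmod ((\<Sum>q\<in>{1..N}. sterm q) - of_real SS) \<le> c * real N powr (-1/8)"
proof -
  obtain c where c: "c \<ge> 0" "\<And>q. q \<ge> 1 \<Longrightarrow> cmod (sterm q) \<le> c * real q powr (-5/4)"
    using singular_term_bound by blast
  have summ_powr: "summable (\<lambda>n. real (Suc n) powr r)" if "r < -1" for r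
    using that summable_real_powr_iff[of r] summable_Suc_iff[of "\<lambda>n. real n powr r"] by simp
  have bij: "bij_betw Suc UNIV {1..}"
    by (rule bij_betw_byWitness[where f' = "\<lambda>n. n - 1"]) auto
  have summ: "summable (\<lambda>q. cmod (sterm (Suc q)))"
  proof (rule summable_comparison_test')
    show "summable (\<lambda>q. c * real (Suc q) powr (-5/4))" by (intro summable_mult summ_powr) simp
    show "norm (cmod (sterm (Suc q))) \<le> c * real (Suc q) powr (-5/4)" if "q \<ge> 0" for q
      using c(2)[of "Suc q"] by simp
  qed
  have summ_on: "(\<lambda>q. cmod (sterm q)) summable_on {1..}"
    using norm_summable_imp_summable_on[of "\<lambda>q. cmod (sterm (Suc q))"] summ
      summable_on_reindex_bij_betw[OF bij, of "\<lambda>q. cmod (sterm q)"] by simp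
  have sums: "(\<lambda>q. sterm (Suc q)) sums infsum sterm {1..}"
  proof -
    have "((\<lambda>q. sterm (Suc q)) has_sum infsum sterm {1..}) UNIV"
      using abs_summable_summable[OF summ_on] summable_on_reindex_bij_betw[OF bij, of sterm]
        infsum_reindex_bij_betw[OF bij, of sterm] by (metis has_sum_infsum)
    then show ?thesis by (rule has_sum_imp_sums)
  qed
  define x where "x p m = real (p ^ m) * local_mass s F t \<kappa> (p ^ m)" for p m
  define K0 :: real where "K0 = 1 / (1 - 2 powr (-5/4))"
  have two: "2 powr (-5/4) < (1::real)" by (simp add: powr_less_one)
  have pow_bound: "cmod (sterm (p ^ Suc j)) \<le> c * real p powr (-5/4) * (2 powr (-5/4)) ^ j" if "prime p" for p j
  proof -
    have p2: "real p \<ge> 2" using prime_ge_2_nat[OF that] by simp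
    have "cmod (sterm (p ^ Suc j)) \<le> c * real (p ^ Suc j) powr (-5/4)"
      using that prime_gt_0_nat[of p] by (intro c(2)) (simp add: Suc_le_eq)
    also have "real (p ^ Suc j) powr (-5/4) = real p powr (-5/4) * (real p powr (-5/4)) ^ j"
      using p2 by (simp add: powr_mult flip: powr_realpow powr_powr) (simp add: powr_powr mult.commute)
    also have "\<dots> \<le> real p powr (-5/4) * (2 powr (-5/4)) ^ j"
      using p2 by (intro mult_left_mono power_mono powr_mono2') auto
    finally show ?thesis using c(1) by (simp add: mult_left_mono mult.assoc)
  qed
  have geo: "summable (\<lambda>j. (2 powr (-5/4)) ^ j :: real)" "(\<Sum>j. (2 powr (-5/4)) ^ j :: real) = K0"
    using two by (auto simp: K0_def suminf_geometric intro!: summable_geometric)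
  have sumpow: "summable (\<lambda>j. cmod (sterm (p ^ Suc j)))" if "prime p" for p
    using pow_bound[OF that] by (intro summable_comparison_test'[OF summable_mult[OF geo(1)]]) auto
  have sumpow': "summable (\<lambda>j. cmod (sterm (p ^ j)))" if "prime p" for p
    using sumpow[OF that] by (subst summable_Suc_iff[symmetric])
  define L where "L p = (\<Sum>j. sterm (p ^ j))" for p
  have x_lim: "(\<lambda>m. complex_of_real (x p m)) \<longlonglongrightarrow> L p" if p: "prime p" for p
  proof -
    have "(\<lambda>j. sterm (p ^ j)) sums L p"
      using summable_norm_cancel[OF sumpow'[OF p]] by (simp add: L_def summable_sums)
    then have "(\<lambda>m. \<Sum>j\<le>m. sterm (p ^ j)) \<longlonglongrightarrow> L p" by (simp add: sums_def_le)
    then show ?thesis using local_mass_prime_power[OF p] by (simp add: x_def)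
  qed
  have x_lim': "x p \<longlonglongrightarrow> Re (L p)" if p: "prime p" for p
    using tendsto_Re[OF x_lim[OF p]] by simp
  \<comment> \<open>The partial sums are real by the local mass identity, hence so is the
    limit.\<close>
  have L_real: "complex_of_real (Re (L p)) = L p" if p: "prime p" for p
    using x_lim[OF p] tendsto_of_real[OF x_lim'[OF p], where 'a = complex] by (rule LIMSEQ_unique[rotated])
  have limx: "lim (x p) = Re (L p)" if p: "prime p" for p using x_lim'[OF p] by (rule limI)
  have L1b: "\<bar>Re (L p) - 1\<bar> \<le> c * K0 * real p powr (-5/4)" if p: "prime p" for p
  proof -
    have "L p = sterm (p ^ 0) + (\<Sum>j. sterm (p ^ Suc j))"
      unfolding L_def using suminf_split_head[OF summable_norm_cancel[OF sumpow'[OF p]]] by simp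
    then have "L p - 1 = (\<Sum>j. sterm (p ^ Suc j))" using singular_term_1 by simp
    then have "cmod (L p - 1) \<le> (\<Sum>j. cmod (sterm (p ^ Suc j)))" using summable_norm[OF sumpow[OF p]] by simp
    also have "\<dots> \<le> (\<Sum>j. c * real p powr (-5/4) * (2 powr (-5/4)) ^ j)"
      using pow_bound[OF p] by (intro suminf_le sumpow[OF p] summable_mult geo) auto
    also have "\<dots> = c * real p powr (-5/4) * K0" using geo by (simp add: suminf_mult)
    finally have "cmod (L p - 1) \<le> c * K0 * real p powr (-5/4)" by (simp add: mult_ac)
    moreover have "\<bar>Re (L p) - 1\<bar> \<le> cmod (L p - 1)" using abs_Re_le_cmod[of "L p - 1"] by simp
    ultimately show ?thesis by simp
  qed
  define \<delta> where "\<delta> p = (if prime p then Re (L p) else 1)" for p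
  \<comment> \<open>Each prime factor is 1 plus a term of order p to the power -5/4, and convergence
    of the sum of these deviations gives a convergent product, even if finitely many factors
    vanish.\<close>
  have "abs_convergent_prod \<delta>"
    unfolding abs_convergent_prod_conv_summable
  proof (rule summable_comparison_test')
    show "summable (\<lambda>p. c * K0 * real p powr (-5/4))"
      by (intro summable_mult) (simp add: summable_real_powr_iff)
    show "norm (norm (\<delta> p - 1)) \<le> c * K0 * real p powr (-5/4)" if "p \<ge> 0" for p
      using L1b[of p] two c(1) by (auto simp: \<delta>_def K0_def)
  qed
  then have hp: "\<delta> has_prod prodinf \<delta>"
    by (intro convergent_prod_has_prod abs_convergent_prod_imp_convergent_prod)
  have nn: "\<delta> p \<ge> 0" for p
  proof (cases "prime p")
    case True
    have "x p m \<ge> 0" for m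
      unfolding x_def local_mass_def using True prime_gt_0_nat[of p]
      by (intro mult_nonneg_nonneg sum_nonneg prod_nonneg kappa_nonneg) (auto simp: Suc_le_eq)
    then have "Re (L p) \<ge> 0" using x_lim'[OF True] by (intro LIMSEQ_le_const) auto
    then show ?thesis by (simp add: \<delta>_def)
  qed (simp add: \<delta>_def)
  have SS: "complex_of_real (prodinf \<delta>) = infsum sterm {1..}"
  proof (rule LIMSEQ_unique)
    show "(\<lambda>N. complex_of_real (\<Prod>p\<le>N. \<delta> p)) \<longlonglongrightarrow> complex_of_real (prodinf \<delta>)"
      using has_prod_imp_tendsto[OF hp] by (rule tendsto_of_real)
    have "(\<lambda>N. \<Prod>p\<in>{p. prime p \<and> p \<le> N}. \<Sum>\<^sub>\<infinity>j. sterm (p ^ j)) \<longlonglongrightarrow> infsum sterm {1..}"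
      by (rule euler_product_tendsto[OF singular_term_1 singular_term_mult summ_on])
    moreover have "(\<Prod>p\<in>{p. prime p \<and> p \<le> N}. \<Sum>\<^sub>\<infinity>j. sterm (p ^ j)) = complex_of_real (\<Prod>p\<le>N. \<delta> p)" for N
    proof -
      have "complex_of_real (\<Prod>p\<le>N. \<delta> p) = (\<Prod>p\<le>N. complex_of_real (\<delta> p))" by simp
      also have "\<dots> = (\<Prod>p\<in>{p. prime p \<and> p \<le> N}. \<Sum>\<^sub>\<infinity>j. sterm (p ^ j))"
      proof (rule prod.mono_neutral_cong_right)
        fix p assume p: "p \<in> {p. prime p \<and> p \<le> N}"
        have "((\<lambda>j. sterm (p ^ j)) has_sum L p) UNIV"
          using p sumpow'[of p] summable_norm_cancel[OF sumpow'[of p]]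
          by (intro norm_summable_imp_has_sum) (auto simp: L_def summable_sums)
        then have "(\<Sum>\<^sub>\<infinity>j. sterm (p ^ j)) = L p" by (rule infsumI)
        then show "complex_of_real (\<delta> p) = (\<Sum>\<^sub>\<infinity>j. sterm (p ^ j))"
          using p L_real[of p] by (simp add: \<delta>_def)
      qed (auto simp: \<delta>_def)
      finally show ?thesis by simp
    qed
    ultimately show "(\<lambda>N. complex_of_real (\<Prod>p\<le>N. \<delta> p)) \<longlonglongrightarrow> infsum sterm {1..}" by simp
  qed
  define Z where "Z = (\<Sum>n. real (Suc n) powr (-9/8))"
  have tail: "cmod ((\<Sum>q\<in>{1..N}. sterm q) - of_real (prodinf \<delta>)) \<le> (c * Z) * real N powr (-1/8)" if N: "N \<ge> 1" for N
  proof -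
    have s: "summable (\<lambda>q. sterm (Suc q))" using summable_norm_cancel[OF summ] .
    have s2: "summable (\<lambda>n. cmod (sterm (Suc (n + N))))" using summ summable_iff_shift[of "\<lambda>q. cmod (sterm (Suc q))" N] by simp
    have "(\<Sum>q\<in>{1..N}. sterm q) = (\<Sum>q<N. sterm (Suc q))"
      by (rule sum.reindex_bij_witness[of _ Suc "\<lambda>n. n - 1"]) auto
    moreover have "of_real (prodinf \<delta>) = (\<Sum>q. sterm (Suc q))" using sums SS by (simp add: sums_iff)
    ultimately have "cmod ((\<Sum>q\<in>{1..N}. sterm q) - of_real (prodinf \<delta>)) = cmod (\<Sum>n. sterm (Suc (n + N)))"
      using suminf_minus_initial_segment[OF s, of N] by (simp add: norm_minus_commute)
    also have "\<dots> \<le> (\<Sum>n. cmod (sterm (Suc (n + N))))" using s2 by (rule summable_norm)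
    \<comment> \<open>With the index written as (n + 1) + N, the rate in N can be pulled out of the
      tail.\<close>
    also have "\<dots> \<le> (\<Sum>n. c * (real N powr (-1/8) * real (Suc n) powr (-9/8)))"
    proof (intro suminf_le s2 summable_mult summ_powr)
      fix n
      have "cmod (sterm (Suc (n + N))) \<le> c * real (Suc (n + N)) powr (-5/4)" by (rule c(2)) simp
      also have "\<dots> \<le> c * (real N powr (-1/8) * real (Suc n) powr (-9/8))"
        using powr_tail[of "Suc n" N] N c(1) by (intro mult_left_mono) auto
      finally show "cmod (sterm (Suc (n + N))) \<le> c * (real N powr (-1/8) * real (Suc n) powr (-9/8))" .
    qed simp
    also have "\<dots> = (c * Z) * real N powr (-1/8)"
      using summ_powr[of "-9/8"] by (simp add: Z_def suminf_mult summable_mult mult_ac)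
    finally show ?thesis .
  qed
  show ?thesis
  proof
    show "prodinf \<delta> \<ge> 0" using hp nn by (rule has_prod_nonneg)
    show "(\<lambda>q. sterm (Suc q)) sums of_real (prodinf \<delta>)" using sums SS by simp
    show "convergent (\<lambda>m. real (p ^ m) * local_mass s F t \<kappa> (p ^ m))" if "prime p" for p
      using x_lim'[OF that] unfolding x_def by (auto simp: convergent_def)
    have "\<delta> = (\<lambda>p. if prime p then lim (\<lambda>m. real (p ^ m) * local_mass s F t \<kappa> (p ^ m)) else 1)"
      using limx unfolding x_def by (auto simp: \<delta>_def)
    then show "(\<lambda>p. if prime p then lim (\<lambda>m. real (p ^ m) * local_mass s F t \<kappa> (p ^ m)) else 1) has_prod prodinf \<delta>"
      using hp by simp
    show "c * Z \<ge> 0" using c(1) summ_powr[of "-9/8"] by (auto simp: Z_def intro!: mult_nonneg_nonneg suminf_nonneg)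
  qed (rule tail)
qed

end

section \<open>Comparison of weighted sums with integrals\<close>

text \<open>Holds for any \<open>f\<close>: a non-integrable function has integral 0 by convention,
  and \<open>g\<close> is nonnegative.\<close>

lemma norm_lebesgue_integral_le:
  fixes f :: "'a \<Rightarrow> 'b :: {banach, second_countable_topology}"
  assumes "integrable M g" "\<And>x. x \<in> space M \<Longrightarrow> norm (f x) \<le> g x"
  shows "norm (\<integral>x. f x \<partial>M) \<le> (\<integral>x. g x \<partial>M)"
proof -
  have "norm (\<integral>x. f x \<partial>M) \<le> (\<integral>x. norm (f x) \<partial>M)" by (rule integral_norm_bound)
  also have "\<dots> \<le> (\<integral>x. g x \<partial>M)"
    using assms by (intro integral_mono') (auto intro: order_trans[OF norm_ge_zero])
  finally show ?thesis .
qed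

text \<open>Abel summation moves the differences onto \<open>g\<close>, whose total variation over
  \<open>N\<close> steps is at most \<open>N * V\<close>.\<close>

lemma abel_sum_bound:
  fixes c :: "nat \<Rightarrow> real" and g :: "nat \<Rightarrow> complex"
  assumes E: "\<And>n. n \<le> N \<Longrightarrow> \<bar>\<Sum>k\<le>n. c k\<bar> \<le> E" and g: "cmod (g N) \<le> 1"
    and V: "\<And>n. n < N \<Longrightarrow> cmod (g (Suc n) - g n) \<le> V"
  shows "cmod (\<Sum>k\<le>N. of_real (c k) * g k) \<le> E * (1 + real N * V)"
proof -
  define D where "D n = complex_of_real (\<Sum>k\<le>n. c k)" for n
  have "(\<Sum>k\<le>n. of_real (c k) * g k) = D n * g n - (\<Sum>k<n. D k * (g (Suc k) - g k))" for n
    by (induction n) (auto simp: D_def algebra_simps)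
  then have "cmod (\<Sum>k\<le>N. of_real (c k) * g k) \<le> cmod (D N * g N) + cmod (\<Sum>k<N. D k * (g (Suc k) - g k))"
    using norm_triangle_ineq4 by metis
  also have D: "cmod (D n) \<le> E" if "n \<le> N" for n
    using E[OF that] unfolding D_def norm_of_real .
  have "E \<ge> 0" using D[of N] norm_ge_zero[of "D N"] by linarith
  then have "cmod (D N * g N) \<le> E * 1"
    unfolding norm_mult using D[of N] g by (intro mult_mono) auto
  also have "cmod (\<Sum>k<N. D k * (g (Suc k) - g k)) \<le> (\<Sum>k<N. E * V)"
    using D V \<open>E \<ge> 0\<close> by (intro sum_norm_le) (auto simp: norm_mult intro!: mult_mono)
  finally show ?thesis by (simp add: algebra_simps)
qed

text \<open>On each unit interval \<open>g\<close> is replaced by its value at the right end, at a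
  cost of \<open>V\<close> times the mass of \<phi> there. At k = 0 truncated subtraction gives
  \<open>k - 1 = 0\<close>, so that term vanishes. Gauge integrals are used because adjacent
  intervals combine easily.\<close>

lemma integral_step_approx:
  fixes \<phi> :: "real \<Rightarrow> real" and g :: "real \<Rightarrow> complex"
  assumes \<phi>g: "(\<lambda>u. of_real (\<phi> u) * g u) integrable_on {0..X}" and \<phi>: "\<phi> integrable_on {0..X}"
    and \<phi>abs: "(\<lambda>u. \<bar>\<phi> u\<bar>) integrable_on {0..X}"
    and V: "\<And>u v. u \<in> {0..X} \<Longrightarrow> v \<in> {0..X} \<Longrightarrow> cmod (g u - g v) \<le> V * \<bar>u - v\<bar>" "V \<ge> 0"
    and n: "real n \<le> X"
  shows "cmod (integral {0..real n} (\<lambda>u. of_real (\<phi> u) * g u)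
      - (\<Sum>k\<le>n. of_real (integral {0..real k} \<phi> - integral {0..real (k - 1)} \<phi>) * g (real k)))
    \<le> V * integral {0..real n} (\<lambda>u. \<bar>\<phi> u\<bar>)"
  using n
proof (induction n)
  case 0
  then show ?case by simp
next
  case (Suc n)
  define J where "J = {real n..real (Suc n)}"
  have sub: "{0..real (Suc n)} \<subseteq> {0..X}" "J \<subseteq> {0..X}" using Suc.prems by (auto simp: J_def)
  have int: "h integrable_on {0..real (Suc n)}" "h integrable_on J"
    if "h integrable_on {0..X}" for h :: "real \<Rightarrow> 'b :: euclidean_space"
    using that sub unfolding J_def by (auto intro: integrable_on_subinterval)
  have split: "integral {0..real (Suc n)} h = integral {0..real n} h + integral J h"
    if "h integrable_on {0..X}" for h :: "real \<Rightarrow> 'b :: euclidean_space"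
    unfolding J_def using int(1)[OF that] by (intro Henstock_Kurzweil_Integration.integral_combine[symmetric]) auto
  have "cmod (integral J (\<lambda>u. of_real (\<phi> u) * g u) - of_real (integral J \<phi>) * g (real (Suc n)))
     \<le> V * integral J (\<lambda>u. \<bar>\<phi> u\<bar>)"
  proof -
    have i1: "(\<lambda>u. complex_of_real (\<phi> u) * g (real (Suc n))) integrable_on J"
      using integrable_linear[OF int(2)[OF \<phi>] bounded_linear_compose[OF bounded_linear_mult_left[of "g (real (Suc n))"] bounded_linear_of_real]] by (simp add: o_def)
    have "integral J (\<lambda>u. complex_of_real (\<phi> u) * g (real (Suc n))) = of_real (integral J \<phi>) * g (real (Suc n))"
      using integral_linear[OF int(2)[OF \<phi>] bounded_linear_compose[OF bounded_linear_mult_left[of "g (real (Suc n))"] bounded_linear_of_real]] by (simp add: o_def)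
    then have "integral J (\<lambda>u. of_real (\<phi> u) * g u) - of_real (integral J \<phi>) * g (real (Suc n))
        = integral J (\<lambda>u. of_real (\<phi> u) * g u) - integral J (\<lambda>u. of_real (\<phi> u) * g (real (Suc n)))"
      by (simp only:)
    also have "\<dots> = integral J (\<lambda>u. of_real (\<phi> u) * g u - of_real (\<phi> u) * g (real (Suc n)))"
      by (rule Henstock_Kurzweil_Integration.integral_diff[OF int(2)[OF \<phi>g] i1, symmetric])
    also have "cmod \<dots> \<le> integral J (\<lambda>u. V * \<bar>\<phi> u\<bar>)"
    proof (rule integral_norm_bound_integral)
      show "(\<lambda>u. of_real (\<phi> u) * g u - of_real (\<phi> u) * g (real (Suc n))) integrable_on J"
        using Henstock_Kurzweil_Integration.integrable_diff[OF int(2)[OF \<phi>g] i1] .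
      show "(\<lambda>u. V * \<bar>\<phi> u\<bar>) integrable_on J"
        using integrable_on_mult_right[OF int(2)[OF \<phi>abs]] .
      fix u assume u: "u \<in> J"
      have "cmod (g u - g (real (Suc n))) \<le> V * \<bar>u - real (Suc n)\<bar>"
        using u sub Suc.prems by (intro V) auto
      also have "\<dots> \<le> V * 1" using u V(2) by (intro mult_left_mono) (auto simp: J_def)
      finally have "\<bar>\<phi> u\<bar> * cmod (g u - g (real (Suc n))) \<le> \<bar>\<phi> u\<bar> * V" by (intro mult_left_mono) auto
      then show "cmod (of_real (\<phi> u) * g u - of_real (\<phi> u) * g (real (Suc n))) \<le> V * \<bar>\<phi> u\<bar>"
        unfolding right_diff_distrib[symmetric] norm_mult by (simp add: mult.commute)
    qed
    also have "\<dots> = V * integral J (\<lambda>u. \<bar>\<phi> u\<bar>)" by simp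
    finally show ?thesis .
  qed
  moreover have "cmod (integral {0..real n} (\<lambda>u. of_real (\<phi> u) * g u)
      - (\<Sum>k\<le>n. of_real (integral {0..real k} \<phi> - integral {0..real (k - 1)} \<phi>) * g (real k)))
    \<le> V * integral {0..real n} (\<lambda>u. \<bar>\<phi> u\<bar>)"
    using Suc by auto
  moreover have "integral {0..real (Suc n)} \<phi> - integral {0..real n} \<phi> = integral J \<phi>"
    using split[OF \<phi>] by simp
  ultimately show ?case
    unfolding split[OF \<phi>g] split[OF \<phi>abs] sum.atMost_Suc distrib_left diff_Suc_1
    using norm_triangle_ineq[of "integral {0..real n} (\<lambda>u. of_real (\<phi> u) * g u)
      - (\<Sum>k\<le>n. of_real (integral {0..real k} \<phi> - integral {0..real (k - 1)} \<phi>) * g (real k))"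
      "integral J (\<lambda>u. of_real (\<phi> u) * g u) - of_real (integral J \<phi>) * g (real (Suc n))"]
    by (simp add: algebra_simps)
qed

text \<open>Three sources of error: partial summation against the step weights \<open>d\<close>
  gives the term with \<open>E\<close>, freezing \<open>g\<close> on unit intervals gives
  \<open>V * M\<close>, and the incomplete last interval gives \<open>E2\<close>. A Lipschitz bound
  on \<open>g\<close> is all that is asked, which also gives its measurability.\<close>

lemma sum_integral_comparison:
  fixes w :: "nat \<Rightarrow> real" and \<phi> :: "real \<Rightarrow> real" and g :: "real \<Rightarrow> complex"
  assumes X: "X \<ge> 0" and \<phi>: "set_integrable lborel {0..X} \<phi>"
    and g: "\<And>u. u \<in> {0..X} \<Longrightarrow> cmod (g u) \<le> 1"
    and V: "\<And>u v. u \<in> {0..X} \<Longrightarrow> v \<in> {0..X} \<Longrightarrow> cmod (g u - g v) \<le> V * \<bar>u - v\<bar>" "V \<ge> 0"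
    and E: "\<And>n. n \<le> nat \<lfloor>X\<rfloor> \<Longrightarrow> \<bar>(\<Sum>k\<le>n. w k) - (LINT u:{0..real n}|lborel. \<phi> u)\<bar> \<le> E"
    and M: "(LINT u:{0..X}|lborel. \<bar>\<phi> u\<bar>) \<le> M"
    and E2: "(LINT u:{real (nat \<lfloor>X\<rfloor>)..X}|lborel. \<bar>\<phi> u\<bar>) \<le> E2"
  shows "cmod ((\<Sum>k\<le>nat \<lfloor>X\<rfloor>. of_real (w k) * g (real k)) - (LINT u:{0..X}|lborel. of_real (\<phi> u) * g u))
    \<le> E * (1 + X * V) + V * M + E2"
proof -
  define N where "N = nat \<lfloor>X\<rfloor>"
  have N: "real N \<le> X" using X by (simp add: N_def)
  have cont: "continuous_on {0..X} g"
  proof (rule lipschitz_on_continuous_on)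
    show "V-lipschitz_on {0..X} g"
      using V by (intro lipschitz_onI) (auto simp: dist_norm)
  qed
  have \<phi>gs: "set_integrable lborel {0..X} (\<lambda>u. of_real (\<phi> u) * g u)"
  proof (rule set_integrable_bound[OF \<phi>])
    have m1: "(\<lambda>u. indicator {0..X} u *\<^sub>R \<phi> u) \<in> borel_measurable lborel"
      using \<phi> unfolding set_integrable_def by (rule borel_measurable_integrable)
    have m2: "(\<lambda>u. indicator {0..X} u *\<^sub>R g u) \<in> borel_measurable borel"
      using cont by (intro borel_measurable_continuous_on_indicator) auto
    have "(\<lambda>u. complex_of_real (indicator {0..X} u *\<^sub>R \<phi> u) * (indicator {0..X} u *\<^sub>R g u)) \<in> borel_measurable lborel"
      using m1 m2 by measurable
    also have "(\<lambda>u. complex_of_real (indicator {0..X} u *\<^sub>R \<phi> u) * (indicator {0..X} u *\<^sub>R g u))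
        = (\<lambda>u. indicator {0..X} u *\<^sub>R (of_real (\<phi> u) * g u))"
      by (auto simp: indicator_def)
    finally show "set_borel_measurable lborel {0..X} (\<lambda>u. of_real (\<phi> u) * g u)"
      by (simp add: set_borel_measurable_def)
    show "AE u in lborel. u \<in> {0..X} \<longrightarrow> norm (of_real (\<phi> u) * g u) \<le> norm (\<phi> u)"
    proof (intro AE_I2 impI)
      fix u assume "u \<in> {0..X}"
      from mult_left_mono[OF g[OF this], of "\<bar>\<phi> u\<bar>"]
      show "norm (of_real (\<phi> u) * g u) \<le> norm (\<phi> u)" by (simp add: norm_mult)
    qed
  qed
  have \<phi>abs: "set_integrable lborel {0..X} (\<lambda>u. \<bar>\<phi> u\<bar>)" using \<phi> by (rule set_integrable_abs)
  have sub: "set_integrable lborel {c..d} h" if "set_integrable lborel {0..X} h" "0 \<le> c" "d \<le> X"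
    for c d and h :: "real \<Rightarrow> 'b :: euclidean_space"
    using that by (intro set_integrable_subset[OF that(1)]) auto
  have eq: "(LINT u:{c..d}|lborel. h u) = integral {c..d} h" if "set_integrable lborel {0..X} h" "0 \<le> c" "d \<le> X"
    for c d and h :: "real \<Rightarrow> 'b :: euclidean_space"
    using sub[OF that] by (rule set_borel_integral_eq_integral(2))
  have on: "h integrable_on {0..X}" if "set_integrable lborel {0..X} h" for h :: "real \<Rightarrow> 'b :: euclidean_space"
    using that by (rule set_borel_integral_eq_integral(1))
  define d where "d k = integral {0..real k} \<phi> - integral {0..real (k - 1)} \<phi>" for k
  have dsum: "(\<Sum>k\<le>n. d k) = integral {0..real n} \<phi>" for n
    by (induction n) (auto simp: d_def)
  have "cmod (\<Sum>k\<le>N. of_real (w k - d k) * g (real k)) \<le> E * (1 + real N * V)"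
  proof (rule abel_sum_bound)
    fix n assume n: "n \<le> N"
    then have "real n \<le> X" using N by linarith
    then show "\<bar>\<Sum>k\<le>n. w k - d k\<bar> \<le> E"
      using E[of n] n eq[OF \<phi>, of 0 "real n"] by (simp add: sum_subtractf dsum N_def)
  next
    fix n assume n: "n < N"
    then have "real (Suc n) \<le> X" using N by linarith
    then show "cmod (g (real (Suc n)) - g (real n)) \<le> V" using V(1)[of "real (Suc n)" "real n"] by auto
  qed (use g N in auto)
  moreover have "E * (1 + real N * V) \<le> E * (1 + X * V)"
    using N V(2) E[of 0] by (intro mult_left_mono) (auto intro: mult_right_mono)
  moreover have "cmod (integral {0..real N} (\<lambda>u. of_real (\<phi> u) * g u) - (\<Sum>k\<le>N. of_real (d k) * g (real k)))
      \<le> V * integral {0..real N} (\<lambda>u. \<bar>\<phi> u\<bar>)"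
    unfolding d_def by (rule integral_step_approx[OF on[OF \<phi>gs] on[OF \<phi>] on[OF \<phi>abs] V N])
  moreover have "V * integral {0..real N} (\<lambda>u. \<bar>\<phi> u\<bar>) \<le> V * M"
  proof (rule mult_left_mono)
    have "integral {0..real N} (\<lambda>u. \<bar>\<phi> u\<bar>) \<le> integral {0..X} (\<lambda>u. \<bar>\<phi> u\<bar>)"
      using N on[OF \<phi>abs] by (intro integral_subset_le) (auto intro: integrable_on_subinterval)
    also have "\<dots> \<le> M" using M eq[OF \<phi>abs, of 0 X] by simp
    finally show "integral {0..real N} (\<lambda>u. \<bar>\<phi> u\<bar>) \<le> M" .
  qed (rule V)
  moreover have "integral {0..X} (\<lambda>u. of_real (\<phi> u) * g u) = integral {0..real N} (\<lambda>u. of_real (\<phi> u) * g u)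
      + integral {real N..X} (\<lambda>u. of_real (\<phi> u) * g u)"
    using N on[OF \<phi>gs] by (intro Henstock_Kurzweil_Integration.integral_combine[symmetric]) auto
  moreover have "cmod (integral {real N..X} (\<lambda>u. of_real (\<phi> u) * g u)) \<le> E2"
  proof -
    have "cmod (integral {real N..X} (\<lambda>u. of_real (\<phi> u) * g u)) \<le> integral {real N..X} (\<lambda>u. \<bar>\<phi> u\<bar>)"
    proof (rule integral_norm_bound_integral)
      fix u assume "u \<in> {real N..X}"
      then have "cmod (g u) \<le> 1" by (intro g) auto
      from mult_left_mono[OF this, of "\<bar>\<phi> u\<bar>"]
      show "cmod (of_real (\<phi> u) * g u) \<le> \<bar>\<phi> u\<bar>" by (simp add: norm_mult)
    qed (use on[OF \<phi>gs] on[OF \<phi>abs] N in \<open>auto intro: integrable_on_subinterval\<close>)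
    also have "\<dots> \<le> E2" using E2 eq[OF \<phi>abs, of "real N" X] by (simp add: N_def)
    finally show ?thesis .
  qed
  moreover have "(\<Sum>k\<le>N. of_real (w k - d k) * g (real k)) = (\<Sum>k\<le>N. of_real (w k) * g (real k)) - (\<Sum>k\<le>N. of_real (d k) * g (real k))"
    by (simp add: algebra_simps sum_subtractf)
  moreover have "cmod (x1 - (y1 + y2)) \<le> cmod (x1 - x2) + cmod (y1 - x2) + cmod y2" for x1 x2 y1 y2 :: complex
  proof -
    have "x1 - (y1 + y2) = (x1 - x2) - (y1 - x2) - y2" by simp
    also have "cmod \<dots> \<le> cmod (x1 - x2) + cmod (y1 - x2) + cmod y2"
      by (meson norm_triangle_ineq4 order_trans add_right_mono)
    finally show ?thesis .
  qed
  ultimately show ?thesis unfolding N_def[symmetric] eq[OF \<phi>gs order_refl order_refl]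
    by (smt (verit, best))
qed

lemma sum_PiE_insert:
  assumes "i \<notin> I"
  shows "(\<Sum>x\<in>insert i I \<rightarrow>\<^sub>E D. g x) = (\<Sum>x\<in>I \<rightarrow>\<^sub>E D. \<Sum>k\<in>D. g (x(i := k)))"
  unfolding sum.cartesian_product
  by (rule sum.reindex_bij_witness[of _ "\<lambda>(x, k). x(i := k)" "\<lambda>x. (x(i := undefined), x i)"])
    (use assms in \<open>auto simp: PiE_def extensional_def\<close>)

lemma integrable_prod_times_bounded:
  fixes \<phi> :: "nat \<Rightarrow> real \<Rightarrow> real" and G :: "(nat \<Rightarrow> real) \<Rightarrow> complex"
  assumes "finite I" "\<And>i. i \<in> I \<Longrightarrow> integrable lborel (\<phi> i)"
    and "G \<in> borel_measurable (Pi\<^sub>M I (\<lambda>_. lborel))" "\<And>u. cmod (G u) \<le> C"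
  shows "integrable (Pi\<^sub>M I (\<lambda>_. lborel)) (\<lambda>u. of_real (\<Prod>i\<in>I. \<phi> i (u i)) * G u)"
proof (rule Bochner_Integration.integrable_bound)
  interpret product_sigma_finite "\<lambda>_::nat. lborel :: real measure" ..
  have i: "integrable (Pi\<^sub>M I (\<lambda>_. lborel)) (\<lambda>u. \<Prod>i\<in>I. \<phi> i (u i))"
    using assms(1,2) by (rule product_integrable_prod)
  then show "integrable (Pi\<^sub>M I (\<lambda>_. lborel)) (\<lambda>u. C * (\<Prod>i\<in>I. \<phi> i (u i)))" by simp
  show "(\<lambda>u. of_real (\<Prod>i\<in>I. \<phi> i (u i)) * G u) \<in> borel_measurable (Pi\<^sub>M I (\<lambda>_. lborel))"
    using borel_measurable_integrable[OF i] assms(3) by measurable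
  show "AE u in Pi\<^sub>M I (\<lambda>_. lborel). norm (of_real (\<Prod>i\<in>I. \<phi> i (u i)) * G u) \<le> norm (C * (\<Prod>i\<in>I. \<phi> i (u i)))"
  proof (rule AE_I2)
    fix u
    have "\<bar>\<Prod>i\<in>I. \<phi> i (u i)\<bar> * cmod (G u) \<le> \<bar>\<Prod>i\<in>I. \<phi> i (u i)\<bar> * \<bar>C\<bar>"
      using assms(4)[of u] by (intro mult_left_mono) auto
    then show "norm (of_real (\<Prod>i\<in>I. \<phi> i (u i)) * G u) \<le> norm (C * (\<Prod>i\<in>I. \<phi> i (u i)))"
      by (simp add: norm_mult abs_mult mult.commute del: of_real_prod)
  qed
qed

text \<open>Coordinates are exchanged one at a time, and each exchange costs \<open>E\<close> times
  the masses of the other coordinates, all at most \<open>M\<close>. The one-dimensional hypothesis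
  is uniform in the test function because freezing the other coordinates yields a different function
  each time.\<close>

lemma box_sum_integral_comparison:
  fixes w :: "nat \<Rightarrow> nat \<Rightarrow> real" and \<phi> :: "nat \<Rightarrow> real \<Rightarrow> real" and G :: "(nat \<Rightarrow> real) \<Rightarrow> complex"
  assumes "finite I" and X: "real N \<le> X"
    and w: "\<And>i k. w i k \<ge> 0" "\<And>i. (\<Sum>k\<le>N. w i k) \<le> M"
    and \<phi>: "\<And>i. integrable lborel (\<phi> i)" "\<And>i u. u \<notin> {0..X} \<Longrightarrow> \<phi> i u = 0" "\<And>i. (\<integral>u. \<bar>\<phi> i u\<bar> \<partial>lborel) \<le> M"
    and M: "M \<ge> 1" and E0: "E \<ge> 0"
    and E: "\<And>i g. (\<And>u. cmod (g u) \<le> 1) \<Longrightarrow>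
        (\<And>u v. u \<in> {0..X} \<Longrightarrow> v \<in> {0..X} \<Longrightarrow> cmod (g u - g v) \<le> V * \<bar>u - v\<bar>) \<Longrightarrow>
        cmod ((\<Sum>k\<le>N. of_real (w i k) * g (real k)) - (\<integral>u. of_real (\<phi> i u) * g u \<partial>lborel)) \<le> E"
    and G: "G \<in> borel_measurable (Pi\<^sub>M I (\<lambda>_. lborel))" "\<And>u. cmod (G u) \<le> 1"
      "\<And>i u y y'. i \<in> I \<Longrightarrow> u \<in> I \<rightarrow> {0..X} \<Longrightarrow> y \<in> {0..X} \<Longrightarrow> y' \<in> {0..X} \<Longrightarrow>
        cmod (G (u(i := y)) - G (u(i := y'))) \<le> V * \<bar>y - y'\<bar>"
      "\<And>u u'. (\<And>i. i \<in> I \<Longrightarrow> u i = u' i) \<Longrightarrow> G u = G u'"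
  shows "cmod ((\<Sum>x\<in>I \<rightarrow>\<^sub>E {..N}. of_real (\<Prod>i\<in>I. w i (x i)) * G (\<lambda>i. real (x i)))
      - (\<integral>u. of_real (\<Prod>i\<in>I. \<phi> i (u i)) * G u \<partial>Pi\<^sub>M I (\<lambda>_. lborel))) \<le> real (card I) * M ^ (card I - 1) * E"
  using assms(1) G
proof (induction I arbitrary: G rule: finite_induct)
  case empty
  interpret finite_measure "Pi\<^sub>M {} (\<lambda>_::nat. lborel :: real measure)"
    by rule (simp add: space_PiM)
  \<comment> \<open>Off the index set the lattice points carry \<open>real undefined\<close> and the
    integration variable carries \<open>undefined\<close>; the locality condition on
    \<open>G\<close> identifies the two.\<close>
  have "G u = G u'" for u u' by (rule empty.prems(4)) simp
  then have "G (\<lambda>_. real undefined) = G (\<lambda>_. undefined)" .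
  then show ?case by (simp add: PiM_empty lebesgue_integral_count_space_finite)
next
  case (insert i I)
  interpret product_sigma_finite "\<lambda>_::nat. lborel :: real measure" ..
  let ?P = "Pi\<^sub>M I (\<lambda>_. lborel :: real measure)"
  have pair: "(\<lambda>(x, y). G (x(i := y))) \<in> borel_measurable (?P \<Otimes>\<^sub>M lborel)"
    using measurable_compose[OF measurable_add_dim[of i I "\<lambda>_. lborel"] insert.prems(1)]
    by (simp add: case_prod_unfold fun_upd_def)
  have Gk: "(\<lambda>x. G (x(i := y))) \<in> borel_measurable ?P" for y
  proof -
    have "(\<lambda>x. (x, y)) \<in> measurable ?P (?P \<Otimes>\<^sub>M lborel)" by simp
    from measurable_compose[OF this pair] show ?thesis by simp
  qed
  define W where "W x = (\<Prod>j\<in>I. w j (x j))" for x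
  define \<Phi> where "\<Phi> u = (\<Prod>j\<in>I. \<phi> j (u j))" for u
  have Wnn: "W x \<ge> 0" for x unfolding W_def by (intro prod_nonneg w)
  have \<Phi>int: "integrable ?P \<Phi>" unfolding \<Phi>_def using insert.hyps(1) \<phi>(1) by (intro product_integrable_prod)
  have iG: "integrable ?P (\<lambda>u. of_real (\<Phi> u) * H u)" if "H \<in> borel_measurable ?P" "\<And>u. cmod (H u) \<le> C" for H C
    unfolding \<Phi>_def using insert.hyps(1) \<phi>(1) that by (rule integrable_prod_times_bounded)
  \<comment> \<open>The intermediate stage of the exchange: \<open>A\<close> has all other
    coordinates summed, \<open>D\<close> has them integrated with coordinate \<open>i\<close> still
    discrete; \<open>S\<close> and \<open>R\<close> are the sum and the integral over coordinate
    \<open>i\<close> for frozen others.\<close>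
  define A where "A k = (\<Sum>x\<in>I \<rightarrow>\<^sub>E {..N}. of_real (W x) * G ((\<lambda>j. real (x j))(i := real k)))" for k
  define D where "D k = (\<integral>u. of_real (\<Phi> u) * G (u(i := real k)) \<partial>?P)" for k
  define S where "S u = (\<Sum>k\<le>N. of_real (w i k) * G (u(i := real k)))" for u
  define R where "R u = (\<integral>y. of_real (\<phi> i y) * G (u(i := y)) \<partial>lborel)" for u
  have split: "(\<Sum>x\<in>insert i I \<rightarrow>\<^sub>E {..N}. of_real (\<Prod>j\<in>insert i I. w j (x j)) * G (\<lambda>j. real (x j)))
    = (\<Sum>k\<le>N. of_real (w i k) * A k)"
  proof -
    have *: "(\<Prod>j\<in>insert i I. w j ((x(i := k)) j)) = w i k * W x" for x k
      using insert.hyps by (auto simp: W_def intro!: prod.cong arg_cong2[of _ _ _ _ "(*)"])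
    have **: "(\<lambda>j. real ((x(i := k)) j)) = (\<lambda>j. real (x j))(i := real k)" for x k by auto
    have "(\<Sum>x\<in>insert i I \<rightarrow>\<^sub>E {..N}. of_real (\<Prod>j\<in>insert i I. w j (x j)) * G (\<lambda>j. real (x j)))
      = (\<Sum>x\<in>I \<rightarrow>\<^sub>E {..N}. \<Sum>k\<le>N. of_real (w i k * W x) * G ((\<lambda>j. real (x j))(i := real k)))"
      unfolding sum_PiE_insert[OF insert.hyps(2)] * ** ..
    also have "\<dots> = (\<Sum>k\<le>N. \<Sum>x\<in>I \<rightarrow>\<^sub>E {..N}. of_real (w i k * W x) * G ((\<lambda>j. real (x j))(i := real k)))"
      by (rule sum.swap)
    finally show ?thesis by (simp add: A_def sum_distrib_left mult_ac)
  qed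
  have AD: "cmod (A k - D k) \<le> real (card I) * M ^ (card I - 1) * E" if "k \<le> N" for k
    unfolding A_def D_def W_def \<Phi>_def
  proof (rule insert.IH)
    show "(\<lambda>u. G (u(i := real k))) \<in> borel_measurable ?P" by (rule Gk)
    show "cmod (G (u(i := real k))) \<le> 1" for u by (rule insert.prems)
    fix j u y y' assume j: "j \<in> I" "u \<in> I \<rightarrow> {0..X}" "y \<in> {0..X}" "y' \<in> {0..X}"
    have k: "real k \<in> {0..X}" using that X by auto
    have "cmod (G ((u(i := real k))(j := y)) - G ((u(i := real k))(j := y'))) \<le> V * \<bar>y - y'\<bar>"
      using j k by (intro insert.prems(3)) auto
    moreover have "(u(i := real k))(j := z) = u(j := z, i := real k)" for z
      using j insert.hyps by (intro fun_upd_twist) auto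
    ultimately show "cmod (G (u(j := y, i := real k)) - G (u(j := y', i := real k))) \<le> V * \<bar>y - y'\<bar>" by simp
  next
    fix u u' :: "nat \<Rightarrow> real" assume "\<And>j. j \<in> I \<Longrightarrow> u j = u' j"
    then show "G (u(i := real k)) = G (u'(i := real k))" by (intro insert.prems(4)) auto
  qed
  have Smeas: "S \<in> borel_measurable ?P" unfolding S_def using Gk by measurable
  have Sbound: "cmod (S u) \<le> M" for u
  proof -
    have "cmod (S u) \<le> (\<Sum>k\<le>N. w i k)" unfolding S_def
      using w(1) insert.prems(2) by (intro sum_norm_le) (simp add: norm_mult mult_left_le)
    then show ?thesis using w(2)[of i] by linarith
  qed
  have Gy: "(\<lambda>y. G (u(i := y))) \<in> borel_measurable lborel" if "u \<in> space ?P" for u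
    using measurable_compose[OF measurable_component_update[OF that insert.hyps(2)] insert.prems(1)] .
  have Rbound: "cmod (R u) \<le> M" for u
  proof -
    have "cmod (R u) \<le> (\<integral>y. \<bar>\<phi> i y\<bar> \<partial>lborel)"
      unfolding R_def using \<phi>(1)[of i] insert.prems(2)
      by (intro norm_lebesgue_integral_le) (auto simp: norm_mult mult_left_le)
    then show ?thesis using \<phi>(3)[of i] by linarith
  qed
  have Rmeas: "R \<in> borel_measurable ?P"
  proof -
    have "\<phi> i \<in> borel_measurable lborel" using \<phi>(1) by (rule borel_measurable_integrable)
    then have "(\<lambda>(u, y). complex_of_real (\<phi> i y) * G (u(i := y))) \<in> borel_measurable (?P \<Otimes>\<^sub>M lborel)"
      using pair by (simp add: case_prod_unfold) measurable
    then show ?thesis unfolding R_def by (rule lborel.borel_measurable_lebesgue_integral)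
  qed
  have SD: "(\<Sum>k\<le>N. of_real (w i k) * D k) = (\<integral>u. of_real (\<Phi> u) * S u \<partial>?P)"
  proof -
    have "(\<Sum>k\<le>N. of_real (w i k) * D k) = (\<Sum>k\<le>N. \<integral>u. of_real (w i k) * (of_real (\<Phi> u) * G (u(i := real k))) \<partial>?P)"
      by (simp add: D_def)
    also have "\<dots> = (\<integral>u. (\<Sum>k\<le>N. of_real (w i k) * (of_real (\<Phi> u) * G (u(i := real k)))) \<partial>?P)"
      by (intro Bochner_Integration.integral_sum[symmetric] integrable_mult_right iG[OF Gk insert.prems(2)])
    finally show ?thesis by (simp add: S_def sum_distrib_left mult_ac)
  qed
  have RD: "(\<integral>u. of_real (\<Prod>j\<in>insert i I. \<phi> j (u j)) * G u \<partial>Pi\<^sub>M (insert i I) (\<lambda>_. lborel)) = (\<integral>u. of_real (\<Phi> u) * R u \<partial>?P)"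
  proof -
    have "integrable (Pi\<^sub>M (insert i I) (\<lambda>_. lborel)) (\<lambda>u. of_real (\<Prod>j\<in>insert i I. \<phi> j (u j)) * G u)"
      using insert.hyps(1) \<phi>(1) insert.prems(1,2) by (intro integrable_prod_times_bounded[where C = 1]) auto
    from product_integral_insert[OF insert.hyps this]
    have "(\<integral>u. of_real (\<Prod>j\<in>insert i I. \<phi> j (u j)) * G u \<partial>Pi\<^sub>M (insert i I) (\<lambda>_. lborel))
      = (\<integral>u. (\<integral>y. of_real (\<Prod>j\<in>insert i I. \<phi> j ((u(i := y)) j)) * G (u(i := y)) \<partial>lborel) \<partial>?P)" .
    also have "(\<Prod>j\<in>insert i I. \<phi> j ((u(i := y)) j)) = \<Phi> u * \<phi> i y" for u y
      using insert.hyps by (auto simp: \<Phi>_def mult.commute intro!: prod.cong arg_cong2[of _ _ _ _ "(*)"])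
    then have "(\<integral>u. (\<integral>y. of_real (\<Prod>j\<in>insert i I. \<phi> j ((u(i := y)) j)) * G (u(i := y)) \<partial>lborel) \<partial>?P)
      = (\<integral>u. of_real (\<Phi> u) * R u \<partial>?P)" by (simp add: R_def mult.assoc)
    finally show ?thesis .
  qed
  have "cmod ((\<Sum>k\<le>N. of_real (w i k) * A k) - (\<Sum>k\<le>N. of_real (w i k) * D k)) \<le> (\<Sum>k\<le>N. w i k * (real (card I) * M ^ (card I - 1) * E))"
    unfolding sum_subtractf[symmetric] right_diff_distrib[symmetric]
    using AD w(1) by (intro sum_norm_le) (auto simp: norm_mult intro: mult_left_mono)
  also have "\<dots> = (\<Sum>k\<le>N. w i k) * (real (card I) * M ^ (card I - 1) * E)" by (simp add: sum_distrib_right)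
  also have "\<dots> \<le> M * (real (card I) * M ^ (card I - 1) * E)"
    using w(2) M E0 by (intro mult_right_mono) auto
  also have "\<dots> = real (card I) * M ^ card I * E" by (cases "card I") auto
  finally have 1: "cmod ((\<Sum>k\<le>N. of_real (w i k) * A k) - (\<integral>u. of_real (\<Phi> u) * S u \<partial>?P)) \<le> real (card I) * M ^ card I * E"
    unfolding SD .
  have "cmod ((\<integral>u. of_real (\<Phi> u) * S u \<partial>?P) - (\<integral>u. of_real (\<Phi> u) * R u \<partial>?P))
      = cmod (\<integral>u. of_real (\<Phi> u) * S u - of_real (\<Phi> u) * R u \<partial>?P)"
    using iG[OF Smeas Sbound] iG[OF Rmeas Rbound] by simp
  also have "\<dots> \<le> (\<integral>u. \<bar>\<Phi> u\<bar> * E \<partial>?P)"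
  proof (rule norm_lebesgue_integral_le)
    show "integrable ?P (\<lambda>u. \<bar>\<Phi> u\<bar> * E)" using \<Phi>int by simp
    fix u assume u: "u \<in> space ?P"
    show "cmod (of_real (\<Phi> u) * S u - of_real (\<Phi> u) * R u) \<le> \<bar>\<Phi> u\<bar> * E"
    proof (cases "u \<in> I \<rightarrow> {0..X}")
      case True
      have "cmod (S u - R u) \<le> E" unfolding S_def R_def
      proof (rule E)
        show "cmod (G (u(i := y))) \<le> 1" for y by (rule insert.prems)
        fix y y' assume y: "y \<in> {0..X}" "y' \<in> {0..X}"
        \<comment> \<open>The Lipschitz hypothesis wants a point of the larger box; the entry 0 is a
          placeholder that is overwritten at once.\<close>
        have "u(i := 0) \<in> insert i I \<rightarrow> {0..X}" using True X by (auto simp: Pi_iff)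
        from insert.prems(3)[OF insertI1 this y]
        show "cmod (G (u(i := y)) - G (u(i := y'))) \<le> V * \<bar>y - y'\<bar>" unfolding fun_upd_upd .
      qed
      then show ?thesis unfolding right_diff_distrib[symmetric] norm_mult norm_of_real by (intro mult_left_mono) auto
    next
      case False
      \<comment> \<open>Off the box a one-dimensional factor vanishes, so the bound is needed only
        where \<open>G\<close> is controlled.\<close>
      then obtain j where "j \<in> I" "u j \<notin> {0..X}" by (meson Pi_I)
      then have "\<Phi> u = 0" unfolding \<Phi>_def using insert.hyps(1) \<phi>(2) by (intro prod_zero) auto
      then show ?thesis by simp
    qed
  qed
  also have "\<dots> = (\<integral>u. (\<Prod>j\<in>I. \<bar>\<phi> j (u j)\<bar>) \<partial>?P) * E" by (simp add: \<Phi>_def abs_prod)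
  also have "(\<integral>u. (\<Prod>j\<in>I. \<bar>\<phi> j (u j)\<bar>) \<partial>?P) = (\<Prod>j\<in>I. \<integral>u. \<bar>\<phi> j u\<bar> \<partial>lborel)"
    using insert.hyps(1) \<phi>(1) by (intro product_integral_prod) auto
  also have "\<dots> \<le> M ^ card I"
    using \<phi>(3) by (intro prod_le_power) (auto simp: M)
  finally have 2: "cmod ((\<integral>u. of_real (\<Phi> u) * S u \<partial>?P) - (\<integral>u. of_real (\<Phi> u) * R u \<partial>?P)) \<le> M ^ card I * E"
    using E0 by (simp add: mult_right_mono)
  have "cmod ((\<Sum>k\<le>N. of_real (w i k) * A k) - (\<integral>u. of_real (\<Phi> u) * R u \<partial>?P))
      \<le> real (card I) * M ^ card I * E + M ^ card I * E"
    using norm_triangle_ineq[of "(\<Sum>k\<le>N. of_real (w i k) * A k) - (\<integral>u. of_real (\<Phi> u) * S u \<partial>?P)"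
      "(\<integral>u. of_real (\<Phi> u) * S u \<partial>?P) - (\<integral>u. of_real (\<Phi> u) * R u \<partial>?P)"] 1 2 by simp
  then show ?case unfolding split RD using insert.hyps by (simp add: algebra_simps)
qed

text \<open>A quadratic form has derivative of order X on a box of side X; this turns
  \<bar>\<beta>\<bar> \<le> P / X^2 into an oscillation rate P / X.\<close>

lemma qform_lipschitz:
  assumes "i < s" "u \<in> {..<s} \<rightarrow> {0..X}" "y \<in> {0..X}" "y' \<in> {0..X}"
  shows "\<bar>qform s F (u(i := y)) - qform s F (u(i := y'))\<bar> \<le> coeff_norm s F * X * \<bar>y - y'\<bar>"
proof -
  define v where "v = u(i := y)"
  define v' where "v' = u(i := y')"
  have b: "\<bar>v j\<bar> \<le> X" "\<bar>v' j\<bar> \<le> X" "\<bar>v j - v' j\<bar> \<le> \<bar>y - y'\<bar>" if "j < s" for j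
    using assms that by (auto simp: v_def v'_def Pi_iff)
  have "\<bar>qform s F v - qform s F v'\<bar> = \<bar>\<Sum>j<s. \<Sum>k<s. F $$ (j, k) * (v j * v k - v' j * v' k)\<bar>"
    by (simp add: qform_def sum_subtractf right_diff_distrib mult.assoc)
  also have "\<dots> \<le> (\<Sum>j<s. \<Sum>k<s. \<bar>F $$ (j, k)\<bar> * (2 * X * \<bar>y - y'\<bar>))"
  proof (intro order_trans[OF sum_abs] sum_mono)
    fix j k assume jk: "j \<in> {..<s}" "k \<in> {..<s}"
    have "v j * v k - v' j * v' k = (v j - v' j) * v k + v' j * (v k - v' k)" by (simp add: algebra_simps)
    also have "\<bar>\<dots>\<bar> \<le> \<bar>v j - v' j\<bar> * \<bar>v k\<bar> + \<bar>v' j\<bar> * \<bar>v k - v' k\<bar>"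
      by (metis abs_mult abs_triangle_ineq)
    also have "\<dots> \<le> \<bar>y - y'\<bar> * X + X * \<bar>y - y'\<bar>"
      using jk b[of j] b[of k] by (intro add_mono mult_mono) auto
    finally show "\<bar>F $$ (j, k) * (v j * v k - v' j * v' k)\<bar> \<le> \<bar>F $$ (j, k)\<bar> * (2 * X * \<bar>y - y'\<bar>)"
      unfolding abs_mult by (intro mult_left_mono) auto
  qed
  also have "\<dots> = coeff_norm s F * X * \<bar>y - y'\<bar>"
    by (simp add: coeff_norm_def sum_distrib_left sum_distrib_right abs_mult mult_ac)
  finally show ?thesis by (simp add: v_def v'_def)
qed

lemma measurable_qform:
  "qform s F \<in> borel_measurable (Pi\<^sub>M {..<s} (\<lambda>_. lborel))"
  unfolding qform_def by measurable

lemma e_borel_measurable [measurable]: "e \<in> borel_measurable borel"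
  unfolding e_def by measurable

section \<open>Growth of the weights and their smooth approximation\<close>

lemma log_powr_le_powr:
  assumes "r > 0" "\<epsilon> > 0"
  shows "eventually (\<lambda>X::real. ln X powr p \<le> \<epsilon> * X powr r) at_top"
proof -
  have "((\<lambda>X::real. ln X powr p / X powr r) \<longlongrightarrow> 0) at_top" using assms(1) by real_asymp
  then have "eventually (\<lambda>X::real. ln X powr p / X powr r < \<epsilon>) at_top"
    using assms(2) by (rule order_tendstoD)
  then show ?thesis
    using eventually_gt_at_top[of 0] by eventually_elim (simp add: field_simps)
qed

lemma wsum_nonneg: "(\<And>x. a x \<ge> 0) \<Longrightarrow> wsum a X \<ge> 0"
  by (simp add: wsum_def sum_nonneg)

lemma wsum_mono: "(\<And>x. a x \<ge> 0) \<Longrightarrow> X \<le> Y \<Longrightarrow> wsum a X \<le> wsum a Y"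
  unfolding wsum_def by (intro sum_mono2) (auto simp: nat_mono floor_mono intro: order_trans)

lemma sum_atMost_eq_wsum: "(\<Sum>k\<le>nat \<lfloor>X\<rfloor>. a k) = a 0 + wsum a X"
proof -
  have "{..nat \<lfloor>X\<rfloor>} = insert 0 {1..nat \<lfloor>X\<rfloor>}" by auto
  then show ?thesis by (simp add: wsum_def)
qed

locale circle_problem = quadratic_problem +
  assumes L2: "condition_L2 a"
begin

lemma ex_pos_weight: "\<exists>x\<ge>1. a x > 0"
proof (rule ccontr)
  assume "\<not> (\<exists>x\<ge>1. a x > 0)"
  then have "a x = 0" if "x \<ge> 1" for x using a_nonneg[of x] that by force
  then have "wsum a X = 0" for X by (simp add: wsum_def)
  then show False using eventually_happens'[OF _ eventually_wsum_ge[of 1]] by simp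
qed

text \<open>Also covers \<open>a 0\<close>, which neither Condition L2 nor \<open>wsum\<close> sees:
  its square is a fixed multiple \<open>r\<close> of the square of one positive weight
  \<open>a y\<close>. Both constants are made strictly positive for later asymptotics.\<close>

lemma weight_squares_bound:
  obtains c C where "c > 0" "C > 0"
    "eventually (\<lambda>X. (\<Sum>x\<le>nat \<lfloor>X\<rfloor>. (a x)\<^sup>2) \<le> C * ((wsum a X)\<^sup>2 / X * ln X powr c)) at_top"
proof -
  obtain c0 C0 where c0: "c0 \<ge> 0" and
    C0: "\<And>X. X \<ge> 2 \<Longrightarrow> (\<Sum>x\<in>{1..nat \<lfloor>X\<rfloor>}. (a x)\<^sup>2) \<le> C0 * ((wsum a X)\<^sup>2 / X * ln X powr c0)"
    using L2 unfolding condition_L2_def by blast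
  obtain y where y: "y \<ge> 1" "a y > 0" using ex_pos_weight by blast
  define r where "r = (a 0)\<^sup>2 / (a y)\<^sup>2"
  have r: "r \<ge> 0" by (simp add: r_def)
  have "eventually (\<lambda>X::real. ln X \<ge> 1) at_top" by real_asymp
  then have "eventually (\<lambda>X. (\<Sum>x\<le>nat \<lfloor>X\<rfloor>. (a x)\<^sup>2) \<le> ((1 + r) * (\<bar>C0\<bar> + 1)) * ((wsum a X)\<^sup>2 / X * ln X powr (c0 + 1))) at_top"
    using eventually_ge_at_top[of 2] eventually_ge_at_top[of "real y"]
  proof eventually_elim
    case (elim X)
    define Q where "Q = (\<Sum>x\<in>{1..nat \<lfloor>X\<rfloor>}. (a x)\<^sup>2)"
    have "(a y)\<^sup>2 \<le> Q"
      unfolding Q_def using elim y by (intro member_le_sum) (auto simp: le_nat_floor)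
    then have "r * (a y)\<^sup>2 \<le> r * Q" using r by (rule mult_left_mono)
    moreover have "r * (a y)\<^sup>2 = (a 0)\<^sup>2" using y by (simp add: r_def)
    moreover have "{..nat \<lfloor>X\<rfloor>} = insert 0 {1..nat \<lfloor>X\<rfloor>}" by auto
    ultimately have "(\<Sum>x\<le>nat \<lfloor>X\<rfloor>. (a x)\<^sup>2) \<le> (1 + r) * Q"
      by (simp add: Q_def algebra_simps)
    also have "Q \<le> C0 * ((wsum a X)\<^sup>2 / X * ln X powr c0)" unfolding Q_def using elim by (intro C0) auto
    also have "\<dots> \<le> (\<bar>C0\<bar> + 1) * ((wsum a X)\<^sup>2 / X * ln X powr (c0 + 1))"
      using elim by (intro mult_mono powr_mono) auto
    finally show ?case using r by (simp add: mult_left_mono mult.assoc)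
  qed
  then show ?thesis using c0 r by (intro that[of "c0 + 1" "(1 + r) * (\<bar>C0\<bar> + 1)"]) (auto intro!: mult_pos_pos)
qed

text \<open>One positive weight keeps the square sum away from zero, and Condition L2 then forces
  A(X)^2 to be at least of order X over a power of log X. Hence bounded errors are negligible
  against A(X) divided by any power of log X.\<close>

lemma wsum_growth: "eventually (\<lambda>X. ln X powr k \<le> wsum a X) at_top"
proof -
  obtain c C where c: "c > 0" "C > 0"
    "eventually (\<lambda>X. (\<Sum>x\<le>nat \<lfloor>X\<rfloor>. (a x)\<^sup>2) \<le> C * ((wsum a X)\<^sup>2 / X * ln X powr c)) at_top"
    by (rule weight_squares_bound)
  obtain y where y: "y \<ge> 1" "a y > 0" using ex_pos_weight by blast
  define \<nu> where "\<nu> = (a y)\<^sup>2 / C"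
  have \<nu>: "\<nu> > 0" using y c by (simp add: \<nu>_def)
  have "eventually (\<lambda>X. ln X powr (2 * k + c) \<le> \<nu> * X powr 1) at_top"
    using \<nu> by (intro log_powr_le_powr) auto
  with c(3) show ?thesis
    using eventually_ge_at_top[of 3] eventually_ge_at_top[of "real y"]
  proof eventually_elim
    case (elim X)
    have L: "ln X > 0" using elim by simp
    have "(a y)\<^sup>2 \<le> (\<Sum>x\<le>nat \<lfloor>X\<rfloor>. (a x)\<^sup>2)"
      using elim y by (intro member_le_sum) (auto simp: le_nat_floor)
    then have "(a y)\<^sup>2 \<le> C * ((wsum a X)\<^sup>2 / X * ln X powr c)" using elim(1) by (rule order_trans)
    then have le1: "\<nu> * (X / ln X powr c) \<le> (wsum a X)\<^sup>2"
      using L c(2) elim by (simp add: \<nu>_def field_simps)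
    have "(ln X powr k)\<^sup>2 \<le> \<nu> * (X / ln X powr c)"
    proof -
      have "(ln X powr k)\<^sup>2 * ln X powr c = ln X powr (2 * k + c)"
        by (simp add: power2_eq_square algebra_simps flip: powr_add)
      then show ?thesis using elim L by (simp add: pos_le_divide_eq)
    qed
    then have "(ln X powr k)\<^sup>2 \<le> (wsum a X)\<^sup>2" using le1 by (rule order_trans)
    then show ?case by (rule power2_le_imp_le) (intro mult_nonneg_nonneg wsum_nonneg a_nonneg powr_ge_zero)
  qed
qed

text \<open>Cauchy's inequality on the first sqrt X terms and Condition L2 give A(sqrt X)^2 at most
  of order A(X)^2 X^(-1/2) up to logarithms. So arguments below sqrt X can be treated trivially, and
  above it log n is at least half of log X.\<close>

lemma wsum_sqrt_le: "eventually (\<lambda>X. wsum a (sqrt X) \<le> wsum a X * ln X powr (-k)) at_top"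
proof -
  obtain c C where c: "c > 0" "C > 0"
    "eventually (\<lambda>X. (\<Sum>x\<le>nat \<lfloor>X\<rfloor>. (a x)\<^sup>2) \<le> C * ((wsum a X)\<^sup>2 / X * ln X powr c)) at_top"
    by (rule weight_squares_bound)
  have "eventually (\<lambda>X. ln X powr (2 * k + c) \<le> (1 / C) * X powr (1/2)) at_top"
    using c by (intro log_powr_le_powr) auto
  with c(3) show ?thesis
    using eventually_ge_at_top[of 3]
  proof eventually_elim
    case (elim X)
    have L: "ln X > 0" using elim by simp
    have small: "C * (sqrt X / X * ln X powr c) \<le> (ln X powr (-k))\<^sup>2"
    proof -
      have "C * ln X powr (2 * k + c) \<le> sqrt X" using elim c by (simp add: powr_half_sqrt field_simps)
      then have "C * ln X powr (2 * k + c) * sqrt X \<le> sqrt X * sqrt X" using elim by (intro mult_right_mono) auto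
      then have "C * ln X powr (2 * k + c) * sqrt X / X \<le> 1" using elim by simp
      then have "ln X powr (-(2 * k)) * (C * ln X powr (2 * k + c) * sqrt X / X) \<le> ln X powr (-(2 * k)) * 1"
        by (intro mult_left_mono) auto
      moreover have "ln X powr (-(2 * k)) * ln X powr (2 * k + c) = ln X powr c" by (simp flip: powr_add)
      then have "C * (sqrt X / X * ln X powr c) = ln X powr (-(2 * k)) * (C * ln X powr (2 * k + c) * sqrt X / X)"
        by (simp add: mult_ac)
      ultimately have "C * (sqrt X / X * ln X powr c) \<le> ln X powr (-(2 * k))" by (simp only: mult_1_right)
      also have "\<dots> = (ln X powr (-k))\<^sup>2" by (simp add: power2_eq_square flip: powr_add)
      finally show ?thesis .
    qed
    define n where "n = nat \<lfloor>sqrt X\<rfloor>"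
    have sX: "sqrt X \<le> X" using elim by (intro real_le_lsqrt self_le_power) auto
    have "(wsum a (sqrt X))\<^sup>2 = (\<Sum>x\<in>{1..n}. a x * 1)\<^sup>2" by (simp add: wsum_def n_def)
    also have "\<dots> \<le> (\<Sum>x\<in>{1..n}. (a x)\<^sup>2) * (\<Sum>x\<in>{1..n}. 1\<^sup>2)" by (rule Cauchy_Schwarz_ineq_sum)
    also have "\<dots> = (\<Sum>x\<in>{1..n}. (a x)\<^sup>2) * real n" by simp
    also have "\<dots> \<le> (\<Sum>x\<le>nat \<lfloor>X\<rfloor>. (a x)\<^sup>2) * sqrt X"
    proof (intro mult_mono sum_mono2)
      have "n \<le> nat \<lfloor>X\<rfloor>" unfolding n_def using sX by (intro nat_mono floor_mono)
      then show "{1..n} \<subseteq> {..nat \<lfloor>X\<rfloor>}" by auto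
      show "real n \<le> sqrt X" using elim by (simp add: n_def)
    qed (auto intro: sum_nonneg)
    also have "\<dots> \<le> C * ((wsum a X)\<^sup>2 / X * ln X powr c) * sqrt X"
      using elim by (intro mult_right_mono) auto
    also have "\<dots> = (wsum a X)\<^sup>2 * (C * (sqrt X / X * ln X powr c))" by simp
    also have "\<dots> \<le> (wsum a X)\<^sup>2 * (ln X powr (-k))\<^sup>2" using small by (intro mult_left_mono) auto
    finally have "(wsum a (sqrt X))\<^sup>2 \<le> (wsum a X * ln X powr (-k))\<^sup>2" by (simp add: power_mult_distrib)
    then show ?case by (rule power2_le_imp_le) (intro mult_nonneg_nonneg wsum_nonneg a_nonneg powr_ge_zero)
  qed
qed

lemma smooth_approx_deriv:
  assumes "smooth_approximation a m \<Psi>" "x > 0"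
  shows "(\<Psi> has_real_derivative deriv \<Psi> x) (at x)" "isCont (deriv \<Psi>) x"
proof -
  have sm: "smooth_on_pos \<Psi>" using assms by (simp add: smooth_approximation_def)
  have x: "x \<in> {0<..}" "open {0::real<..}" using assms by auto
  have "(deriv ^^ 0) \<Psi> differentiable_on {0<..}" "(deriv ^^ 1) \<Psi> differentiable_on {0<..}"
    using sm unfolding smooth_on_pos_def by blast+
  then have "\<Psi> differentiable_on {0<..}" "deriv \<Psi> differentiable_on {0<..}" by simp_all
  then have d: "\<Psi> differentiable (at x)" "deriv \<Psi> differentiable (at x)"
    using x by (auto simp: differentiable_on_eq_differentiable_at)
  show "(\<Psi> has_real_derivative deriv \<Psi> x) (at x)"
    using d(1) by (metis DERIV_imp_deriv real_differentiable_def)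
  show "isCont (deriv \<Psi>) x"
    using d(2) differentiable_imp_continuous_within by blast
qed

lemma smooth_approx_integrable:
  assumes "smooth_approximation a m \<Psi>"
  shows "set_integrable lborel {0..X} (deriv \<Psi>)"
proof -
  have 1: "set_integrable lborel {0<..1} (deriv \<Psi>)" using assms by (simp add: smooth_approximation_def)
  \<comment> \<open>Nothing is known about the value of \<open>deriv \<Psi>\<close> at 0, but a
    single point is a null set.\<close>
  have 0: "set_integrable lborel {0} (deriv \<Psi>)"
  proof -
    have "(\<lambda>u. indicator {0} u *\<^sub>R deriv \<Psi> u) = (\<lambda>u. indicator {0} u *\<^sub>R deriv \<Psi> (0 :: real))"
      by (auto simp: indicator_def)
    then show ?thesis unfolding set_integrable_def by simp
  qed
  have "continuous_on {1..max 1 X} (deriv \<Psi>)"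
    using smooth_approx_deriv(2)[OF assms] by (intro continuous_at_imp_continuous_on ballI) auto
  then have 2: "set_integrable lborel {1..max 1 X} (deriv \<Psi>)"
    by (rule borel_integrable_atLeastAtMost')
  have "set_integrable lborel ({0} \<union> {0<..1} \<union> {1..max 1 X}) (deriv \<Psi>)"
    using 0 1 2 by (intro set_integrable_Un) auto
  then show ?thesis by (rule set_integrable_subset) auto
qed

text \<open>The fundamental theorem is applied from 1 on, since \<Psi> is smooth on the positive
  reals only; the part over [0, 1] stays as a constant.\<close>

lemma smooth_approx_integral:
  assumes "smooth_approximation a m \<Psi>" "n \<ge> 1"
  shows "(LINT u:{0..real n}|lborel. deriv \<Psi> u) = \<Psi> n - \<Psi> 1 + (LINT u:{0..1}|lborel. deriv \<Psi> u)"
proof -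
  have eq: "(LINT u:{0..b}|lborel. deriv \<Psi> u) = integral {0..b} (deriv \<Psi>)" "deriv \<Psi> integrable_on {0..b}" for b
    using set_borel_integral_eq_integral[OF smooth_approx_integrable[OF assms(1), of b]] by auto
  have "(deriv \<Psi> has_integral (\<Psi> n - \<Psi> 1)) {1..real n}"
    using assms smooth_approx_deriv(1)[OF assms(1)]
    by (intro fundamental_theorem_of_calculus)
      (auto simp: has_real_derivative_iff_has_vector_derivative[symmetric] intro: has_field_derivative_at_within)
  then have "integral {1..real n} (deriv \<Psi>) = \<Psi> n - \<Psi> 1" by (rule integral_unique)
  moreover have "integral {0..1} (deriv \<Psi>) + integral {1..real n} (deriv \<Psi>) = integral {0..real n} (deriv \<Psi>)"
    using assms(2) eq(2) by (intro Henstock_Kurzweil_Integration.integral_combine) auto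
  ultimately show ?thesis unfolding eq(1) by simp
qed

text \<open>The summand 1 pays for the constant from [0, 1] and for the finitely many n before the
  asymptotics set in. The sharp bound starts at 3, where ln n \<ge> 1; the crude one holds for all n
  and serves below sqrt X.\<close>

lemma smooth_approx_error:
  assumes sa: "smooth_approximation a m \<Psi>"
  obtains C where "C \<ge> 0"
    "\<And>n. \<bar>wsum a (real n) - (LINT u:{0..real n}|lborel. deriv \<Psi> u)\<bar> \<le> C * (1 + wsum a (real n))"
    "\<And>n. n \<ge> 3 \<Longrightarrow> \<bar>wsum a (real n) - (LINT u:{0..real n}|lborel. deriv \<Psi> u)\<bar> \<le> C * (1 + wsum a (real n) / ln (real n) ^ m)"
proof -
  define err where "err n = \<bar>wsum a (real n) - (LINT u:{0..real n}|lborel. deriv \<Psi> u)\<bar>" for n :: nat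
  define c1 where "c1 = \<bar>\<Psi> 1 - (LINT u:{0..1}|lborel. deriv \<Psi> u)\<bar>"
  have "(\<lambda>X. \<Psi> X - wsum a X) \<in> O(\<lambda>X. wsum a X / ln X ^ m)"
    using sa by (simp add: smooth_approximation_def)
  then obtain c where c: "c > 0" "eventually (\<lambda>X. \<bar>\<Psi> X - wsum a X\<bar> \<le> c * \<bar>wsum a X / ln X ^ m\<bar>) at_top"
    by (auto elim!: landau_o.bigE)
  then obtain x0 where x0: "\<And>X. X \<ge> x0 \<Longrightarrow> \<bar>\<Psi> X - wsum a X\<bar> \<le> c * \<bar>wsum a X / ln X ^ m\<bar>"
    by (auto simp: eventually_at_top_linorder)
  define n0 where "n0 = max 3 (nat \<lceil>x0\<rceil>)"
  define C where "C = c + c1 + (\<Sum>n\<le>n0. err n)"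
  have errnn: "(\<Sum>n\<le>n0. err n) \<ge> 0" by (intro sum_nonneg) (simp add: err_def)
  have C: "C \<ge> c" "C \<ge> c1" "C \<ge> 0" "\<And>n. n \<le> n0 \<Longrightarrow> err n \<le> C"
  proof -
    show "C \<ge> c" "C \<ge> c1" "C \<ge> 0" using errnn c(1) by (auto simp: C_def c1_def)
    fix n assume "n \<le> n0"
    then have "err n \<le> (\<Sum>n\<le>n0. err n)" by (intro member_le_sum) (auto simp: err_def)
    then show "err n \<le> C" using c(1) by (simp add: C_def c1_def)
  qed
  have A: "wsum a X \<ge> 0" for X using a_nonneg by (rule wsum_nonneg)
  have ln1: "ln (real n) \<ge> 1" if "n \<ge> 3" for n
  proof -
    have "exp 1 \<le> real n" using exp_le that by linarith
    then show ?thesis by (subst ln_ge_iff) (use that in auto)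
  qed
  have 2: "err n \<le> C * (1 + wsum a (real n) / ln (real n) ^ m)" if n: "n \<ge> 3" for n
  proof (cases "n \<le> n0")
    case True
    have "0 \<le> wsum a (real n) / ln (real n) ^ m" using A ln1[OF n] by simp
    then have "C * 1 \<le> C * (1 + wsum a (real n) / ln (real n) ^ m)" using C(3) by (intro mult_left_mono) auto
    then show ?thesis using C(4)[OF True] by simp
  next
    case False
    then have "real n \<ge> x0" unfolding n0_def by linarith
    from x0[OF this] have "\<bar>\<Psi> n - wsum a (real n)\<bar> \<le> c * (wsum a (real n) / ln (real n) ^ m)"
      using A ln1[OF n] by simp
    also have "\<dots> \<le> C * (wsum a (real n) / ln (real n) ^ m)"
      using C A[of "real n"] ln1[OF n] by (intro mult_right_mono) auto
    finally have "\<bar>\<Psi> n - wsum a (real n)\<bar> \<le> C * (wsum a (real n) / ln (real n) ^ m)" .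
    moreover have "err n \<le> \<bar>\<Psi> n - wsum a (real n)\<bar> + c1"
      unfolding err_def c1_def using smooth_approx_integral[OF sa, of n] n by simp
    ultimately show ?thesis using C(2) by (simp add: algebra_simps)
  qed
  have 1: "err n \<le> C * (1 + wsum a (real n))" for n
  proof (cases "n \<ge> 3")
    case True
    have "wsum a (real n) / ln (real n) ^ m \<le> wsum a (real n) / 1"
      using A[of "real n"] ln1[OF True] by (intro divide_left_mono) (auto simp: one_le_power)
    then have "C * (1 + wsum a (real n) / ln (real n) ^ m) \<le> C * (1 + wsum a (real n))"
      using C(3) by (intro mult_left_mono) auto
    with 2[OF True] show ?thesis by linarith
  next
    case False
    then have "err n \<le> C * 1" using C(4)[of n] by (simp add: n0_def)
    also have "\<dots> \<le> C * (1 + wsum a (real n))" using C(3) A by (intro mult_left_mono) auto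
    finally show ?thesis .
  qed
  show ?thesis using that[OF C(3)] 1 2 unfolding err_def by blast
qed

lemma smooth_approx_deriv_bound:
  assumes "smooth_approximation a m \<Psi>"
  obtains C x0 where "C > 0" "x0 \<ge> 2" "\<And>u. u \<ge> x0 \<Longrightarrow> \<bar>deriv \<Psi> u\<bar> \<le> C * (wsum a u / u)"
proof -
  have "deriv \<Psi> \<in> O(\<lambda>X. wsum a X / X)"
    using assms by (auto simp: smooth_approximation_def bigtheta_def)
  then obtain c where c: "c > 0" "eventually (\<lambda>X. \<bar>deriv \<Psi> X\<bar> \<le> c * \<bar>wsum a X / X\<bar>) at_top"
    by (auto elim!: landau_o.bigE)
  then obtain x0 where x0: "\<And>X. X \<ge> x0 \<Longrightarrow> \<bar>deriv \<Psi> X\<bar> \<le> c * \<bar>wsum a X / X\<bar>"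
    by (auto simp: eventually_at_top_linorder)
  show ?thesis
  proof (rule that[of c "max x0 2"])
    fix u assume "u \<ge> max x0 2"
    then show "\<bar>deriv \<Psi> u\<bar> \<le> c * (wsum a u / u)"
      using x0[of u] wsum_nonneg[of a u] a_nonneg by simp
  qed (use c in auto)
qed

text \<open>From \<bar>\<psi>(u)\<bar> \<le> C A(u)/u \<le> C A(X)/u one loses a logarithm; the
  second power of log X also swallows the constants. The loss is harmless because m is chosen
  afterwards.\<close>

lemma smooth_approx_abs_integral:
  assumes sa: "smooth_approximation a m \<Psi>"
  shows "eventually (\<lambda>X. (LINT u:{0..X}|lborel. \<bar>deriv \<Psi> u\<bar>) \<le> wsum a X * ln X powr 2) at_top"
proof -
  obtain C x0 where C: "C > 0" "x0 \<ge> 2" "\<And>u. u \<ge> x0 \<Longrightarrow> \<bar>deriv \<Psi> u\<bar> \<le> C * (wsum a u / u)"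
    using smooth_approx_deriv_bound[OF sa] by metis
  have eq: "(LINT u:{0..b}|lborel. \<bar>deriv \<Psi> u\<bar>) = integral {0..b} (\<lambda>u. \<bar>deriv \<Psi> u\<bar>)"
    "(\<lambda>u. \<bar>deriv \<Psi> u\<bar>) integrable_on {0..b}" for b
    using set_borel_integral_eq_integral[OF set_integrable_abs[OF smooth_approx_integrable[OF sa, of b]]] by auto
  define c0 where "c0 = integral {0..x0} (\<lambda>u. \<bar>deriv \<Psi> u\<bar>)"
  have "eventually (\<lambda>X::real. 1 + C * ln X \<le> ln X powr 2) at_top" by real_asymp
  then show ?thesis
    using eventually_wsum_ge[of c0] eventually_ge_at_top[of x0]
  proof eventually_elim
    case (elim X)
    have A: "wsum a X \<ge> 0" using a_nonneg by (rule wsum_nonneg)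
    have hi: "((\<lambda>u. C * (wsum a X / u)) has_integral (C * wsum a X * ln X - C * wsum a X * ln x0)) {x0..X}"
      using C(2) elim by (intro fundamental_theorem_of_calculus)
        (auto simp: has_real_derivative_iff_has_vector_derivative[symmetric] intro!: derivative_eq_intros)
    have "integral {x0..X} (\<lambda>u. \<bar>deriv \<Psi> u\<bar>) \<le> C * wsum a X * ln X - C * wsum a X * ln x0"
    proof (rule has_integral_le[OF integrable_integral hi])
      show "(\<lambda>u. \<bar>deriv \<Psi> u\<bar>) integrable_on {x0..X}"
        using eq(2)[of X] C(2) by (rule_tac integrable_on_subinterval) auto
      fix u assume u: "u \<in> {x0..X}"
      have "\<bar>deriv \<Psi> u\<bar> \<le> C * (wsum a u / u)" using u by (intro C) auto
      also have "\<dots> \<le> C * (wsum a X / u)"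
        using u C a_nonneg by (intro mult_left_mono divide_right_mono wsum_mono) auto
      finally show "\<bar>deriv \<Psi> u\<bar> \<le> C * (wsum a X / u)" .
    qed
    also have "\<dots> \<le> C * wsum a X * ln X" using C A by simp
    finally have "integral {x0..X} (\<lambda>u. \<bar>deriv \<Psi> u\<bar>) \<le> C * wsum a X * ln X" .
    moreover have "c0 + integral {x0..X} (\<lambda>u. \<bar>deriv \<Psi> u\<bar>) = integral {0..X} (\<lambda>u. \<bar>deriv \<Psi> u\<bar>)"
      unfolding c0_def using elim C(2) eq(2) by (intro Henstock_Kurzweil_Integration.integral_combine) auto
    ultimately have "integral {0..X} (\<lambda>u. \<bar>deriv \<Psi> u\<bar>) \<le> wsum a X * (1 + C * ln X)"
      using elim by (simp add: algebra_simps)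
    also have "\<dots> \<le> wsum a X * ln X powr 2" using elim A by (intro mult_left_mono) auto
    finally show ?case unfolding eq(1) .
  qed
qed

text \<open>The interval is shorter than 1 and on it A(u)/u is at most 2 A(X)/X.\<close>

lemma smooth_approx_tail_integral:
  assumes sa: "smooth_approximation a m \<Psi>"
  obtains C where "C > 0"
    "eventually (\<lambda>X. (LINT u:{real (nat \<lfloor>X\<rfloor>)..X}|lborel. \<bar>deriv \<Psi> u\<bar>) \<le> C * (wsum a X / X)) at_top"
proof -
  obtain C x0 where C: "C > 0" "x0 \<ge> 2" "\<And>u. u \<ge> x0 \<Longrightarrow> \<bar>deriv \<Psi> u\<bar> \<le> C * (wsum a u / u)"
    using smooth_approx_deriv_bound[OF sa] by metis
  have "eventually (\<lambda>X. (LINT u:{real (nat \<lfloor>X\<rfloor>)..X}|lborel. \<bar>deriv \<Psi> u\<bar>) \<le> 2 * C * (wsum a X / X)) at_top"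
    using eventually_ge_at_top[of "x0 + 1"]
  proof eventually_elim
    case (elim X)
    define N where "N = nat \<lfloor>X\<rfloor>"
    have N: "real N \<le> X" "X - 1 \<le> real N" "real N \<ge> x0" "X \<le> 2 * real N"
      using elim C(2) by (auto simp: N_def; linarith)+
    have i: "set_integrable lborel {real N..X} (\<lambda>u. \<bar>deriv \<Psi> u\<bar>)"
      by (rule set_integrable_subset[OF set_integrable_abs[OF smooth_approx_integrable[OF sa, of X]]]) auto
    have "(LINT u:{real N..X}|lborel. \<bar>deriv \<Psi> u\<bar>) = integral {real N..X} (\<lambda>u. \<bar>deriv \<Psi> u\<bar>)"
      using i by (rule set_borel_integral_eq_integral(2))
    also have "\<dots> \<le> integral {real N..X} (\<lambda>u. 2 * C * (wsum a X / X))"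
    proof (rule Henstock_Kurzweil_Integration.integral_le)
      show "(\<lambda>u. \<bar>deriv \<Psi> u\<bar>) integrable_on {real N..X}" using i by (rule set_borel_integral_eq_integral(1))
      fix u assume u: "u \<in> {real N..X}"
      have "\<bar>deriv \<Psi> u\<bar> \<le> C * (wsum a u / u)" using u N by (intro C) auto
      also have "wsum a u / u \<le> wsum a X / (X / 2)"
        using u N C(2) a_nonneg by (intro frac_le wsum_mono wsum_nonneg) auto
      finally show "\<bar>deriv \<Psi> u\<bar> \<le> 2 * C * (wsum a X / X)" using C(1) by (simp add: mult_ac mult_left_mono)
    qed auto
    also have "\<dots> = (X - real N) * (2 * C * (wsum a X / X))" using N by simp
    also have "\<dots> \<le> 1 * (2 * C * (wsum a X / X))"
      using N C elim wsum_nonneg[of a X] a_nonneg by (intro mult_right_mono) auto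
    finally show ?case by (simp add: N_def)
  qed
  then show ?thesis using C(1) by (intro that[of "2 * C"]) auto
qed

end

section \<open>Major arcs\<close>

lemma indicator_PiE:
  fixes u :: "nat \<Rightarrow> real"
  assumes "u \<in> extensional {..<s}"
  shows "indicator ({..<s} \<rightarrow>\<^sub>E {0..X}) u = (\<Prod>i<s. indicator {0..X} (u i) :: real)"
proof (cases "u \<in> {..<s} \<rightarrow>\<^sub>E {0..X}")
  case True
  then have "(\<Prod>i<s. indicator {0..X} (u i) :: real) = (\<Prod>i<s. 1)"
    by (intro prod.cong refl) (auto simp: PiE_iff)
  with True show ?thesis by simp
next
  case False
  then obtain i where i: "i < s" "u i \<notin> {0..X}" using assms by (auto simp: PiE_iff)
  then have "indicator {0..X} (u i) = (0 :: real)" by simp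
  with i(1) have "(\<Prod>i<s. indicator {0..X} (u i) :: real) = 0" by (intro prod_zero) auto
  with False show ?thesis by simp
qed

text \<open>Moves the indicator of the box into the one-dimensional factors, the shape in which
  coordinates can be exchanged.\<close>

lemma osc_integral_eq:
  "osc_integral s F \<psi> l X = (\<integral>u. of_real (\<Prod>i<s. indicator {0..X} (u i) * \<psi> (u i)) * e (l * qform s F u) \<partial>Pi\<^sub>M {..<s} (\<lambda>_. lborel))"
  unfolding osc_integral_def set_lebesgue_integral_def
proof (intro Bochner_Integration.integral_cong refl)
  fix u :: "nat \<Rightarrow> real" assume "u \<in> space (Pi\<^sub>M {..<s} (\<lambda>_. lborel))"
  then have "u \<in> extensional {..<s}" by (simp add: space_PiM PiE_def)
  from indicator_PiE[OF this, of X]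
  show "indicat_real ({..<s} \<rightarrow>\<^sub>E {0..X}) u *\<^sub>R (of_real (\<Prod>i<s. \<psi> (u i)) * e (l * qform s F u))
    = of_real (\<Prod>i<s. indicator {0..X} (u i) * \<psi> (u i)) * e (l * qform s F u)"
    by (simp add: prod.distrib scaleR_conv_of_real)
qed

context circle_problem
begin

definition expsum :: "real \<Rightarrow> real \<Rightarrow> complex" where
  "expsum X \<alpha> = (\<Sum>x\<in>{..<s} \<rightarrow>\<^sub>E {..nat \<lfloor>X\<rfloor>}. of_real (\<Prod>i<s. a (x i)) * e (\<alpha> * qform s F (\<lambda>i. real (x i))))"

definition ap_weight :: "nat \<Rightarrow> int \<Rightarrow> nat \<Rightarrow> real" where
  "ap_weight q h k = (if [int k = h] (mod int q) then a k else 0)"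

lemma ap_weight_nonneg: "ap_weight q h k \<ge> 0"
  by (simp add: ap_weight_def a_nonneg)

lemma ap_weight_le: "ap_weight q h k \<le> a k"
  by (simp add: ap_weight_def a_nonneg)

lemma sum_ap_weight: "(\<Sum>k\<le>n. ap_weight q h k) = ap_weight q h 0 + wsum_ap a q h (real n)"
proof -
  have "{..n} = insert 0 {1..n}" by auto
  then have "(\<Sum>k\<le>n. ap_weight q h k) = ap_weight q h 0 + (\<Sum>k\<in>{1..n}. ap_weight q h k)" by simp
  also have "(\<Sum>k\<in>{1..n}. ap_weight q h k) = wsum_ap a q h (real n)"
    unfolding ap_weight_def wsum_ap_def by (subst sum.inter_filter[symmetric]) auto
  finally show ?thesis .
qed

text \<open>The restricted weights vanish unless x is congruent to h, so exactly one h contributes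
  for each x, and there the rational part of the phase depends on h alone.\<close>

lemma expsum_split:
  assumes "q \<ge> 1"
  shows "expsum X (real b / real q + \<beta>) = (\<Sum>h\<in>residue_vectors s q. e (real b / real q * f h) *
    (\<Sum>x\<in>{..<s} \<rightarrow>\<^sub>E {..nat \<lfloor>X\<rfloor>}. of_real (\<Prod>i<s. ap_weight q (h i) (x i)) * e (\<beta> * qform s F (\<lambda>i. real (x i)))))"
proof -
  have inner: "(\<Sum>h\<in>residue_vectors s q. e (real b / real q * f h) * of_real (\<Prod>i<s. ap_weight q (h i) (x i)))
      = of_real (\<Prod>i<s. a (x i)) * e (real b / real q * qform s F (\<lambda>i. real (x i)))" for x :: "nat \<Rightarrow> nat"
  proof -
    define h0 where "h0 = (\<lambda>i\<in>{..<s}. int (x i) mod int q)"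
    have h0: "h0 \<in> residue_vectors s q" using assms by (simp add: h0_def residue_vectors_def PiE_iff)
    have "(\<Sum>h\<in>residue_vectors s q. e (real b / real q * f h) * of_real (\<Prod>i<s. ap_weight q (h i) (x i)))
       = (\<Sum>h\<in>{h0}. e (real b / real q * f h) * of_real (\<Prod>i<s. ap_weight q (h i) (x i)))"
    proof (rule sum.mono_neutral_right)
      show "\<forall>h\<in>residue_vectors s q - {h0}. e (real b / real q * f h) * of_real (\<Prod>i<s. ap_weight q (h i) (x i)) = 0"
      proof
        fix h assume h: "h \<in> residue_vectors s q - {h0}"
        have "\<exists>i<s. \<not> [int (x i) = h i] (mod int q)"
        proof (rule ccontr)
          assume "\<not> (\<exists>i<s. \<not> [int (x i) = h i] (mod int q))"
          then have c: "int (x i) mod int q = h i mod int q" if "i < s" for i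
            using that by (auto simp: cong_def)
          have "h i = h0 i" for i
          proof (cases "i < s")
            case True
            then have "h i \<in> {0..<int q}" using h by (auto simp: residue_vectors_def PiE_iff)
            then show ?thesis using c[OF True] True by (simp add: h0_def)
          next
            case False
            then show ?thesis using h by (simp add: h0_def residue_vectors_def PiE_iff extensional_def)
          qed
          with h show False by auto
        qed
        then obtain i where "i < s" "ap_weight q (h i) (x i) = 0" by (auto simp: ap_weight_def)
        then have "(\<Prod>i<s. ap_weight q (h i) (x i)) = 0" by (intro prod_zero) auto
        then show "e (real b / real q * f h) * of_real (\<Prod>i<s. ap_weight q (h i) (x i)) = 0" by simp
      qed
    qed (use h0 in auto)
    also have "(\<Prod>i<s. ap_weight q (h0 i) (x i)) = (\<Prod>i<s. a (x i))"
      by (intro prod.cong refl) (auto simp: ap_weight_def h0_def cong_def)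
    moreover have "e (real b / real q * f h0) = e (real b / real q * f (\<lambda>i. int (x i)))"
      using assms by (intro e_qform_cong) (auto simp: h0_def cong_def)
    ultimately show ?thesis by (simp add: mult.commute)
  qed
  have "(\<Sum>h\<in>residue_vectors s q. e (real b / real q * f h) *
    (\<Sum>x\<in>{..<s} \<rightarrow>\<^sub>E {..nat \<lfloor>X\<rfloor>}. of_real (\<Prod>i<s. ap_weight q (h i) (x i)) * e (\<beta> * qform s F (\<lambda>i. real (x i)))))
    = (\<Sum>h\<in>residue_vectors s q. \<Sum>x\<in>{..<s} \<rightarrow>\<^sub>E {..nat \<lfloor>X\<rfloor>}.
       (e (real b / real q * f h) * of_real (\<Prod>i<s. ap_weight q (h i) (x i))) * e (\<beta> * qform s F (\<lambda>i. real (x i))))"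
    by (simp add: sum_distrib_left mult.assoc)
  also have "\<dots> = (\<Sum>x\<in>{..<s} \<rightarrow>\<^sub>E {..nat \<lfloor>X\<rfloor>}. \<Sum>h\<in>residue_vectors s q.
       (e (real b / real q * f h) * of_real (\<Prod>i<s. ap_weight q (h i) (x i))) * e (\<beta> * qform s F (\<lambda>i. real (x i))))"
    by (rule sum.swap)
  also have "\<dots> = (\<Sum>x\<in>{..<s} \<rightarrow>\<^sub>E {..nat \<lfloor>X\<rfloor>}.
       (of_real (\<Prod>i<s. a (x i)) * e (real b / real q * qform s F (\<lambda>i. real (x i)))) * e (\<beta> * qform s F (\<lambda>i. real (x i))))"
    by (simp only: inner flip: sum_distrib_right)
  also have "\<dots> = expsum X (real b / real q + \<beta>)"
    unfolding expsum_def by (simp only: mult.assoc distrib_right flip: e_add)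
  finally show ?thesis by simp
qed

text \<open>Condition D will be applied at every n from sqrt X to X with moduli up to (log X)^B. The
  exponent B + 1 in the level compensates for log(sqrt X) being only half of log X.\<close>

lemma eventually_level:
  assumes "B > 0"
  shows "eventually (\<lambda>X. \<forall>Y\<ge>sqrt X. ln X powr B \<le> QD Y) at_top"
proof -
  have "eventually (\<lambda>X. ln X powr (B + 1) \<le> QD X) at_top"
    using level unfolding level_beyond_log_powers_def by blast
  then obtain x0 where x0: "\<And>Y. Y \<ge> x0 \<Longrightarrow> ln Y powr (B + 1) \<le> QD Y"
    by (auto simp: eventually_at_top_linorder)
  have "eventually (\<lambda>X. ln X powr B \<le> ln (sqrt X) powr (B + 1)) at_top" using assms by real_asymp
  moreover have "eventually (\<lambda>X. sqrt X \<ge> max x0 2) at_top" by real_asymp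
  ultimately show ?thesis
  proof eventually_elim
    case (elim X)
    show ?case
    proof (intro allI impI)
      fix Y assume Y: "sqrt X \<le> Y"
      have "ln (sqrt X) powr (B + 1) \<le> ln Y powr (B + 1)"
      proof (rule powr_mono2)
        have "2 \<le> sqrt X" using elim by simp
        with Y show "ln (sqrt X) \<le> ln Y" by (intro ln_mono) linarith+
        show "0 \<le> ln (sqrt X)" using \<open>2 \<le> sqrt X\<close> by (intro ln_ge_zero) linarith
      qed (use assms in simp)
      also have "\<dots> \<le> QD Y" using Y elim by (intro x0) auto
      finally show "ln X powr B \<le> QD Y" using elim by linarith
    qed
  qed
qed

text \<open>Partial summation needs the error for all initial segments n \<le> X at once. Above sqrt
  X, Condition D and the smooth approximation at n are sharp enough; below, every term is at most
  about A(sqrt X).\<close>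

lemma weights_error:
  assumes sa: "smooth_approximation a m \<Psi>" and B: "B > 0"
  obtains D where "D \<ge> 0"
    "eventually (\<lambda>X. \<forall>q\<ge>1. real q \<le> ln X powr B \<longrightarrow> (\<forall>h. \<forall>n\<le>nat \<lfloor>X\<rfloor>.
       \<bar>(\<Sum>k\<le>n. ap_weight q h k) - \<kappa> q h * (LINT u:{0..real n}|lborel. deriv \<Psi> u)\<bar>
         \<le> D * (wsum a X * ln X powr (- real m)))) at_top"
proof -
  obtain C where C: "C \<ge> 0"
    "\<And>n. \<bar>wsum a (real n) - (LINT u:{0..real n}|lborel. deriv \<Psi> u)\<bar> \<le> C * (1 + wsum a (real n))"
    "\<And>n. n \<ge> 3 \<Longrightarrow> \<bar>wsum a (real n) - (LINT u:{0..real n}|lborel. deriv \<Psi> u)\<bar> \<le> C * (1 + wsum a (real n) / ln (real n) ^ m)"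
    using smooth_approx_error[OF sa] by metis
  obtain C1 where C1: "\<And>X q h. X > 1 \<Longrightarrow> q \<ge> 1 \<Longrightarrow> real q \<le> QD X \<Longrightarrow>
     \<bar>wsum_ap a q h X - \<kappa> q h * wsum a X\<bar> \<le> C1 * (wsum a X / ln X ^ m)"
    using D_bound[of m] by blast
  define D where "D = a 0 + 2 * C + 2 + (\<bar>C1\<bar> + C) * 2 ^ m"
  have D: "D \<ge> 0" using C(1) a_nonneg[of 0] by (simp add: D_def)
  have A: "wsum a X \<ge> 0" for X using a_nonneg by (rule wsum_nonneg)
  have "eventually (\<lambda>X. ln X powr (real m + 1) \<le> wsum a X) at_top"
    by (rule wsum_growth)
  moreover have "eventually (\<lambda>X. wsum a (sqrt X) \<le> wsum a X * ln X powr (-(real m + 1))) at_top"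
    by (rule wsum_sqrt_le)
  moreover have "eventually (\<lambda>X::real. ln X \<ge> 1) at_top" "eventually (\<lambda>X::real. sqrt X \<ge> 3) at_top" by real_asymp+
  ultimately have "eventually (\<lambda>X. \<forall>q\<ge>1. real q \<le> ln X powr B \<longrightarrow> (\<forall>h. \<forall>n\<le>nat \<lfloor>X\<rfloor>.
       \<bar>(\<Sum>k\<le>n. ap_weight q h k) - \<kappa> q h * (LINT u:{0..real n}|lborel. deriv \<Psi> u)\<bar>
         \<le> D * (wsum a X * ln X powr (- real m)))) at_top"
    using eventually_level[OF B]
  proof eventually_elim
    case (elim X)
    define U where "U = wsum a X * ln X powr (- real m)"
    have L: "ln X > 0" using elim by linarith
    have X: "X > 1" using elim(4) by (smt (verit) real_sqrt_le_1_iff)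
    \<comment> \<open>The target error \<open>U\<close> is at least 1 by the growth of the weights,
      so it absorbs \<open>a 0\<close> and the additive constants.\<close>
    have U1: "1 \<le> U"
    proof -
      have "1 = ln X powr real m * ln X powr (- real m)" using L elim(3) by (auto simp flip: powr_add)
      also have "\<dots> \<le> ln X powr (real m + 1) * ln X powr (- real m)"
        using elim by (intro mult_right_mono powr_mono) auto
      also have "\<dots> \<le> U" unfolding U_def using elim by (intro mult_right_mono) auto
      finally show ?thesis .
    qed
    have sq: "wsum a (sqrt X) \<le> U"
    proof -
      have "ln X powr (-(real m + 1)) \<le> ln X powr (- real m)" using elim by (intro powr_mono) auto
      then have "wsum a X * ln X powr (-(real m + 1)) \<le> U" unfolding U_def using A by (rule mult_left_mono)
      then show ?thesis using elim by linarith
    qed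
    show ?case
    proof (intro allI impI)
      fix q h n assume q: "1 \<le> q" "real q \<le> ln X powr B" and n: "n \<le> nat \<lfloor>X\<rfloor>"
      define I where "I = (LINT u:{0..real n}|lborel. deriv \<Psi> u)"
      have nX: "real n \<le> X" using n X by linarith
      have k: "0 \<le> \<kappa> q h" "\<kappa> q h \<le> 1" using kappa_nonneg kappa_le_1 q by auto
      have w0: "0 \<le> ap_weight q h 0" "ap_weight q h 0 \<le> a 0" by (rule ap_weight_nonneg, rule ap_weight_le)
      have "\<bar>(\<Sum>k\<le>n. ap_weight q h k) - \<kappa> q h * I\<bar> \<le> D * U"
      proof (cases "sqrt X \<le> real n")
        case True
        \<comment> \<open>In this range ln n \<ge> ln X / 2, which costs the factor 2^m in
          \<open>D\<close>.\<close>
        have n3: "n \<ge> 3" using True elim(4) by linarith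
        have lnn: "ln X / 2 \<le> ln (real n)"
        proof -
          have "ln (sqrt X) \<le> ln (real n)" using True X n3 by simp
          then show ?thesis using X by (simp add: ln_sqrt)
        qed
        have V: "wsum a (real n) / ln (real n) ^ m \<le> 2 ^ m * U"
        proof -
          have "wsum a (real n) / ln (real n) ^ m \<le> wsum a X / (ln X / 2) ^ m"
            using A L lnn nX a_nonneg by (intro frac_le power_mono wsum_mono) auto
          also have "\<dots> = 2 ^ m * U" using L by (simp add: U_def powr_minus powr_realpow power_divide field_simps)
          finally show ?thesis .
        qed
        have "\<bar>wsum_ap a q h (real n) - \<kappa> q h * wsum a (real n)\<bar> \<le> C1 * (wsum a (real n) / ln (real n) ^ m)"
          using elim(5) True n3 q by (intro C1) (auto intro: order_trans)
        also have "\<dots> \<le> \<bar>C1\<bar> * (wsum a (real n) / ln (real n) ^ m)"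
          using A[of "real n"] n3 by (intro mult_right_mono divide_nonneg_nonneg) auto
        also have "\<dots> \<le> \<bar>C1\<bar> * (2 ^ m * U)" using V by (intro mult_left_mono) auto
        finally have 1: "\<bar>wsum_ap a q h (real n) - \<kappa> q h * wsum a (real n)\<bar> \<le> \<bar>C1\<bar> * (2 ^ m * U)" .
        have "\<bar>\<kappa> q h * wsum a (real n) - \<kappa> q h * I\<bar> = \<kappa> q h * \<bar>wsum a (real n) - I\<bar>"
          using k by (simp add: abs_mult flip: right_diff_distrib)
        also have "\<dots> \<le> 1 * (C * (1 + wsum a (real n) / ln (real n) ^ m))"
          using k C(3)[OF n3] unfolding I_def by (intro mult_mono) auto
        also have "\<dots> \<le> C * (U + 2 ^ m * U)" using V U1 C(1) by (simp add: mult_left_mono)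
        finally have 2: "\<bar>\<kappa> q h * wsum a (real n) - \<kappa> q h * I\<bar> \<le> C * (U + 2 ^ m * U)" .
        have 3: "a 0 \<le> a 0 * U" using U1 a_nonneg[of 0] by (simp add: mult_le_cancel_left1)
        have "\<bar>(\<Sum>k\<le>n. ap_weight q h k) - \<kappa> q h * I\<bar> \<le> a 0 * U + \<bar>C1\<bar> * (2 ^ m * U) + C * (U + 2 ^ m * U)"
          unfolding sum_ap_weight using 1 2 3 w0 by linarith
        also have "\<dots> = (a 0 + C + (\<bar>C1\<bar> + C) * 2 ^ m) * U" by (simp add: algebra_simps)
        also have "\<dots> \<le> D * U" using U1 C(1) by (intro mult_right_mono) (auto simp: D_def)
        finally show ?thesis .
      next
        case False
        have An: "wsum a (real n) \<le> U"
          using False a_nonneg sq by (intro order_trans[OF wsum_mono[of a "real n" "sqrt X"]]) auto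
        have "wsum_ap a q h (real n) \<le> wsum a (real n)"
          unfolding wsum_ap_def wsum_def using a_nonneg by (intro sum_mono2) auto
        moreover have "wsum_ap a q h (real n) \<ge> 0"
          unfolding wsum_ap_def using a_nonneg by (intro sum_nonneg)
        moreover have "\<bar>I\<bar> \<le> U + C * (U + U)"
        proof -
          have "\<bar>I\<bar> \<le> wsum a (real n) + C * (1 + wsum a (real n))" using C(2)[of n] A[of "real n"] unfolding I_def by linarith
          also have "\<dots> \<le> U + C * (U + U)" using An U1 C(1) by (intro add_mono mult_left_mono) auto
          finally show ?thesis .
        qed
        then have "\<bar>\<kappa> q h * I\<bar> \<le> 1 * (U + C * (U + U))"
          unfolding abs_mult using k by (intro mult_mono) auto
        moreover have "a 0 \<le> a 0 * U" using U1 a_nonneg[of 0] by (simp add: mult_le_cancel_left1)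
        moreover have "\<bar>w + W - J\<bar> \<le> p + U + Z"
          if "W \<le> v" "0 \<le> W" "\<bar>J\<bar> \<le> 1 * Z" "a 0 \<le> p" "v \<le> U" "0 \<le> w" "w \<le> a 0" for w W J p Z v :: real
          using that by linarith
        ultimately have "\<bar>(\<Sum>k\<le>n. ap_weight q h k) - \<kappa> q h * I\<bar> \<le> a 0 * U + U + (U + C * (U + U))"
          unfolding sum_ap_weight using An w0 by blast
        also have "\<dots> = (a 0 + 2 * C + 2) * U" by (simp add: algebra_simps)
        also have "\<dots> \<le> D * U" using U1 C(1) by (intro mult_right_mono) (auto simp: D_def)
        finally show ?thesis .
      qed
      then show "\<bar>(\<Sum>k\<le>n. ap_weight q h k) - \<kappa> q h * (LINT u:{0..real n}|lborel. deriv \<Psi> u)\<bar>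
         \<le> D * (wsum a X * ln X powr (- real m))" by (simp add: I_def U_def)
    qed
  qed
  with D show ?thesis by (rule that)
qed

text \<open>Applies the exchange of coordinates to the weights restricted to one residue vector
  against \<kappa> times \<psi>. Since 0 \<le> \<kappa> \<le> 1, the constants \<open>M\<close> and
  \<open>E2\<close> serve all residue classes; \<open>V\<close> bounds the oscillation of the phase
  in one coordinate.\<close>

lemma residue_box_approx:
  assumes sa: "smooth_approximation a m \<Psi>" and q: "q \<ge> 1" and X: "X \<ge> 0" and M: "M \<ge> 1"
    and wM: "a 0 + wsum a X \<le> M" and \<psi>M: "(LINT u:{0..X}|lborel. \<bar>deriv \<Psi> u\<bar>) \<le> M"
    and \<psi>E2: "(LINT u:{real (nat \<lfloor>X\<rfloor>)..X}|lborel. \<bar>deriv \<Psi> u\<bar>) \<le> E2"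
    and E1: "\<And>h n. n \<le> nat \<lfloor>X\<rfloor> \<Longrightarrow> \<bar>(\<Sum>k\<le>n. ap_weight q h k) - \<kappa> q h * (LINT u:{0..real n}|lborel. deriv \<Psi> u)\<bar> \<le> E1"
    and V: "2 * pi * \<bar>\<beta>\<bar> * coeff_norm s F * X \<le> V"
  shows "cmod ((\<Sum>x\<in>{..<s} \<rightarrow>\<^sub>E {..nat \<lfloor>X\<rfloor>}. of_real (\<Prod>i<s. ap_weight q (h i) (x i)) * e (\<beta> * qform s F (\<lambda>i. real (x i))))
    - of_real (\<Prod>i<s. \<kappa> q (h i)) * osc_integral s F (deriv \<Psi>) \<beta> X) \<le> real s * M ^ (s - 1) * (E1 * (1 + X * V) + V * M + E2)"
proof -
  define N where "N = nat \<lfloor>X\<rfloor>"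
  define w where "w i = ap_weight q (h i)" for i
  define \<phi> where "\<phi> i u = \<kappa> q (h i) * (indicator {0..X} u * deriv \<Psi> u)" for i u
  have k: "0 \<le> \<kappa> q j" "\<kappa> q j \<le> 1" for j using kappa_nonneg kappa_le_1 q by auto
  have V0: "V \<ge> 0" using X coeff_norm_nonneg[of s F] by (intro order_trans[OF _ V] mult_nonneg_nonneg) auto
  have E10: "E1 \<ge> 0" using E1[of 0] by (meson abs_ge_zero le0 order_trans)
  have int: "set_integrable lborel {c..d} (deriv \<Psi>)" if "0 \<le> c" for c d
    by (rule set_integrable_subset[OF smooth_approx_integrable[OF sa, of d]]) (use that in auto)
  have E20: "E2 \<ge> 0"
    by (rule order_trans[OF _ \<psi>E2]) (auto simp: set_lebesgue_integral_def intro!: integral_nonneg_AE)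
  have inner: "cmod ((\<Sum>k\<le>N. of_real (w i k) * g (real k)) - (\<integral>u. of_real (\<phi> i u) * g u \<partial>lborel)) \<le> E1 * (1 + X * V) + V * M + E2"
    if g: "\<And>u. cmod (g u) \<le> 1" "\<And>u v. u \<in> {0..X} \<Longrightarrow> v \<in> {0..X} \<Longrightarrow> cmod (g u - g v) \<le> V * \<bar>u - v\<bar>" for i g
  proof -
    have abs_eq: "(LINT u:S|lborel. \<bar>\<kappa> q (h i) * deriv \<Psi> u\<bar>) = \<kappa> q (h i) * (LINT u:S|lborel. \<bar>deriv \<Psi> u\<bar>)" for S
      using k by (simp add: abs_mult)
    have abs_le: "(LINT u:S|lborel. \<bar>\<kappa> q (h i) * deriv \<Psi> u\<bar>) \<le> (LINT u:S|lborel. \<bar>deriv \<Psi> u\<bar>)" for S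
      unfolding abs_eq using k
      by (intro mult_left_le_one_le) (auto simp: set_lebesgue_integral_def intro!: integral_nonneg_AE)
    have "cmod ((\<Sum>k\<le>N. of_real (w i k) * g (real k)) - (LINT u:{0..X}|lborel. of_real (\<kappa> q (h i) * deriv \<Psi> u) * g u)) \<le> E1 * (1 + X * V) + V * M + E2"
      unfolding N_def
    proof (rule sum_integral_comparison[OF X])
      show "set_integrable lborel {0..X} (\<lambda>u. \<kappa> q (h i) * deriv \<Psi> u)" using int[of 0 X] by simp
      show "\<bar>(\<Sum>k\<le>n. w i k) - (LINT u:{0..real n}|lborel. \<kappa> q (h i) * deriv \<Psi> u)\<bar> \<le> E1" if "n \<le> nat \<lfloor>X\<rfloor>" for n
        using E1[OF that, of "h i"] by (simp add: w_def)
      show "(LINT u:{0..X}|lborel. \<bar>\<kappa> q (h i) * deriv \<Psi> u\<bar>) \<le> M" using abs_le \<psi>M by (rule order_trans)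
      show "(LINT u:{real (nat \<lfloor>X\<rfloor>)..X}|lborel. \<bar>\<kappa> q (h i) * deriv \<Psi> u\<bar>) \<le> E2" using abs_le \<psi>E2 by (rule order_trans)
    qed (use g V0 in auto)
    also have "(LINT u:{0..X}|lborel. of_real (\<kappa> q (h i) * deriv \<Psi> u) * g u) = (\<integral>u. of_real (\<phi> i u) * g u \<partial>lborel)"
      unfolding set_lebesgue_integral_def \<phi>_def
      by (intro Bochner_Integration.integral_cong refl) (auto simp: indicator_def)
    finally show ?thesis .
  qed
  have \<phi>int: "integrable lborel (\<phi> i)" for i
    using int[of 0 X] unfolding \<phi>_def set_integrable_def by simp
  have "cmod ((\<Sum>x\<in>{..<s} \<rightarrow>\<^sub>E {..N}. of_real (\<Prod>i<s. w i (x i)) * e (\<beta> * qform s F (\<lambda>i. real (x i))))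
      - (\<integral>u. of_real (\<Prod>i<s. \<phi> i (u i)) * e (\<beta> * qform s F u) \<partial>Pi\<^sub>M {..<s} (\<lambda>_. lborel)))
      \<le> real (card {..<s}) * M ^ (card {..<s} - 1) * (E1 * (1 + X * V) + V * M + E2)"
  proof (rule box_sum_integral_comparison[where V = V and X = X])
    show "finite {..<s}" by simp
    show "real N \<le> X" using X by (simp add: N_def)
    show "0 \<le> w i k" for i k by (simp add: w_def ap_weight_nonneg)
    show "(\<Sum>k\<le>N. w i k) \<le> M" for i
    proof -
      have "(\<Sum>k\<le>N. w i k) \<le> (\<Sum>k\<le>N. a k)" unfolding w_def by (intro sum_mono ap_weight_le)
      then show ?thesis using wM sum_atMost_eq_wsum[of a X] by (simp add: N_def)
    qed
    show "integrable lborel (\<phi> i)" for i by (rule \<phi>int)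
    show "\<phi> i u = 0" if "u \<notin> {0..X}" for i u using that by (simp add: \<phi>_def)
    show "(\<integral>u. \<bar>\<phi> i u\<bar> \<partial>lborel) \<le> M" for i
    proof -
      have "(\<integral>u. \<bar>\<phi> i u\<bar> \<partial>lborel) = \<kappa> q (h i) * (LINT u:{0..X}|lborel. \<bar>deriv \<Psi> u\<bar>)"
        unfolding \<phi>_def set_lebesgue_integral_def using k[of "h i"] by (simp add: abs_mult)
      also have "\<dots> \<le> 1 * (LINT u:{0..X}|lborel. \<bar>deriv \<Psi> u\<bar>)"
        using k by (intro mult_right_mono) (auto simp: set_lebesgue_integral_def intro!: integral_nonneg_AE)
      finally show ?thesis using \<psi>M by simp
    qed
    show "0 \<le> E1 * (1 + X * V) + V * M + E2" using E10 V0 X M E20 by (intro add_nonneg_nonneg mult_nonneg_nonneg) auto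
    show "(\<lambda>u. e (\<beta> * qform s F u)) \<in> borel_measurable (Pi\<^sub>M {..<s} (\<lambda>_. lborel))"
      using measurable_qform[of s F] by measurable
    fix i u y y' assume iu: "i \<in> {..<s}" "u \<in> {..<s} \<rightarrow> {0..X}" "y \<in> {0..X}" "y' \<in> {0..X}"
    have "cmod (e (\<beta> * qform s F (u(i := y))) - e (\<beta> * qform s F (u(i := y')))) \<le> 2 * pi * \<bar>\<beta> * qform s F (u(i := y)) - \<beta> * qform s F (u(i := y'))\<bar>"
      by (rule norm_e_diff_le)
    also have "\<dots> = 2 * pi * \<bar>\<beta>\<bar> * \<bar>qform s F (u(i := y)) - qform s F (u(i := y'))\<bar>"
      by (simp add: abs_mult flip: right_diff_distrib)
    also have "\<dots> \<le> 2 * pi * \<bar>\<beta>\<bar> * (coeff_norm s F * X * \<bar>y - y'\<bar>)"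
      using iu by (intro mult_left_mono qform_lipschitz) auto
    also have "\<dots> = (2 * pi * \<bar>\<beta>\<bar> * coeff_norm s F * X) * \<bar>y - y'\<bar>" by simp
    also have "\<dots> \<le> V * \<bar>y - y'\<bar>" using V by (intro mult_right_mono) auto
    finally show "cmod (e (\<beta> * qform s F (u(i := y))) - e (\<beta> * qform s F (u(i := y')))) \<le> V * \<bar>y - y'\<bar>" .
  next
    fix u u' :: "nat \<Rightarrow> real" assume "\<And>i. i \<in> {..<s} \<Longrightarrow> u i = u' i"
    then have "qform s F u = qform s F u'" by (intro qform_cong) auto
    then show "e (\<beta> * qform s F u) = e (\<beta> * qform s F u')" by simp
  qed (use M inner in auto)
  moreover have "(\<integral>u. of_real (\<Prod>i<s. \<phi> i (u i)) * e (\<beta> * qform s F u) \<partial>Pi\<^sub>M {..<s} (\<lambda>_. lborel))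
      = of_real (\<Prod>i<s. \<kappa> q (h i)) * osc_integral s F (deriv \<Psi>) \<beta> X"
    unfolding osc_integral_eq \<phi>_def by (simp add: prod.distrib mult.assoc del: of_real_prod)
  ultimately show ?thesis by (simp add: N_def w_def)
qed

text \<open>Bookkeeping of the exponent: B s from the number of residue vectors, 2 s from the masses
  of the other coordinates, B from the oscillation X V of the phase, and -m from the quality of the
  approximation.\<close>

lemma major_arc_approx:
  assumes sa: "smooth_approximation a m \<Psi>" and B: "B > 0" and s: "s \<ge> 1"
  obtains D where "D \<ge> 0"
    "eventually (\<lambda>X. \<forall>q\<ge>1. real q \<le> ln X powr B \<longrightarrow> (\<forall>b \<beta>. \<bar>\<beta>\<bar> \<le> ln X powr B / X\<^sup>2 \<longrightarrow>
       cmod (expsum X (real b / real q + \<beta>) - local_sum s F \<kappa> q b * osc_integral s F (deriv \<Psi>) \<beta> X)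
         \<le> D * (wsum a X ^ s * ln X powr (B * s + 2 * s + B - m)))) at_top"
proof -
  obtain D1 where D1: "D1 \<ge> 0"
    "eventually (\<lambda>X. \<forall>q\<ge>1. real q \<le> ln X powr B \<longrightarrow> (\<forall>h. \<forall>n\<le>nat \<lfloor>X\<rfloor>.
       \<bar>(\<Sum>k\<le>n. ap_weight q h k) - \<kappa> q h * (LINT u:{0..real n}|lborel. deriv \<Psi> u)\<bar>
         \<le> D1 * (wsum a X * ln X powr (- real m)))) at_top"
    by (rule weights_error[OF sa B])
  obtain C2 where C2: "C2 > 0"
    "eventually (\<lambda>X. (LINT u:{real (nat \<lfloor>X\<rfloor>)..X}|lborel. \<bar>deriv \<Psi> u\<bar>) \<le> C2 * (wsum a X / X)) at_top"
    by (rule smooth_approx_tail_integral[OF sa])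
  define c1 where "c1 = 2 * pi * coeff_norm s F"
  have c1: "c1 \<ge> 0" using coeff_norm_nonneg[of s F] by (simp add: c1_def)
  define D where "D = D1 * (1 + c1) + 2"
  have D: "D \<ge> 0" using D1(1) c1 by (simp add: D_def)
  \<comment> \<open>The terms \<open>V * M\<close> and \<open>E2\<close> carry a factor 1/X, which
    beats every power of log X.\<close>
  have "eventually (\<lambda>X. (c1 + 1) * (ln X powr B / X * ln X powr 2) \<le> ln X powr (B - real m)) at_top"
    using c1 by real_asymp
  moreover have "eventually (\<lambda>X. C2 / X \<le> ln X powr (B - real m)) at_top"
    using C2(1) by real_asymp
  moreover have "eventually (\<lambda>X::real. ln X \<ge> 2) at_top" by real_asymp
  ultimately have "eventually (\<lambda>X. \<forall>q\<ge>1. real q \<le> ln X powr B \<longrightarrow> (\<forall>b \<beta>. \<bar>\<beta>\<bar> \<le> ln X powr B / X\<^sup>2 \<longrightarrow>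
       cmod (expsum X (real b / real q + \<beta>) - local_sum s F \<kappa> q b * osc_integral s F (deriv \<Psi>) \<beta> X)
         \<le> (real s * D) * (wsum a X ^ s * ln X powr (B * s + 2 * s + B - m)))) at_top"
    using D1(2) C2(2) smooth_approx_abs_integral[OF sa] eventually_wsum_ge[of "max 1 (a 0)"] eventually_gt_at_top[of 1]
  proof eventually_elim
    case (elim X)
    define A where "A = wsum a X"
    define L where "L = ln X"
    have A1: "A \<ge> 1" "A \<ge> a 0" and X: "X > 1" and L2: "L \<ge> 2" using elim by (auto simp: A_def L_def)
    define M where "M = A * L powr 2"
    define E1 where "E1 = D1 * (A * L powr (- real m))"
    define V where "V = c1 * (L powr B / X)"
    define E2 where "E2 = C2 * (A / X)"
    have L4: "L powr 2 \<ge> 4" using L2 power_mono[of 2 L 2] by simp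
    have "1 * 1 \<le> A * L powr 2" using A1 L4 by (intro mult_mono) auto
    then have M1: "M \<ge> 1" by (simp add: M_def)
    have "A * 2 \<le> A * L powr 2" using A1 L4 by (intro mult_left_mono) auto
    then have M2: "a 0 + A \<le> M" using A1(2) unfolding M_def by linarith
    have LB: "L powr B \<ge> 1" using L2 B by (simp add: ge_one_powr_ge_zero)
    have Etot: "E1 * (1 + X * V) + V * M + E2 \<le> D * (A * L powr (B - real m))"
    proof -
      have "E1 * (1 + X * V) = D1 * (A * L powr (- real m)) * (1 + c1 * L powr B)" using X by (simp add: E1_def V_def)
      also have "\<dots> \<le> D1 * (A * L powr (- real m)) * ((1 + c1) * L powr B)"
        using LB D1(1) A1 by (intro mult_left_mono) (auto simp: algebra_simps)
      also have "\<dots> = D1 * (1 + c1) * (A * (L powr (- real m) * L powr B))" by simp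
      also have "L powr (- real m) * L powr B = L powr (B - real m)" by (simp flip: powr_add)
      finally have 1: "E1 * (1 + X * V) \<le> D1 * (1 + c1) * (A * L powr (B - real m))" .
      have "V * M = A * (c1 * (L powr B / X * L powr 2))" by (simp add: V_def M_def)
      also have "\<dots> \<le> A * ((c1 + 1) * (L powr B / X * L powr 2))"
        using A1 X by (intro mult_left_mono mult_right_mono) auto
      also have "\<dots> \<le> A * L powr (B - real m)" using elim(1) A1 by (intro mult_left_mono) (auto simp: L_def)
      finally have 2: "V * M \<le> A * L powr (B - real m)" .
      have "E2 = A * (C2 / X)" by (simp add: E2_def)
      also have "\<dots> \<le> A * L powr (B - real m)" using elim(2) A1 by (intro mult_left_mono) (auto simp: L_def)
      finally show ?thesis using 1 2 by (simp add: D_def algebra_simps)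
    qed
    show ?case
    proof (intro allI impI)
      fix q :: nat and b :: nat and \<beta> :: real
      assume q: "1 \<le> q" "real q \<le> ln X powr B" and \<beta>: "\<bar>\<beta>\<bar> \<le> ln X powr B / X\<^sup>2"
      define T where "T h = (\<Sum>x\<in>{..<s} \<rightarrow>\<^sub>E {..nat \<lfloor>X\<rfloor>}. of_real (\<Prod>i<s. ap_weight q (h i) (x i)) * e (\<beta> * qform s F (\<lambda>i. real (x i))))" for h
      have T: "cmod (T h - of_real (\<Prod>i<s. \<kappa> q (h i)) * osc_integral s F (deriv \<Psi>) \<beta> X)
          \<le> real s * D * (A ^ s * L powr (2 * s + B - m))" for h
      proof -
        have "cmod (T h - of_real (\<Prod>i<s. \<kappa> q (h i)) * osc_integral s F (deriv \<Psi>) \<beta> X)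
          \<le> real s * M ^ (s - 1) * (E1 * (1 + X * V) + V * M + E2)"
          unfolding T_def
        proof (rule residue_box_approx[OF sa q(1) _ M1])
          show "2 * pi * \<bar>\<beta>\<bar> * coeff_norm s F * X \<le> V"
          proof -
            have "2 * pi * \<bar>\<beta>\<bar> * coeff_norm s F * X = c1 * (\<bar>\<beta>\<bar> * X)" by (simp add: c1_def)
            also have "\<dots> \<le> c1 * (L powr B / X\<^sup>2 * X)"
              using c1 \<beta> X by (intro mult_left_mono mult_right_mono) (auto simp: L_def)
            also have "\<dots> = V" using X by (simp add: V_def power2_eq_square)
            finally show ?thesis .
          qed
        qed (use X M2 elim q in \<open>auto simp: A_def L_def M_def E1_def E2_def\<close>)
        also have "\<dots> \<le> real s * M ^ (s - 1) * (D * (A * L powr (B - real m)))"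
          using Etot M1 by (intro mult_left_mono) auto
        also have "\<dots> = real s * D * ((A ^ (s - 1) * A) * ((L powr 2) ^ (s - 1) * L powr (B - real m)))"
          by (simp add: M_def power_mult_distrib)
        also have "A ^ (s - 1) * A = A ^ s" using s by (metis One_nat_def Suc_pred less_eq_Suc_le power_Suc2)
        also have "(L powr 2) ^ (s - 1) = L powr (2 * (real s - 1))"
        proof -
          have "(L powr 2) ^ (s - 1) = (L powr 2) powr real (s - 1)"
            using L2 by (intro powr_realpow[symmetric]) simp
          also have "\<dots> = L powr (2 * (real s - 1))" using s by (simp add: powr_powr of_nat_diff)
          finally show ?thesis .
        qed
        also have "L powr (2 * (real s - 1)) * L powr (B - real m) = L powr (2 * (real s - 1) + B - m)"
          by (simp add: algebra_simps flip: powr_add)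
        also have "real s * D * (A ^ s * L powr (2 * (real s - 1) + B - m)) \<le> real s * D * (A ^ s * L powr (2 * s + B - m))"
          using A1 L2 D by (intro mult_left_mono powr_mono) auto
        finally show ?thesis .
      qed
      have "expsum X (real b / real q + \<beta>) - local_sum s F \<kappa> q b * osc_integral s F (deriv \<Psi>) \<beta> X
        = (\<Sum>h\<in>residue_vectors s q. e (real b / real q * f h) * (T h - of_real (\<Prod>i<s. \<kappa> q (h i)) * osc_integral s F (deriv \<Psi>) \<beta> X))"
        unfolding expsum_split[OF q(1)] T_def local_sum_def sum_distrib_right right_diff_distrib sum_subtractf
        by (simp add: mult_ac)
      also have "cmod \<dots> \<le> (\<Sum>h\<in>residue_vectors s q. real s * D * (A ^ s * L powr (2 * s + B - m)))"
        using T by (intro sum_norm_le) (simp add: norm_mult)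
      also have "\<dots> = real q ^ s * (real s * D * (A ^ s * L powr (2 * s + B - m)))"
        by (simp add: residue_vectors_def card_PiE)
      also have "\<dots> \<le> (L powr B) ^ s * (real s * D * (A ^ s * L powr (2 * s + B - m)))"
        using q D A1 by (intro mult_right_mono power_mono) (auto simp: L_def)
      also have "(L powr B) ^ s = L powr (B * s)"
        using L2 by (simp add: powr_realpow[symmetric] powr_powr)
      also have "L powr (B * s) * (real s * D * (A ^ s * L powr (2 * s + B - m)))
          = real s * D * (A ^ s * (L powr (B * s) * L powr (2 * s + B - m)))" by (simp add: mult_ac)
      also have "L powr (B * s) * L powr (2 * s + B - m) = L powr (B * s + 2 * s + B - m)"
        by (simp add: algebra_simps flip: powr_add)
      finally show "cmod (expsum X (real b / real q + \<beta>) - local_sum s F \<kappa> q b * osc_integral s F (deriv \<Psi>) \<beta> X)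
         \<le> (real s * D) * (wsum a X ^ s * ln X powr (B * s + 2 * s + B - m))"
        by (simp add: A_def L_def)
    qed
  qed
  then show ?thesis using D by (intro that[of "real s * D"]) auto
qed

end

section \<open>Minor arcs\<close>

text \<open>Uniqueness of lowest terms; it guarantees that two different reduced fractions have a
  nonzero integer determinant.\<close>

lemma coprime_fractions_eq:
  fixes a q a' q' :: int
  assumes "coprime a q" "coprime a' q'" "q > 0" "q' > 0" "a' * q = a * q'"
  shows "q = q'" "a = a'"
proof -
  have "q dvd a * q'" using assms(5) by (metis dvd_triv_right)
  moreover have "coprime q a" using assms(1) by (simp add: coprime_commute)
  ultimately have 1: "q dvd q'" by (simp only: coprime_dvd_mult_right_iff)
  have "q' dvd a' * q" using assms(5) by (metis dvd_triv_right)
  moreover have "coprime q' a'" using assms(2) by (simp add: coprime_commute)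
  ultimately have "q' dvd q" by (simp only: coprime_dvd_mult_right_iff)
  with 1 show "q = q'" using assms(3,4) by (intro zdvd_antisym_nonneg) auto
  with assms(3,5) show "a = a'" by simp
qed

text \<open>A continuous majorant, up to a factor 2, of 1 / max(1, z)^2 with z = X^2 \<bar>\<alpha>
  - c\<bar>. It is the derivative of an arctangent divided by X^2, so its integral is at most pi /
  X^2.\<close>

definition bump :: "real \<Rightarrow> real \<Rightarrow> real \<Rightarrow> real" where
  "bump X c \<alpha> = 1 / (1 + (X\<^sup>2 * (\<alpha> - c))\<^sup>2)"

text \<open>Summing over all fractions replaces a bound that depends on the Dirichlet approximation
  of \<alpha> by one fixed continuous function, so the minor arcs need no dissection. The numerators
  reach beyond q because \<alpha> may exceed 1 slightly.\<close>

definition bump_sum :: "real \<Rightarrow> real \<Rightarrow> real" where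
  "bump_sum X \<alpha> = (\<Sum>q\<in>{1..nat \<lfloor>X\<rfloor>}. \<Sum>b\<in>{0..q + 2}. 1 / (real q)\<^sup>2 * bump X (real b / real q) \<alpha>)"

lemma bump_nonneg: "bump X c \<alpha> \<ge> 0"
  by (simp add: bump_def add_nonneg_nonneg)

lemma bump_sum_nonneg: "bump_sum X \<alpha> \<ge> 0"
  by (simp add: bump_sum_def sum_nonneg bump_nonneg)

lemma continuous_bump: "continuous_on S (bump X c)"
proof -
  have "1 + (X\<^sup>2 * (\<alpha> - c))\<^sup>2 \<noteq> 0" for \<alpha> using zero_le_power2[of "X\<^sup>2 * (\<alpha> - c)"] by linarith
  then show ?thesis unfolding bump_def[abs_def] by (intro continuous_intros) auto
qed

lemma integral_bump_le:
  assumes "X > 0" "d \<le> d'"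
  shows "integral {d..d'} (bump X c) \<le> pi / X\<^sup>2"
proof -
  have X2: "X\<^sup>2 > 0" using assms by simp
  have "(bump X c has_integral (arctan (X\<^sup>2 * (d' - c)) / X\<^sup>2 - arctan (X\<^sup>2 * (d - c)) / X\<^sup>2)) {d..d'}"
  proof (rule fundamental_theorem_of_calculus[OF assms(2)])
    fix \<alpha> assume "\<alpha> \<in> {d..d'}"
    have "((\<lambda>\<alpha>. arctan (X\<^sup>2 * (\<alpha> - c)) / X\<^sup>2) has_real_derivative
        (inverse (1 + (X\<^sup>2 * (\<alpha> - c))\<^sup>2) * (X\<^sup>2 * 1)) / X\<^sup>2) (at \<alpha> within {d..d'})"
      by (rule DERIV_cdivide) (auto intro!: derivative_eq_intros)
    also have "(inverse (1 + (X\<^sup>2 * (\<alpha> - c))\<^sup>2) * (X\<^sup>2 * 1)) / X\<^sup>2 = bump X c \<alpha>"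
      unfolding bump_def inverse_eq_divide mult_1_right
      by (rule nonzero_mult_div_cancel_right) (use assms(1) in simp)
    finally have "((\<lambda>\<alpha>. arctan (X\<^sup>2 * (\<alpha> - c)) / X\<^sup>2) has_real_derivative bump X c \<alpha>) (at \<alpha> within {d..d'})" .
    then show "((\<lambda>\<alpha>. arctan (X\<^sup>2 * (\<alpha> - c)) / X\<^sup>2) has_vector_derivative bump X c \<alpha>) (at \<alpha> within {d..d'})"
      by (simp add: has_real_derivative_iff_has_vector_derivative)
  qed
  then have "integral {d..d'} (bump X c) = (arctan (X\<^sup>2 * (d' - c)) - arctan (X\<^sup>2 * (d - c))) / X\<^sup>2"
    by (simp add: integral_unique diff_divide_distrib)
  also have "\<dots> \<le> pi / X\<^sup>2"
  proof (rule divide_right_mono)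
    show "arctan (X\<^sup>2 * (d' - c)) - arctan (X\<^sup>2 * (d - c)) \<le> pi"
      using arctan_ubound[of "X\<^sup>2 * (d' - c)"] arctan_lbound[of "X\<^sup>2 * (d - c)"] by linarith
  qed simp
  finally show ?thesis .
qed

lemma continuous_bump_sum: "continuous_on S (bump_sum X)"
  unfolding bump_sum_def[abs_def] by (intro continuous_intros continuous_bump)

text \<open>There are q + 3 numerators with weight 1/q^2 each, hence a harmonic sum: one logarithm
  above X^-2.\<close>

lemma integral_bump_sum_le:
  assumes "X \<ge> 1" "d \<le> d'"
  shows "integral {d..d'} (bump_sum X) \<le> 4 * pi * (1 + ln X) / X\<^sup>2"
proof -
  define N where "N = nat \<lfloor>X\<rfloor>"
  have int: "bump X c integrable_on {d..d'}" for c
    by (rule integrable_continuous_interval[OF continuous_bump])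
  have "integral {d..d'} (bump_sum X) = (\<Sum>q\<in>{1..N}. \<Sum>b\<in>{0..q + 2}. 1 / (real q)\<^sup>2 * integral {d..d'} (bump X (real b / real q)))"
    unfolding bump_sum_def[abs_def] N_def[symmetric]
    by (subst integral_sum, simp, intro integrable_sum integrable_on_mult_right int, simp,
        intro sum.cong refl, subst integral_sum, simp, intro integrable_on_mult_right int, simp)
  also have "\<dots> \<le> (\<Sum>q\<in>{1..N}. \<Sum>b\<in>{0..q + 2}. 1 / (real q)\<^sup>2 * (pi / X\<^sup>2))"
    using assms by (intro sum_mono mult_left_mono integral_bump_le) auto
  also have "\<dots> = (\<Sum>q\<in>{1..N}. (real q + 3) / (real q)\<^sup>2) * (pi / X\<^sup>2)"
    unfolding sum_distrib_right by (intro sum.cong refl) (simp add: add_ac)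
  also have "(\<Sum>q\<in>{1..N}. (real q + 3) / (real q)\<^sup>2) \<le> (\<Sum>q\<in>{1..N}. 4 * inverse (real q))"
  proof (rule sum_mono)
    fix q assume "q \<in> {1..N}"
    then have "real q \<ge> 1" by simp
    then have q: "real q \<ge> 1" by simp
    then have "(real q + 3) / (real q)\<^sup>2 \<le> (4 * real q) / (real q)\<^sup>2" by (intro divide_right_mono) auto
    also have "\<dots> = 4 * inverse (real q)" using q by (simp add: power2_eq_square divide_inverse)
    finally show "(real q + 3) / (real q)\<^sup>2 \<le> 4 * inverse (real q)" .
  qed
  also have "\<dots> = 4 * harm N" by (simp add: harm_def sum_distrib_left)
  also have "harm N \<le> 1 + ln X"
  proof -
    have N: "N \<ge> 1" "real N \<le> X" using assms by (auto simp: N_def le_nat_floor)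
    have "harm N \<le> 1 + ln (real N)"
      using decseqD[OF decseq_harm_diff_ln, of 0 "N - 1"] N(1) by (simp add: harm_def)
    also have "ln (real N) \<le> ln X" using N by simp
    finally show ?thesis by simp
  qed
  finally show ?thesis using assms by (simp add: mult_right_mono field_simps)
qed

context circle_problem
begin

lemma s_ge_10: "s \<ge> 10"
proof (rule condition_L1_nonsingular_block[OF L1])
  fix I J
  assume IJ: "I \<subseteq> {..<s}" "J \<subseteq> {..<s}" "I \<inter> J = {}" "card I = 5" "card J = 5"
  have "finite I" "finite J" using IJ finite_subset by blast+
  then have "card (I \<union> J) = 10" using IJ by (simp add: card_Un_disjoint)
  moreover have "card (I \<union> J) \<le> card {..<s}" using IJ by (intro card_mono) auto
  ultimately show ?thesis by simp
qed

definition T_const :: real where "T_const = 16 * (2 * coeff_norm s F + 1)"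

lemma T_const_pos: "T_const > 0"
  using coeff_norm_nonneg[of s F] by (simp add: T_const_def)

text \<open>The variables run over 0, ..., N and so have N + 1 values.\<close>

definition T_range :: "nat \<Rightarrow> nat" where "T_range N = nat \<lceil>coeff_norm s F * real (N + 1)\<rceil>"

lemma T_range_ge: "coeff_norm s F * real (N + 1) \<le> real (T_range N)"
  using coeff_norm_nonneg[of s F] by (simp add: T_range_def del: of_nat_Suc of_nat_add)

text \<open>\<open>Tsum_le\<close> with a range proportional to N, written symmetrically in N and q
  so that it can be used for denominators on either side of N.\<close>

lemma Tsum_bound:
  fixes \<alpha> :: real and a' q :: int
  assumes "coprime a' q" "q > 0" "\<bar>\<alpha> - a' / q\<bar> \<le> 1 / q\<^sup>2" "N \<ge> 1"
  shows "Tsum \<alpha> (N + 1) (T_range N) \<le> T_const * (2 + ln q) * ((real N + q)\<^sup>2 / q)"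
proof -
  define c where "c = coeff_norm s F"
  have c: "c \<ge> 0" by (simp add: c_def coeff_norm_nonneg)
  have q: "real_of_int q \<ge> 1" using assms(2) by linarith
  have N: "real N \<ge> 1" using assms(4) by simp
  have "real (T_range N) \<le> c * real (N + 1) + 1"
    using c by (simp add: T_range_def c_def del: of_nat_Suc of_nat_add)
  also have "\<dots> \<le> c * (2 * real N) + real N" using c N by (intro add_mono mult_left_mono) auto
  finally have M: "real (T_range N) \<le> (2 * c + 1) * real N" by (simp add: algebra_simps)
  have 1: "4 * real (T_range N) / q + 2 \<le> 4 * (2 * c + 1) * ((real N + q) / q)"
  proof -
    have "4 * real (T_range N) / q \<le> 4 * ((2 * c + 1) * real N) / q"
      using M q by (intro divide_right_mono) auto
    moreover have "2 \<le> 4 * (2 * c + 1)" using c by simp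
    moreover have "4 * (2 * c + 1) * ((real N + q) / q) = 4 * ((2 * c + 1) * real N) / q + 4 * (2 * c + 1)"
      using q by (simp add: field_simps)
    ultimately show ?thesis by linarith
  qed
  have 2: "real (N + 1) + q * (1 + ln q) \<le> (2 + ln q) * (real N + q)"
  proof -
    have "0 \<le> ln q * real N" using q by (intro mult_nonneg_nonneg) auto
    moreover have *: "n + 1 + Q * (1 + l) \<le> (2 + l) * (n + Q)" if "0 \<le> l * n" "1 \<le> n" "1 \<le> Q" for n Q l :: real
    proof -
      have "(2 + l) * (n + Q) - (n + 1 + Q * (1 + l)) = (n - 1) + Q + l * n" by (simp add: algebra_simps)
      with that show ?thesis by linarith
    qed
    ultimately show ?thesis using *[of "ln q" "real N" "real_of_int q"] N q by (simp add: add_ac)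
  qed
  have "Tsum \<alpha> (N + 1) (T_range N) \<le> (4 * real (T_range N) / q + 2) * (4 * (real (N + 1) + q * (1 + ln q)))"
    using Tsum_le[OF assms(1-3), of "N + 1" "T_range N"] by simp
  also have "\<dots> \<le> (4 * (2 * c + 1) * ((real N + q) / q)) * (4 * ((2 + ln q) * (real N + q)))"
    using 1 2 q c N by (intro mult_mono) (auto intro!: mult_nonneg_nonneg add_nonneg_nonneg)
  also have "\<dots> = T_const * (2 + ln q) * ((real N + q)\<^sup>2 / q)"
    by (simp add: T_const_def c_def power2_eq_square) (simp add: algebra_simps)
  finally show ?thesis .
qed

text \<open>When \<open>\<alpha>\<close> is not very close to \<open>a'/q\<close>, a second Dirichlet approximation has denominator
  of size about \<open>1 / \<bar>q \<alpha> - a'\<bar>\<close>, which turns the distance into a saving.\<close>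

lemma Tsum_minor:
  fixes \<alpha> X :: real and a' q :: int
  assumes X: "X \<ge> 2" and N: "N = nat \<lfloor>X\<rfloor>" and cop: "coprime a' q" and q: "0 < q" "q \<le> int N"
    and approx: "\<bar>q * \<alpha> - a'\<bar> < 1 / real N"
  shows "Tsum \<alpha> (N + 1) (T_range N) \<le> 10 * T_const * (4 + 2 * ln X) * X\<^sup>2 * (1 / (q * max 1 (X\<^sup>2 * \<bar>\<alpha> - a' / q\<bar>)))"
proof -
  define \<beta> where "\<beta> = \<alpha> - a' / q"
  define \<eta> where "\<eta> = \<bar>q * \<alpha> - a'\<bar>"
  have N1: "real N \<ge> 1" "real N \<le> X" using X unfolding N by linarith+
  have q1: "real_of_int q \<ge> 1" "real_of_int q \<le> real N" using q by linarith+
  have L: "ln X \<ge> 0" using X by simp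
  have \<eta>\<beta>: "\<eta> = q * \<bar>\<beta>\<bar>"
  proof -
    have "q * \<alpha> - a' = q * \<beta>" using q1 by (simp add: \<beta>_def right_diff_distrib)
    then show ?thesis using q1 by (simp add: \<eta>_def abs_mult)
  qed
  show ?thesis
  proof (cases "X\<^sup>2 * \<bar>\<beta>\<bar> \<le> 1")
    \<comment> \<open>Within distance X^-2 of the fraction the first approximation is already
      sufficient.\<close>
    case True
    have "\<bar>\<beta>\<bar> \<le> 1 / q\<^sup>2"
    proof -
      have "q * \<bar>\<beta>\<bar> \<le> 1 / real N"
        using approx unfolding \<eta>_def[symmetric] \<eta>\<beta> by (rule less_imp_le)
      also have "\<dots> \<le> 1 / q" using q1 by (intro divide_left_mono) auto
      finally have "q * \<bar>\<beta>\<bar> \<le> 1 / q" .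
      then show ?thesis using q1 by (simp add: field_simps power2_eq_square)
    qed
    then have "Tsum \<alpha> (N + 1) (T_range N) \<le> T_const * (2 + ln q) * ((real N + q)\<^sup>2 / q)"
      using cop q N1 by (intro Tsum_bound) (auto simp: \<beta>_def)
    also have "\<dots> \<le> T_const * (2 + ln X) * ((2 * X)\<^sup>2 / q)"
    proof (intro mult_mono divide_right_mono power_mono)
      show "2 + ln q \<le> 2 + ln X" using q1 N1 by simp
      show "0 \<le> T_const * (2 + ln X)" using T_const_pos L by (intro mult_nonneg_nonneg) linarith+
    qed (use T_const_pos q1 N1 L in auto)
    also have "\<dots> \<le> T_const * (4 + 2 * ln X) * (10 * X\<^sup>2 / q)"
      using T_const_pos L q1 by (intro mult_mono divide_right_mono) (auto simp: power_mult_distrib)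
    also have "\<dots> = 10 * T_const * (4 + 2 * ln X) * X\<^sup>2 * (1 / (q * 1))" by simp
    finally show ?thesis using True by (simp add: \<beta>_def max_def)
  next
    case False
    have "\<beta> \<noteq> 0" using False by auto
    have \<eta>0: "\<eta> > 0" using \<open>\<beta> \<noteq> 0\<close> q1 by (simp add: \<eta>\<beta>)
    have \<eta>1: "real N * \<eta> < 1" using approx N1 by (simp add: \<eta>_def field_simps)
    have \<eta>le: "\<eta> \<le> 1"
    proof -
      have "1 * \<eta> \<le> real N * \<eta>" using N1 \<eta>0 by (intro mult_right_mono) auto
      then show ?thesis using \<eta>1 by simp
    qed
    \<comment> \<open>With N2 \<ge> 2/\<eta> the new approximation error is at most \<eta>/2, so the
      new fraction differs from a'/q.\<close>
    define N2 where "N2 = nat \<lceil>2 / \<eta>\<rceil>"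
    have N2: "real N2 \<ge> 2 / \<eta>" "real N2 \<le> 2 / \<eta> + 1" using \<eta>0 by (auto simp: N2_def)
    have N2pos: "N2 > 0" using N2(1) \<eta>0 by (metis divide_pos_pos gr0I not_le of_nat_0 zero_less_numeral)
    obtain a2 q2 where a2: "coprime a2 q2" "0 < q2" "q2 \<le> int N2" "\<bar>of_int q2 * \<alpha> - of_int a2\<bar> < 1 / real N2"
      using Dirichlet_approx_coprime[OF N2pos] by metis
    have q2: "real_of_int q2 \<ge> 1" "real_of_int q2 \<le> real N2" using a2 by linarith+
    have N2inv: "1 / real N2 \<le> \<eta> / 2" using N2(1) \<eta>0 N2pos by (simp add: field_simps)
    have ne: "a2 * q - a' * q2 \<noteq> 0"
    proof
      assume "a2 * q - a' * q2 = 0"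
      then have "a2 * q = a' * q2" by simp
      from coprime_fractions_eq[OF cop a2(1) q(1) a2(2) this] have "q = q2" "a' = a2" .
      then have "\<eta> < 1 / real N2" using a2(4) by (simp add: \<eta>_def)
      with N2inv \<eta>0 show False by linarith
    qed
    \<comment> \<open>The nonzero determinant of the two fractions is at most q2 \<eta> + q
      \<eta>/2, and q \<eta> \<le> N \<eta> < 1.\<close>
    have lower: "1 / 2 \<le> q2 * \<eta>"
    proof -
      have "1 \<le> \<bar>real_of_int (a2 * q - a' * q2)\<bar>" using ne by linarith
      also have "real_of_int (a2 * q - a' * q2) = q2 * (q * \<alpha> - a') - q * (q2 * \<alpha> - a2)"
        by (simp add: algebra_simps)
      also have "\<bar>\<dots>\<bar> \<le> \<bar>q2 * (q * \<alpha> - a')\<bar> + \<bar>q * (q2 * \<alpha> - a2)\<bar>" by linarith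
      also have "\<dots> = q2 * \<eta> + q * \<bar>q2 * \<alpha> - a2\<bar>" using q1 q2 by (simp add: abs_mult \<eta>_def)
      also have "\<dots> \<le> q2 * \<eta> + real N * (\<eta> / 2)"
        using q1 a2(4) N2inv by (intro add_left_mono mult_mono) auto
      also have "\<dots> \<le> q2 * \<eta> + 1 / 2" using \<eta>1 by simp
      finally show ?thesis by simp
    qed
    have upper: "q2 \<le> 3 / \<eta>"
    proof -
      have "1 \<le> 1 / \<eta>" using \<eta>0 \<eta>le by simp
      then have "2 / \<eta> + 1 \<le> 3 / \<eta>" by (simp add: field_simps)
      then show ?thesis using q2(2) N2(2) by linarith
    qed
    have \<eta>X: "1 / \<eta> \<le> X\<^sup>2"
    proof -
      have "1 \<le> X\<^sup>2 * \<bar>\<beta>\<bar>" using False by simp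
      also have "\<dots> \<le> X\<^sup>2 * \<eta>" unfolding \<eta>\<beta> using q1 by (intro mult_left_mono) (auto simp: mult_le_cancel_right1)
      finally show ?thesis using \<eta>0 by (simp add: field_simps)
    qed
    have lnq2: "ln q2 \<le> 2 + 2 * ln X"
    proof -
      have "real_of_int q2 \<le> 3 * X\<^sup>2" using upper \<eta>X by simp
      then have "ln q2 \<le> ln (3 * X\<^sup>2)" using q2 X by (intro ln_mono) auto
      also have "\<dots> = ln 3 + 2 * ln X" using X by (simp add: ln_mult ln_realpow)
      also have "ln (3::real) \<le> 2" using ln_le_minus_one[of "3::real"] by simp
      finally show ?thesis by simp
    qed
    have "\<bar>\<alpha> - a2 / q2\<bar> \<le> 1 / q2\<^sup>2"
    proof -
      have "\<bar>q2 * \<alpha> - a2\<bar> \<le> 1 / q2"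
      proof -
        have "\<bar>q2 * \<alpha> - a2\<bar> \<le> 1 / real N2" using a2(4) by (rule less_imp_le)
        also have "\<dots> \<le> 1 / q2" using q2 by (intro divide_left_mono) auto
        finally show ?thesis .
      qed
      moreover have "q2 * \<alpha> - a2 = q2 * (\<alpha> - a2 / q2)" using q2 by (simp add: right_diff_distrib)
      ultimately have "q2 * \<bar>\<alpha> - a2 / q2\<bar> \<le> 1 / q2" using q2 by (simp add: abs_mult)
      then show ?thesis using q2 by (simp add: field_simps power2_eq_square)
    qed
    then have "Tsum \<alpha> (N + 1) (T_range N) \<le> T_const * (2 + ln q2) * ((real N + q2)\<^sup>2 / q2)"
      using a2 N1 by (intro Tsum_bound) auto
    \<comment> \<open>The constant is 4 + 6: from N \<eta> < 1 and q2 \<eta> \<ge> 1/2 the part 2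
      N^2 / q2 is at most 4/\<eta>, and 2 q2 is at most 6/\<eta>.\<close>
    also have "\<dots> \<le> T_const * (4 + 2 * ln X) * (10 / \<eta>)"
    proof (intro mult_mono)
      have "(real N + q2)\<^sup>2 \<le> 2 * (real N)\<^sup>2 + 2 * q2\<^sup>2"
        using sum_squares_bound[of "real N" "real_of_int q2"] by (simp add: power2_sum)
      then have "(real N + q2)\<^sup>2 / q2 \<le> (2 * (real N)\<^sup>2 + 2 * q2\<^sup>2) / q2" using q2 by (intro divide_right_mono) auto
      also have "\<dots> = 2 * (real N)\<^sup>2 / q2 + 2 * q2" using q2 by (simp add: field_simps power2_eq_square)
      also have "2 * (real N)\<^sup>2 / q2 \<le> 4 / \<eta>"
      proof -
        have "(real N * \<eta>)\<^sup>2 \<le> 1" using \<eta>1 \<eta>0 by (intro power_le_one) auto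
        then have "2 * (real N)\<^sup>2 * \<eta> * \<eta> \<le> 2" by (simp add: power2_eq_square mult_ac)
        also have "2 \<le> 4 * (q2 * \<eta>)" using lower by linarith
        finally have "(2 * (real N)\<^sup>2 * \<eta>) * \<eta> \<le> (4 * q2) * \<eta>" by (simp add: mult_ac)
        then have "2 * (real N)\<^sup>2 * \<eta> \<le> 4 * q2" using \<eta>0 by (simp only: mult_le_cancel_right_pos)
        then show ?thesis using \<eta>0 q2 by (simp add: field_simps)
      qed
      finally show "(real N + q2)\<^sup>2 / q2 \<le> 10 / \<eta>" using upper by simp
    qed (use T_const_pos lnq2 q2 L in auto)
    also have "\<dots> = 10 * T_const * (4 + 2 * ln X) * X\<^sup>2 * (1 / (q * (X\<^sup>2 * \<bar>\<beta>\<bar>)))"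
      using X \<eta>0 by (simp add: \<eta>\<beta>)
    finally show ?thesis using False by (simp add: \<beta>_def max_def)
  qed
qed

lemma expsum_weyl:
  "cmod (expsum X \<alpha>) \<le> (\<Sum>x\<le>nat \<lfloor>X\<rfloor>. a x) ^ (s - 10) * (\<Sum>x\<le>nat \<lfloor>X\<rfloor>. (a x)\<^sup>2) ^ 5
    * sqrt (Tsum \<alpha> (nat \<lfloor>X\<rfloor> + 1) (T_range (nat \<lfloor>X\<rfloor>)) ^ 5)"
proof -
  have "bij_betw int {..N} {0..<int (N + 1)}" for N
    by (rule bij_betw_byWitness[where f' = nat]) auto
  from weyl[OF this T_range_ge, where b = a and \<alpha> = \<alpha>] show ?thesis
    using a_nonneg by (simp add: expsum_def)
qed

text \<open>The power 5/2 of \<tau> is written as \<open>\<tau>\<^sup>2 * sqrt \<tau>\<close>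
  because the two factors have different uses: the square is integrated over the circle, the root is
  the saving on the minor arcs.\<close>

lemma expsum_bound:
  obtains c C where "C > 0"
    "eventually (\<lambda>X. \<forall>\<alpha> a' q. coprime a' q \<longrightarrow> 0 < q \<longrightarrow> q \<le> int (nat \<lfloor>X\<rfloor>) \<longrightarrow> \<bar>of_int q * \<alpha> - of_int a'\<bar> < 1 / real (nat \<lfloor>X\<rfloor>) \<longrightarrow>
       cmod (expsum X \<alpha>) \<le> C * (wsum a X ^ s * ln X powr c) *
         (let \<tau> = 1 / (of_int q * max 1 (X\<^sup>2 * \<bar>\<alpha> - of_int a' / of_int q\<bar>)) in \<tau>\<^sup>2 * sqrt \<tau>)) at_top"
proof -
  obtain c C where c: "c > 0" "C > 0"
    "eventually (\<lambda>X. (\<Sum>x\<le>nat \<lfloor>X\<rfloor>. (a x)\<^sup>2) \<le> C * ((wsum a X)\<^sup>2 / X * ln X powr c)) at_top"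
    by (rule weight_squares_bound)
  \<comment> \<open>The logarithm to the power 5/2, with its constants, is rounded up to the power
    3.\<close>
  have "eventually (\<lambda>X. sqrt ((10 * T_const * (4 + 2 * ln X)) ^ 5) \<le> ln X powr 3) at_top"
    using T_const_pos by real_asymp
  with c(3) have "eventually (\<lambda>X. \<forall>\<alpha> a' q. coprime a' q \<longrightarrow> 0 < q \<longrightarrow> q \<le> int (nat \<lfloor>X\<rfloor>) \<longrightarrow> \<bar>of_int q * \<alpha> - of_int a'\<bar> < 1 / real (nat \<lfloor>X\<rfloor>) \<longrightarrow>
       cmod (expsum X \<alpha>) \<le> (2 ^ (s - 10) * C ^ 5) * (wsum a X ^ s * ln X powr (5 * c + 3)) *
         (let \<tau> = 1 / (of_int q * max 1 (X\<^sup>2 * \<bar>\<alpha> - of_int a' / of_int q\<bar>)) in \<tau>\<^sup>2 * sqrt \<tau>)) at_top"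
    using eventually_ge_at_top[of 3] eventually_wsum_ge[of "max 1 (a 0)"]
  proof eventually_elim
    case (elim X)
    define A where "A = wsum a X"
    define L where "L = ln X"
    define N where "N = nat \<lfloor>X\<rfloor>"
    have A: "A \<ge> 1" "A \<ge> a 0" and X: "X \<ge> 3" and L: "L > 0" using elim by (auto simp: A_def L_def)
    show ?case
    proof (intro allI impI)
      fix \<alpha> :: real and a' q :: int
      assume q: "coprime a' q" "0 < q" "q \<le> int (nat \<lfloor>X\<rfloor>)" "\<bar>of_int q * \<alpha> - of_int a'\<bar> < 1 / real (nat \<lfloor>X\<rfloor>)"
      define \<tau> where "\<tau> = 1 / (of_int q * max 1 (X\<^sup>2 * \<bar>\<alpha> - of_int a' / of_int q\<bar>))"
      define T where "T = Tsum \<alpha> (N + 1) (T_range N)"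
      define U where "U = 10 * T_const * (4 + 2 * L)"
      have \<tau>: "\<tau> > 0" using q(2) by (simp add: \<tau>_def less_max_iff_disj)
      have U: "U > 0" using T_const_pos L by (simp add: U_def)
      have "T \<le> U * X\<^sup>2 * \<tau>"
        unfolding T_def U_def L_def \<tau>_def using q X by (intro Tsum_minor) (auto simp: N_def)
      then have "sqrt (T ^ 5) \<le> sqrt ((U * X\<^sup>2 * \<tau>) ^ 5)" by (intro real_sqrt_le_mono power_mono) (auto simp: T_def)
      also have "\<dots> = sqrt (U ^ 5) * X ^ 5 * (\<tau>\<^sup>2 * sqrt \<tau>)"
      proof -
        have 1: "(X\<^sup>2) ^ 5 = (X ^ 5)\<^sup>2" by (simp flip: power_mult)
        have 2: "\<tau> ^ 5 = (\<tau>\<^sup>2)\<^sup>2 * \<tau>" by (simp add: power2_eq_square eval_nat_numeral)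
        have "X ^ 5 \<ge> 0" "\<tau>\<^sup>2 \<ge> 0" using X by auto
        then have "sqrt (U ^ 5 * (X ^ 5)\<^sup>2 * ((\<tau>\<^sup>2)\<^sup>2 * \<tau>)) = sqrt (U ^ 5) * X ^ 5 * (\<tau>\<^sup>2 * sqrt \<tau>)"
          unfolding real_sqrt_mult by (simp only: real_sqrt_abs abs_of_nonneg)
        then show ?thesis by (simp only: power_mult_distrib 1 2)
      qed
      also have "\<dots> \<le> L powr 3 * X ^ 5 * (\<tau>\<^sup>2 * sqrt \<tau>)"
        using elim(2) \<tau> X by (intro mult_right_mono) (auto simp: U_def L_def)
      finally have T: "sqrt (T ^ 5) \<le> L powr 3 * X ^ 5 * (\<tau>\<^sup>2 * sqrt \<tau>)" .
      have S1: "(\<Sum>x\<le>N. a x) ^ (s - 10) \<le> (2 * A) ^ (s - 10)"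
        using A(2) sum_atMost_eq_wsum[of a X] a_nonneg
        by (intro power_mono) (auto simp: A_def N_def intro: add_nonneg_nonneg wsum_nonneg)
      have S2: "(\<Sum>x\<le>N. (a x)\<^sup>2) ^ 5 \<le> (C * (A\<^sup>2 / X * L powr c)) ^ 5"
        using elim(1) by (intro power_mono) (auto simp: A_def L_def N_def intro: sum_nonneg)
      have "cmod (expsum X \<alpha>) \<le> (\<Sum>x\<le>N. a x) ^ (s - 10) * (\<Sum>x\<le>N. (a x)\<^sup>2) ^ 5 * sqrt (T ^ 5)"
        unfolding T_def N_def by (rule expsum_weyl)
      also have "\<dots> \<le> (2 * A) ^ (s - 10) * (C * (A\<^sup>2 / X * L powr c)) ^ 5 * (L powr 3 * X ^ 5 * (\<tau>\<^sup>2 * sqrt \<tau>))"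
        using S1 S2 T A X c(2)
        by (intro mult_mono) (auto intro!: mult_nonneg_nonneg zero_le_power sum_nonneg a_nonneg simp: T_def)
      \<comment> \<open>The X^5 from the root of the kernel sums cancels the X^-5 from five copies
        of Condition L2; this balance makes the trivial size A(X)^s appear.\<close>
      also have "\<dots> = (2 ^ (s - 10) * C ^ 5) * ((A ^ (s - 10) * A ^ 10) * ((L powr c) ^ 5 * L powr 3)) * (\<tau>\<^sup>2 * sqrt \<tau>)"
        using X by (simp add: power_mult_distrib power_divide flip: power_mult)
      also have "A ^ (s - 10) * A ^ 10 = A ^ s" using s_ge_10 by (simp flip: power_add)
      also have "(L powr c) ^ 5 = L powr (5 * c)"
        using L by (simp add: powr_realpow[symmetric] powr_powr mult.commute)
      also have "L powr (5 * c) * L powr 3 = L powr (5 * c + 3)" by (simp add: powr_add)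
      finally show "cmod (expsum X \<alpha>) \<le> (2 ^ (s - 10) * C ^ 5) * (wsum a X ^ s * ln X powr (5 * c + 3)) *
         (let \<tau> = 1 / (of_int q * max 1 (X\<^sup>2 * \<bar>\<alpha> - of_int a' / of_int q\<bar>)) in \<tau>\<^sup>2 * sqrt \<tau>)"
        by (simp add: Let_def \<tau>_def A_def L_def)
    qed
  qed
  then show ?thesis using c(2) by (intro that[of "2 ^ (s - 10) * C ^ 5" "5 * c + 3"]) auto
qed

definition major_arc :: "real \<Rightarrow> real \<Rightarrow> nat \<times> nat \<Rightarrow> real set" where
  "major_arc B X u = {real (snd u) / real (fst u) - ln X powr B / X\<^sup>2..real (snd u) / real (fst u) + ln X powr B / X\<^sup>2}"

definition arc_index :: "real \<Rightarrow> real \<Rightarrow> (nat \<times> nat) set" where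
  "arc_index B X = (SIGMA q:{1..nat \<lfloor>ln X powr B\<rfloor>}. totatives q)"

text \<open>An interval of length one shifted by the half-width of an arc, so that the arc around 1
  is not cut. Half open, to be a full period without overlap.\<close>

definition unit_arc :: "real \<Rightarrow> real \<Rightarrow> real set" where
  "unit_arc B X = {ln X powr B / X\<^sup>2<..1 + ln X powr B / X\<^sup>2}"

text \<open>The constants \<open>C\<close> and \<open>c\<close> are fixed before \<open>B\<close>,
  which allows \<open>B\<close> to be chosen in terms of \<open>c\<close> later.\<close>

lemma minor_pointwise:
  obtains c C where "C > 0"
    "\<And>B. B > 0 \<Longrightarrow> eventually (\<lambda>X. \<forall>\<alpha>\<in>unit_arc B X - (\<Union>u\<in>arc_index B X. major_arc B X u).
       cmod (expsum X \<alpha>) \<le> C * (wsum a X ^ s * ln X powr (c - B / 2)) * bump_sum X \<alpha>) at_top"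
proof -
  obtain c C where C: "C > 0"
    "eventually (\<lambda>X. \<forall>\<alpha> a' q. coprime a' q \<longrightarrow> 0 < q \<longrightarrow> q \<le> int (nat \<lfloor>X\<rfloor>) \<longrightarrow> \<bar>of_int q * \<alpha> - of_int a'\<bar> < 1 / real (nat \<lfloor>X\<rfloor>) \<longrightarrow>
       cmod (expsum X \<alpha>) \<le> C * (wsum a X ^ s * ln X powr c) *
         (let \<tau> = 1 / (of_int q * max 1 (X\<^sup>2 * \<bar>\<alpha> - of_int a' / of_int q\<bar>)) in \<tau>\<^sup>2 * sqrt \<tau>)) at_top"
    by (rule expsum_bound)
  show ?thesis
  proof (rule that[of "2 * C" c])
    fix B :: real assume B: "B > 0"
    \<comment> \<open>Ensures that a fraction near the unit interval with denominator at most P has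
      its numerator between 1 and q, and that P \<le> X.\<close>
    have "eventually (\<lambda>X. 2 * (ln X powr B / X\<^sup>2) * ln X powr B < 1) at_top" using B by real_asymp
    moreover have "eventually (\<lambda>X::real. ln X \<ge> 1) at_top" by real_asymp
    ultimately show "eventually (\<lambda>X. \<forall>\<alpha>\<in>unit_arc B X - (\<Union>u\<in>arc_index B X. major_arc B X u).
       cmod (expsum X \<alpha>) \<le> (2 * C) * (wsum a X ^ s * ln X powr (c - B / 2)) * bump_sum X \<alpha>) at_top"
      using C(2) eventually_ge_at_top[of 3]
    proof eventually_elim
      case (elim X)
      define P where "P = ln X powr B"
      define \<delta> where "\<delta> = P / X\<^sup>2"
      define N where "N = nat \<lfloor>X\<rfloor>"
      have P: "P \<ge> 1" using elim B by (simp add: P_def ge_one_powr_ge_zero)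
      have X: "X \<ge> 3" using elim by simp
      have \<delta>: "\<delta> > 0" "2 * \<delta> * P < 1" using elim(1) P X by (auto simp: \<delta>_def P_def)
      have \<delta>2: "\<delta> < 1 / 2"
      proof -
        have "2 * \<delta> * 1 \<le> 2 * \<delta> * P" using \<delta> P by (intro mult_left_mono) auto
        then show ?thesis using \<delta>(2) by linarith
      qed
      have N: "N \<ge> 1" using X by (simp add: N_def le_nat_floor)
      show ?case
      proof
        fix \<alpha> assume \<alpha>: "\<alpha> \<in> unit_arc B X - (\<Union>u\<in>arc_index B X. major_arc B X u)"
        then have \<alpha>U: "\<delta> < \<alpha>" "\<alpha> \<le> 1 + \<delta>" by (auto simp: unit_arc_def \<delta>_def P_def)
        obtain a' q where q: "coprime a' q" "0 < q" "q \<le> int N" "\<bar>of_int q * \<alpha> - of_int a'\<bar> < 1 / real N"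
          using Dirichlet_approx_coprime[of N \<alpha>] N by auto
        define \<beta> where "\<beta> = \<alpha> - a' / q"
        define z where "z = X\<^sup>2 * \<bar>\<beta>\<bar>"
        define \<tau> where "\<tau> = 1 / (of_int q * max 1 z)"
        have q1: "real_of_int q \<ge> 1" using q(2) by linarith
        have N1: "1 / real N \<le> 1" using N by simp
        have q\<beta>: "q * \<alpha> - a' = q * \<beta>" using q1 by (simp add: \<beta>_def right_diff_distrib)
        \<comment> \<open>If both quantities were at most P, then \<alpha> would lie on the arc
          around a'/q; it remains to see that a' is an admissible numerator.\<close>
        have minor: "real_of_int q > P \<or> z > P"
        proof (rule ccontr)
          assume "\<not> (real_of_int q > P \<or> z > P)"
          then have le: "real_of_int q \<le> P" "z \<le> P" by auto
          have \<beta>: "\<bar>\<beta>\<bar> \<le> \<delta>" using le(2) X by (simp add: z_def \<delta>_def field_simps)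
          have "of_int a' = q * (\<alpha> - \<beta>)" using q1 by (simp add: \<beta>_def)
          moreover have "0 < q * (\<alpha> - \<beta>)" using q1 \<alpha>U \<beta> by (intro mult_pos_pos) auto
          ultimately have a0: "a' > 0" by simp
          have "q * (\<alpha> - \<beta>) \<le> q * (1 + 2 * \<delta>)" using q1 \<alpha>U \<beta> by (intro mult_left_mono) auto
          also have "\<dots> = q + 2 * \<delta> * q" by (simp add: algebra_simps)
          also have "\<dots> \<le> q + 2 * \<delta> * P" using le \<delta> by (intro add_left_mono mult_left_mono) auto
          also have "\<dots> < q + 1" using \<delta> by simp
          finally have "real_of_int a' < real_of_int (q + 1)" using \<open>of_int a' = q * (\<alpha> - \<beta>)\<close> by simp
          then have aq: "a' \<le> q" by linarith
          define u where "u = (nat q, nat a')"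
          have "nat a' \<in> totatives (nat q)"
          proof -
            have "coprime (int (nat a')) (int (nat q))" using a0 q(1,2) by simp
            then have "coprime (nat a') (nat q)" by (simp only: coprime_int_iff)
            then show ?thesis using a0 aq q(2) by (simp add: totatives_def nat_mono)
          qed
          moreover have "nat q \<le> nat \<lfloor>P\<rfloor>" using le(1) by (intro nat_mono) (simp add: le_floor_iff)
          ultimately have "u \<in> arc_index B X" using q(2) by (simp add: u_def arc_index_def P_def)
          moreover have "\<alpha> \<in> major_arc B X u"
            using \<beta> a0 q(2) unfolding \<beta>_def by (auto simp: major_arc_def u_def \<delta>_def P_def abs_le_iff)
          ultimately show False using \<alpha> by blast
        qed
        have \<tau>P: "\<tau> \<le> 1 / P" "\<tau> > 0"
        proof -
          have "P \<le> q * max 1 z"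
          proof (cases "real_of_int q > P")
            case True
            have "P * 1 \<le> q * max 1 z" using True P q1 by (intro mult_mono) auto
            then show ?thesis by simp
          next
            case False
            then have "1 * P \<le> q * max 1 z" using minor q1 P by (intro mult_mono) auto
            then show ?thesis by simp
          qed
          then show "\<tau> \<le> 1 / P" unfolding \<tau>_def using P by (intro divide_left_mono) auto
          show "\<tau> > 0" using q1 by (simp add: \<tau>_def less_max_iff_disj)
        qed
        have sq: "sqrt \<tau> \<le> ln X powr (- (B / 2))"
        proof -
          have "sqrt \<tau> \<le> sqrt (1 / P)" using \<tau>P by (intro real_sqrt_le_mono)
          also have "1 / P = ln X powr (- B)" by (simp add: P_def powr_minus divide_inverse)
          also have "sqrt \<dots> = ln X powr (- (B / 2))"
            using elim(2) by (simp add: powr_half_sqrt[symmetric] powr_powr)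
          finally show ?thesis .
        qed
        have \<tau>2: "\<tau>\<^sup>2 \<le> 2 * (1 / (real_of_int q)\<^sup>2 * bump X (a' / q) \<alpha>)"
        proof -
          have z2: "(X\<^sup>2 * (\<alpha> - a' / q))\<^sup>2 = z\<^sup>2" by (simp add: z_def \<beta>_def power_mult_distrib)
          have m: "1 + z\<^sup>2 \<le> 2 * (max 1 z)\<^sup>2"
            by (cases "z \<le> 1") (auto simp: max_def z_def power_le_one one_le_power)
          have le: "1 / (max 1 z)\<^sup>2 \<le> 2 / (1 + z\<^sup>2)"
          proof -
            have "1 + z\<^sup>2 > 0" by (simp add: add_pos_nonneg)
            moreover have "(max 1 z)\<^sup>2 > 0" by (simp add: less_max_iff_disj)
            ultimately show ?thesis using m by (simp add: field_simps)
          qed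
          have "\<tau>\<^sup>2 = 1 / (real_of_int q)\<^sup>2 * (1 / (max 1 z)\<^sup>2)" by (simp add: \<tau>_def power_mult_distrib power_divide)
          also have "\<dots> \<le> 1 / (real_of_int q)\<^sup>2 * (2 / (1 + z\<^sup>2))" using le by (intro mult_left_mono) auto
          finally show ?thesis unfolding bump_def z2 by simp
        qed
        have qa: "nat q \<in> {1..N}" using q by auto
        \<comment> \<open>The Dirichlet error is below 1 and q \<delta> \<le> 1, so the numerator
          falls in the range used in \<open>bump_sum\<close>.\<close>
        have aa: "a' \<ge> 0" "a' \<le> q + 2"
        proof -
          have "real_of_int a' > of_int q * \<alpha> - 1" using q(4) N1 by linarith
          moreover have "of_int q * \<alpha> > 0" using q1 \<alpha>U \<delta> by (intro mult_pos_pos) auto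
          ultimately show "a' \<ge> 0" by linarith
          have "q * \<alpha> \<le> q * (1 + \<delta>)" using q1 \<alpha>U by (intro mult_left_mono) auto
          moreover have "real_of_int q * \<delta> \<le> 1"
          proof -
            have "real_of_int q \<le> X" using q(3) X by (simp add: N_def) linarith
            then have "q * \<delta> \<le> X * \<delta>" using \<delta> by (intro mult_right_mono) auto
            also have "\<dots> = P / X" using X by (simp add: \<delta>_def power2_eq_square)
            also have "P / X \<le> 1"
            proof -
              have "2 * P\<^sup>2 < X\<^sup>2" using \<delta>(2) X by (simp add: \<delta>_def power2_eq_square field_simps)
              then have "P\<^sup>2 \<le> X\<^sup>2" using zero_le_power2[of P] by linarith
              then have "P \<le> X" by (rule power2_le_imp_le) (use X in simp)
              then show ?thesis using X by simp
            qed
            finally show ?thesis .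
          qed
          ultimately have "real_of_int a' < real_of_int q + 2" using q(4) N1 by (simp add: algebra_simps)
          then show "a' \<le> q + 2" by linarith
        qed
        have "1 / (real_of_int q)\<^sup>2 * bump X (a' / q) \<alpha> \<le> bump_sum X \<alpha>"
        proof -
          have "1 / (real (nat q))\<^sup>2 * bump X (real (nat a') / real (nat q)) \<alpha> \<le> (\<Sum>b\<in>{0..nat q + 2}. 1 / (real (nat q))\<^sup>2 * bump X (real b / real (nat q)) \<alpha>)"
            using aa q(2) by (intro member_le_sum) (auto simp: bump_nonneg nat_le_iff)
          also have "\<dots> \<le> bump_sum X \<alpha>"
            unfolding bump_sum_def N_def[symmetric] using qa
            by (intro member_le_sum[of "nat q" _ "\<lambda>q. \<Sum>b\<in>{0..q + 2}. 1 / (real q)\<^sup>2 * bump X (real b / real q) \<alpha>"])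
              (auto intro!: sum_nonneg divide_nonneg_nonneg bump_nonneg simp del: sum.atLeast0_atMost_Suc sum.cl_ivl_Suc)
          finally show ?thesis using aa q(2) by simp
        qed
        then have \<tau>2': "\<tau>\<^sup>2 \<le> 2 * bump_sum X \<alpha>" using \<tau>2 by linarith
        have A0: "0 \<le> wsum a X ^ s * ln X powr c" using wsum_nonneg[of a X] a_nonneg by simp
        have "cmod (expsum X \<alpha>) \<le> C * (wsum a X ^ s * ln X powr c) * (\<tau>\<^sup>2 * sqrt \<tau>)"
          using elim(3) q unfolding \<tau>_def z_def \<beta>_def N_def by (simp add: Let_def)
        also have "\<dots> \<le> C * (wsum a X ^ s * ln X powr c) * ((2 * bump_sum X \<alpha>) * ln X powr (- (B / 2)))"
          using \<tau>2' sq A0 C(1) \<tau>P(2) bump_sum_nonneg by (intro mult_left_mono mult_mono) auto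
        also have "\<dots> = (2 * C) * (wsum a X ^ s * (ln X powr c * ln X powr (- (B / 2)))) * bump_sum X \<alpha>" by simp
        also have "ln X powr c * ln X powr (- (B / 2)) = ln X powr (c - B / 2)" by (simp flip: powr_add)
        finally show "cmod (expsum X \<alpha>) \<le> (2 * C) * (wsum a X ^ s * ln X powr (c - B / 2)) * bump_sum X \<alpha>" .
      qed
    qed
  qed (use C in simp)
qed

end

section \<open>The asymptotic formula\<close>

lemma continuous_on_e [continuous_intros]: "continuous_on S g \<Longrightarrow> continuous_on S (\<lambda>x. e (g x))"
  unfolding e_def by (intro continuous_intros)

lemma set_integral_greaterThanAtMost:
  fixes f :: "real \<Rightarrow> 'a :: euclidean_space"
  assumes "continuous_on UNIV f"
  shows "(LINT x:{c<..d}|lborel. f x) = integral {c..d} f"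
proof -
  have [measurable]: "f \<in> borel_measurable borel" using assms by (rule borel_measurable_continuous_onI)
  have "(LINT x:{c<..d}|lborel. f x) = (LINT x:{c..d}|lborel. f x)"
    unfolding set_lebesgue_integral_def
  proof (rule integral_cong_AE)
    show "AE x in lborel. indicat_real {c<..d} x *\<^sub>R f x = indicat_real {c..d} x *\<^sub>R f x"
      using AE_lborel_singleton[of c] by eventually_elim (auto simp: indicator_def)
  qed auto
  also have "\<dots> = integral {c..d} f"
    using assms by (intro set_borel_integral_eq_integral(2) borel_integrable_atLeastAtMost')
      (auto intro: continuous_on_subset)
  finally show ?thesis .
qed

lemma integral_e_int:
  "integral {d..1 + d} (\<lambda>\<alpha>. e (\<alpha> * of_int k)) = (if k = 0 then 1 else 0)"
proof (cases "k = 0")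
  case False
  define c where "c = 2 * of_real pi * \<i> * complex_of_int k"
  have c: "c \<noteq> 0" using False by (simp add: c_def)
  have eq: "e (\<alpha> * of_int k) = exp (of_real \<alpha> * c)" for \<alpha> by (simp add: e_def c_def mult_ac)
  have "((\<lambda>\<alpha>. e (\<alpha> * of_int k)) has_integral (exp (of_real (1 + d) * c) / c - exp (of_real d * c) / c)) {d..1 + d}"
    unfolding eq
  proof (rule fundamental_theorem_of_calculus)
    fix x assume "x \<in> {d..1 + d}"
    show "((\<lambda>\<alpha>. exp (of_real \<alpha> * c) / c) has_vector_derivative exp (of_real x * c)) (at x within {d..1 + d})"
      using c by (auto intro!: derivative_eq_intros has_vector_derivative_real_field)
  qed simp
  moreover have "exp (of_real (1 + d) * c) = exp (of_real d * c)"
    unfolding eq[symmetric] by (rule e_cong) (simp add: algebra_simps)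
  ultimately show ?thesis using False by (simp add: integral_unique)
qed simp

context circle_problem
begin

definition twisted :: "real \<Rightarrow> real \<Rightarrow> complex" where
  "twisted X \<alpha> = expsum X \<alpha> * e (- \<alpha> * of_int t)"

lemma continuous_twisted: "continuous_on S (twisted X)"
  unfolding twisted_def[abs_def] expsum_def[abs_def] by (intro continuous_intros)

text \<open>Orthogonality over a period; the starting point \<open>d\<close> is free, so it can be
  adapted to the arcs.\<close>

lemma rep_count_eq_integral:
  "of_real (rep_count s F t a X) = (LINT \<alpha>:{d<..1 + d}|lborel. twisted X \<alpha>)"
proof -
  define V where "V = {..<s} \<rightarrow>\<^sub>E {..nat \<lfloor>X\<rfloor>}"
  have fin: "finite V" by (simp add: V_def finite_PiE)
  have Q: "qform s F (\<lambda>i. real (x i)) \<in> \<int>" for x :: "nat \<Rightarrow> nat" by (rule qform_Ints[OF F]) simp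
  define k where "k x = \<lfloor>qform s F (\<lambda>i. real (x i))\<rfloor> - t" for x :: "nat \<Rightarrow> nat"
  have k: "qform s F (\<lambda>i. real (x i)) = of_int (k x + t)" for x using Q[of x] by (simp add: k_def)
  have tw: "twisted X \<alpha> = (\<Sum>x\<in>V. of_real (\<Prod>i<s. a (x i)) * e (\<alpha> * of_int (k x)))" for \<alpha>
  proof -
    have "e (\<alpha> * of_int (k x + t)) * e (- \<alpha> * of_int t) = e (\<alpha> * of_int (k x))" for x
      unfolding e_add[symmetric] by (simp add: algebra_simps)
    then show ?thesis
      unfolding twisted_def expsum_def V_def[symmetric] k sum_distrib_right mult.assoc by simp
  qed
  have "(LINT \<alpha>:{d<..1 + d}|lborel. twisted X \<alpha>) = integral {d..1 + d} (twisted X)"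
    by (rule set_integral_greaterThanAtMost[OF continuous_twisted])
  also have "\<dots> = (\<Sum>x\<in>V. integral {d..1 + d} (\<lambda>\<alpha>. of_real (\<Prod>i<s. a (x i)) * e (\<alpha> * of_int (k x))))"
    unfolding tw[abs_def]
    by (intro integral_sum fin integrable_continuous_interval continuous_intros)
  also have "\<dots> = (\<Sum>x\<in>V. of_real (\<Prod>i<s. a (x i)) * (if k x = 0 then 1 else 0))"
    by (simp add: integral_e_int)
  also have "\<dots> = (\<Sum>x\<in>{x\<in>V. k x = 0}. of_real (\<Prod>i<s. a (x i)))"
    using fin by (intro sum.mono_neutral_cong_right) auto
  also have "\<dots> = of_real (rep_count s F t a X)"
  proof -
    have "{x\<in>V. k x = 0} = {x \<in> {..<s} \<rightarrow>\<^sub>E {0..nat \<lfloor>X\<rfloor>}. qform s F (\<lambda>i. real (x i)) = of_int t}"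
      unfolding k V_def by (auto simp: atLeast0AtMost)
    then show ?thesis by (simp add: rep_count_def)
  qed
  finally show ?thesis by simp
qed

lemma finite_arc_index [simp]: "finite (arc_index B X)"
  by (simp add: arc_index_def)

lemma arc_index_le:
  assumes "u \<in> arc_index B X"
  shows "1 \<le> fst u" "real (fst u) \<le> ln X powr B" "snd u \<in> totatives (fst u)"
proof -
  show "1 \<le> fst u" "snd u \<in> totatives (fst u)" using assms by (auto simp: arc_index_def)
  have "fst u \<le> nat \<lfloor>ln X powr B\<rfloor>" using assms by (auto simp: arc_index_def)
  then have "real (fst u) \<le> real (nat \<lfloor>ln X powr B\<rfloor>)" by (simp only: of_nat_le_iff)
  also have "\<dots> \<le> ln X powr B" by (rule of_nat_floor) simp
  finally show "real (fst u) \<le> ln X powr B" .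
qed

lemma major_arc_subset:
  assumes u: "u \<in> arc_index B X" and small: "2 * (ln X powr B / X\<^sup>2) * ln X powr B < 1" and X: "X > 0"
  shows "major_arc B X u \<subseteq> unit_arc B X"
proof
  fix \<alpha> assume \<alpha>: "\<alpha> \<in> major_arc B X u"
  define \<delta> where "\<delta> = ln X powr B / X\<^sup>2"
  define q where "q = real (fst u)"
  define b where "b = real (snd u)"
  have \<delta>: "\<delta> \<ge> 0" by (simp add: \<delta>_def)
  have q: "q \<ge> 1" "q \<le> ln X powr B" using arc_index_le[OF u] by (auto simp: q_def)
  have b: "1 \<le> b" "b \<le> q" using arc_index_le(3)[OF u] by (auto simp: b_def q_def totatives_def Suc_le_eq)
  have "2 * \<delta> * q \<le> 2 * \<delta> * ln X powr B" using q \<delta> by (intro mult_left_mono) auto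
  then have "2 * \<delta> * q < 1" using small by (simp add: \<delta>_def)
  then have "2 * \<delta> < 1 / q" using q by (simp add: field_simps)
  also have "1 / q \<le> b / q" using b q by (intro divide_right_mono) auto
  finally have "2 * \<delta> < b / q" .
  moreover have "b / q \<le> 1" using b q by simp
  moreover have "b / q - \<delta> \<le> \<alpha>" "\<alpha> \<le> b / q + \<delta>" using \<alpha> by (auto simp: major_arc_def b_def q_def \<delta>_def)
  ultimately show "\<alpha> \<in> unit_arc B X" by (simp add: unit_arc_def flip: \<delta>_def)
qed

text \<open>Distinct fractions with denominators at most P are at least P^-2 apart, more than twice
  the half-width of an arc.\<close>

lemma major_arcs_disjoint:
  assumes u: "u \<in> arc_index B X" and v: "v \<in> arc_index B X"
    and small: "2 * (ln X powr B / X\<^sup>2) * (ln X powr B)\<^sup>2 < 1"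
    and \<alpha>: "\<alpha> \<in> major_arc B X u" "\<alpha> \<in> major_arc B X v"
  shows "u = v"
proof (rule ccontr)
  assume "u \<noteq> v"
  define \<delta> where "\<delta> = ln X powr B / X\<^sup>2"
  obtain q b where ub: "u = (q, b)" by force
  obtain q' b' where vb: "v = (q', b')" by force
  have \<delta>: "\<delta> \<ge> 0" by (simp add: \<delta>_def)
  have q: "real q \<ge> 1" "real q \<le> ln X powr B" "real q' \<ge> 1" "real q' \<le> ln X powr B"
    using arc_index_le[OF u] arc_index_le[OF v] by (auto simp: ub vb)
  have cop: "coprime (int b) (int q)" "coprime (int b') (int q')"
    using arc_index_le(3)[OF u] arc_index_le(3)[OF v] by (auto simp: ub vb totatives_def)
  have "int b * int q' - int b' * int q \<noteq> 0"
  proof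
    assume "int b * int q' - int b' * int q = 0"
    then have "int b * int q' = int b' * int q" by simp
    from coprime_fractions_eq[OF cop(2,1) _ _ this] q have "int q' = int q" "int b' = int b" by auto
    with \<open>u \<noteq> v\<close> show False by (simp add: ub vb)
  qed
  then have "1 \<le> \<bar>real_of_int (int b * int q' - int b' * int q)\<bar>" by linarith
  also have "real_of_int (int b * int q' - int b' * int q) = (real q * real q') * (real b / real q - real b' / real q')"
    using q by (simp add: field_simps)
  also have "\<bar>\<dots>\<bar> = (real q * real q') * \<bar>real b / real q - real b' / real q'\<bar>" by (simp add: abs_mult)
  also have "\<dots> \<le> (ln X powr B * ln X powr B) * (2 * \<delta>)"
  proof (intro mult_mono)
    show "\<bar>real b / real q - real b' / real q'\<bar> \<le> 2 * \<delta>"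
      using \<alpha> by (auto simp: major_arc_def ub vb simp flip: \<delta>_def)
  qed (use q in auto)
  also have "\<dots> < 1" using small by (simp add: power2_eq_square \<delta>_def mult_ac)
  finally show False by simp
qed

text \<open>Bounds everything off the major arcs by the integral of the majorant over the whole
  period.\<close>

lemma circle_decomposition:
  assumes X: "X \<ge> 3" and P: "ln X powr B \<ge> 1"
    and small: "2 * (ln X powr B / X\<^sup>2) * (ln X powr B)\<^sup>2 < 1" and K0: "K0 \<ge> 0"
    and minor: "\<And>\<alpha>. \<alpha> \<in> unit_arc B X - (\<Union>u\<in>arc_index B X. major_arc B X u) \<Longrightarrow> cmod (expsum X \<alpha>) \<le> K0 * bump_sum X \<alpha>"
  shows "cmod (of_real (rep_count s F t a X) - (\<Sum>u\<in>arc_index B X. LINT \<alpha>:major_arc B X u|lborel. twisted X \<alpha>))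
    \<le> K0 * (4 * pi * (1 + ln X) / X\<^sup>2)"
proof -
  define \<delta> where "\<delta> = ln X powr B / X\<^sup>2"
  have "2 * \<delta> * ln X powr B \<le> 2 * \<delta> * (ln X powr B)\<^sup>2"
    using P by (intro mult_left_mono self_le_power) (auto simp: \<delta>_def)
  then have small': "2 * (ln X powr B / X\<^sup>2) * ln X powr B < 1" using small by (simp add: \<delta>_def)
  \<comment> \<open>The difference of integrands: it vanishes on the major arcs because they are
    disjoint and inside the period, and equals the full integrand elsewhere in the period.\<close>
  define T where "T = (\<lambda>\<alpha>. indicat_real (unit_arc B X) \<alpha> *\<^sub>R twisted X \<alpha>
      - (\<Sum>u\<in>arc_index B X. indicat_real (major_arc B X u) \<alpha> *\<^sub>R twisted X \<alpha>))"
  have si: "set_integrable lborel {c..d} (twisted X)" for c d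
    by (rule borel_integrable_atLeastAtMost'[OF continuous_twisted])
  have siU: "integrable lborel (\<lambda>\<alpha>. indicat_real (unit_arc B X) \<alpha> *\<^sub>R twisted X \<alpha>)"
  proof -
    have "set_integrable lborel (unit_arc B X) (twisted X)"
      by (rule set_integrable_subset[OF si[of \<delta> "1 + \<delta>"]]) (auto simp: unit_arc_def \<delta>_def)
    then show ?thesis by (simp only: set_integrable_def)
  qed
  have sia: "integrable lborel (\<lambda>\<alpha>. indicat_real (major_arc B X u) \<alpha> *\<^sub>R twisted X \<alpha>)" for u
    using si unfolding set_integrable_def major_arc_def by auto
  have "(\<integral>\<alpha>. T \<alpha> \<partial>lborel) = (\<integral>\<alpha>. indicat_real (unit_arc B X) \<alpha> *\<^sub>R twisted X \<alpha> \<partial>lborel)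
      - (\<integral>\<alpha>. (\<Sum>u\<in>arc_index B X. indicat_real (major_arc B X u) \<alpha> *\<^sub>R twisted X \<alpha>) \<partial>lborel)"
    unfolding T_def by (rule Bochner_Integration.integral_diff[OF siU]) (intro Bochner_Integration.integrable_sum sia)
  also have "(\<integral>\<alpha>. (\<Sum>u\<in>arc_index B X. indicat_real (major_arc B X u) \<alpha> *\<^sub>R twisted X \<alpha>) \<partial>lborel)
      = (\<Sum>u\<in>arc_index B X. \<integral>\<alpha>. indicat_real (major_arc B X u) \<alpha> *\<^sub>R twisted X \<alpha> \<partial>lborel)"
    by (rule Bochner_Integration.integral_sum) (rule sia)
  finally have "of_real (rep_count s F t a X) - (\<Sum>u\<in>arc_index B X. LINT \<alpha>:major_arc B X u|lborel. twisted X \<alpha>)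
    = (\<integral>\<alpha>. T \<alpha> \<partial>lborel)"
    unfolding rep_count_eq_integral[of X "ln X powr B / X\<^sup>2"] unit_arc_def[symmetric] set_lebesgue_integral_def
    by simp
  also have "cmod \<dots> \<le> (\<integral>\<alpha>. indicat_real {\<delta>..1 + \<delta>} \<alpha> *\<^sub>R (K0 * bump_sum X \<alpha>) \<partial>lborel)"
  proof (rule norm_lebesgue_integral_le)
    have "set_integrable lborel {\<delta>..1 + \<delta>} (\<lambda>\<alpha>. K0 * bump_sum X \<alpha>)"
      by (intro borel_integrable_atLeastAtMost' continuous_intros continuous_bump_sum)
    then show "integrable lborel (\<lambda>\<alpha>. indicat_real {\<delta>..1 + \<delta>} \<alpha> *\<^sub>R (K0 * bump_sum X \<alpha>))"
      by (simp add: set_integrable_def)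
    fix \<alpha> :: real
    show "cmod (T \<alpha>) \<le> indicat_real {\<delta>..1 + \<delta>} \<alpha> *\<^sub>R (K0 * bump_sum X \<alpha>)"
    proof (cases "\<alpha> \<in> (\<Union>u\<in>arc_index B X. major_arc B X u)")
      case True
      then obtain u where u: "u \<in> arc_index B X" "\<alpha> \<in> major_arc B X u" by blast
      have "\<alpha> \<in> unit_arc B X" using major_arc_subset[OF u(1) small'] u(2) X by auto
      moreover have "(\<Sum>v\<in>arc_index B X. indicat_real (major_arc B X v) \<alpha> *\<^sub>R twisted X \<alpha>)
          = (\<Sum>v\<in>{u}. indicat_real (major_arc B X v) \<alpha> *\<^sub>R twisted X \<alpha>)"
      proof (rule sum.mono_neutral_right)
        show "\<forall>v\<in>arc_index B X - {u}. indicat_real (major_arc B X v) \<alpha> *\<^sub>R twisted X \<alpha> = 0"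
        proof
          fix v assume v: "v \<in> arc_index B X - {u}"
          then have "\<alpha> \<notin> major_arc B X v" using major_arcs_disjoint[OF u(1) _ small u(2), of v] by blast
          then show "indicat_real (major_arc B X v) \<alpha> *\<^sub>R twisted X \<alpha> = 0" by simp
        qed
      qed (use u in auto)
      ultimately have "T \<alpha> = 0" using u(2) by (simp add: T_def)
      then show ?thesis using K0 bump_sum_nonneg[of X \<alpha>] by simp
    next
      case False
      then have T: "T \<alpha> = indicat_real (unit_arc B X) \<alpha> *\<^sub>R twisted X \<alpha>"
      proof -
        have "(\<Sum>u\<in>arc_index B X. indicat_real (major_arc B X u) \<alpha> *\<^sub>R twisted X \<alpha>) = 0"
          using False by (intro sum.neutral ballI) simp
        then show ?thesis by (simp add: T_def)
      qed
      show ?thesis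
      proof (cases "\<alpha> \<in> unit_arc B X")
        case True
        then have "cmod (T \<alpha>) \<le> K0 * bump_sum X \<alpha>"
          using minor[of \<alpha>] False by (simp add: T twisted_def norm_mult)
        moreover have "\<alpha> \<in> {\<delta>..1 + \<delta>}" using True by (simp add: unit_arc_def \<delta>_def)
        ultimately show ?thesis by simp
      next
        case False
        then show ?thesis using T K0 bump_sum_nonneg[of X \<alpha>] by simp
      qed
    qed
  qed
  also have "\<dots> = integral {\<delta>..1 + \<delta>} (\<lambda>\<alpha>. K0 * bump_sum X \<alpha>)"
    unfolding set_lebesgue_integral_def[symmetric]
    by (intro set_borel_integral_eq_integral(2) borel_integrable_atLeastAtMost' continuous_intros continuous_bump_sum)
  also have "\<dots> = K0 * integral {\<delta>..1 + \<delta>} (bump_sum X)" by simp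
  also have "\<dots> \<le> K0 * (4 * pi * (1 + ln X) / X\<^sup>2)"
    using X K0 by (intro mult_left_mono integral_bump_sum_le) auto
  finally show ?thesis .
qed

text \<open>As a parameter integral over a sigma-finite product it is measurable in the frequency,
  and it is bounded by the L1 norm of the weight product.\<close>

lemma osc_integrable:
  assumes sa: "smooth_approximation a m \<Psi>"
  shows "set_integrable lborel {c..d} (\<lambda>l. osc_integral s F (deriv \<Psi>) l X * e (- l * of_int t))"
proof -
  interpret product_sigma_finite "\<lambda>_::nat. lborel :: real measure" ..
  let ?M = "Pi\<^sub>M {..<s} (\<lambda>_. lborel :: real measure)"
  interpret M: sigma_finite_measure ?M by (rule sigma_finite) simp
  define \<phi> where "\<phi> u = indicat_real {0..X} u * deriv \<Psi> u" for u
  have int\<phi>: "integrable lborel \<phi>"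
    using smooth_approx_integrable[OF sa, of X] by (simp add: set_integrable_def \<phi>_def[abs_def])
  have [measurable]: "\<phi> \<in> borel_measurable borel" using borel_measurable_integrable[OF int\<phi>] by simp
  have [measurable]: "qform s F \<in> borel_measurable ?M" by (rule measurable_qform)
  have intP: "integrable ?M (\<lambda>u. \<Prod>i<s. \<phi> (u i))" using int\<phi> by (intro product_integrable_prod) auto
  then have intP': "integrable ?M (\<lambda>u. \<bar>\<Prod>i<s. \<phi> (u i)\<bar>)" by simp
  have osc: "osc_integral s F (deriv \<Psi>) l X = (\<integral>u. of_real (\<Prod>i<s. \<phi> (u i)) * e (l * qform s F u) \<partial>?M)" for l
    by (simp add: osc_integral_eq \<phi>_def)
  have prodm: "(\<lambda>u. \<Prod>i<s. \<phi> (u i)) \<in> borel_measurable ?M" using borel_measurable_integrable[OF intP] .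
  have "(\<lambda>(l, u). complex_of_real (\<Prod>i<s. \<phi> (u i)) * e (l * qform s F u)) \<in> borel_measurable (lborel \<Otimes>\<^sub>M ?M)"
  proof -
    have "(\<lambda>p :: real \<times> (nat \<Rightarrow> real). \<Prod>i<s. \<phi> (snd p i)) \<in> borel_measurable (lborel \<Otimes>\<^sub>M ?M)"
      using measurable_compose[OF measurable_snd prodm] by simp
    moreover have "(\<lambda>p :: real \<times> (nat \<Rightarrow> real). qform s F (snd p)) \<in> borel_measurable (lborel \<Otimes>\<^sub>M ?M)"
      by (rule measurable_compose[OF measurable_snd measurable_qform])
    ultimately show ?thesis unfolding case_prod_unfold by measurable
  qed
  then have "(\<lambda>l. \<integral>u. complex_of_real (\<Prod>i<s. \<phi> (u i)) * e (l * qform s F u) \<partial>?M) \<in> borel_measurable lborel"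
    by (rule M.borel_measurable_lebesgue_integral)
  then have m: "(\<lambda>l. osc_integral s F (deriv \<Psi>) l X) \<in> borel_measurable borel" by (simp add: osc)
  have bound: "cmod (osc_integral s F (deriv \<Psi>) l X) \<le> (\<integral>u. \<bar>\<Prod>i<s. \<phi> (u i)\<bar> \<partial>?M)" for l
    unfolding osc by (rule norm_lebesgue_integral_le[OF intP']) (simp add: norm_mult del: of_real_prod)
  show ?thesis
    unfolding set_integrable_def
  proof (rule integrableI_bounded_set_indicator)
    show "AE l in lborel. l \<in> {c..d} \<longrightarrow> cmod (osc_integral s F (deriv \<Psi>) l X * e (- l * of_int t)) \<le> (\<integral>u. \<bar>\<Prod>i<s. \<phi> (u i)\<bar> \<partial>?M)"
      using bound by (simp add: norm_mult)
    show "(\<lambda>l. osc_integral s F (deriv \<Psi>) l X * e (- l * of_int t)) \<in> borel_measurable lborel"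
      using m by measurable
    show "emeasure lborel {c..d} < \<infinity>" by (simp add: emeasure_lborel_Icc_eq)
  qed simp
qed

text \<open>Translation by b/q turns the arc into the interval of the singular integral; the
  approximation error is multiplied by the length of the arc.\<close>

lemma major_arc_integral:
  assumes sa: "smooth_approximation a m \<Psi>" and q: "q \<ge> 1"
    and \<delta>: "\<delta> = ln X powr B / X\<^sup>2"
    and E: "\<And>\<beta>. \<bar>\<beta>\<bar> \<le> \<delta> \<Longrightarrow> cmod (expsum X (real b / real q + \<beta>) - local_sum s F \<kappa> q b * osc_integral s F (deriv \<Psi>) \<beta> X) \<le> E"
  shows "cmod ((LINT \<alpha>:major_arc B X (q, b)|lborel. twisted X \<alpha>)
      - st q b * (LINT l:{-\<delta>..\<delta>}|lborel. osc_integral s F (deriv \<Psi>) l X * e (- l * of_int t))) \<le> 2 * \<delta> * E"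
proof -
  define O' where "O' l = osc_integral s F (deriv \<Psi>) l X * e (- l * of_int t)" for l
  have \<delta>0: "\<delta> \<ge> 0" by (simp add: \<delta>)
  have i1: "set_integrable lborel {-\<delta>..\<delta>} (\<lambda>\<beta>. twisted X (real b / real q + \<beta>))"
  proof (rule borel_integrable_atLeastAtMost')
    show "continuous_on {-\<delta>..\<delta>} (\<lambda>\<beta>. twisted X (real b / real q + \<beta>))"
      by (rule continuous_on_compose2[OF continuous_twisted[of UNIV]]) (auto intro!: continuous_intros)
  qed
  have i2: "set_integrable lborel {-\<delta>..\<delta>} (\<lambda>\<beta>. st q b * O' \<beta>)"
    unfolding O'_def using osc_integrable[OF sa] by (intro set_integrable_mult_right)
  have "(LINT \<alpha>:major_arc B X (q, b)|lborel. twisted X \<alpha>)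
      = (\<integral>\<beta>. indicat_real (major_arc B X (q, b)) (real b / real q + 1 * \<beta>) *\<^sub>R twisted X (real b / real q + 1 * \<beta>) \<partial>lborel)"
    unfolding set_lebesgue_integral_def
    by (subst lborel_integral_real_affine[where c = 1 and t = "real b / real q"]) auto
  also have "\<dots> = (LINT \<beta>:{-\<delta>..\<delta>}|lborel. twisted X (real b / real q + \<beta>))"
    unfolding set_lebesgue_integral_def
    by (intro Bochner_Integration.integral_cong refl) (auto simp: major_arc_def indicator_def \<delta>)
  finally have 1: "(LINT \<alpha>:major_arc B X (q, b)|lborel. twisted X \<alpha>) = (LINT \<beta>:{-\<delta>..\<delta>}|lborel. twisted X (real b / real q + \<beta>))" .
  have "(LINT \<beta>:{-\<delta>..\<delta>}|lborel. twisted X (real b / real q + \<beta>)) - st q b * (LINT l:{-\<delta>..\<delta>}|lborel. O' l)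
     = (LINT \<beta>:{-\<delta>..\<delta>}|lborel. twisted X (real b / real q + \<beta>) - st q b * O' \<beta>)"
    using set_integral_diff(2)[OF i1 i2] by simp
  also have "cmod \<dots> \<le> (\<integral>\<beta>. indicat_real {-\<delta>..\<delta>} \<beta> * E \<partial>lborel)"
    unfolding set_lebesgue_integral_def
  proof (rule norm_lebesgue_integral_le)
    have "set_integrable lborel {-\<delta>..\<delta>} (\<lambda>_. E)" by (rule borel_integrable_atLeastAtMost') simp
    then show "integrable lborel (\<lambda>\<beta>. indicat_real {-\<delta>..\<delta>} \<beta> * E)" by (simp add: set_integrable_def)
    fix \<beta> :: real
    show "cmod (indicat_real {-\<delta>..\<delta>} \<beta> *\<^sub>R (twisted X (real b / real q + \<beta>) - st q b * O' \<beta>)) \<le> indicat_real {-\<delta>..\<delta>} \<beta> * E"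
    proof (cases "\<beta> \<in> {-\<delta>..\<delta>}")
      case True
      \<comment> \<open>Splitting the twist makes the difference equal to the approximation error
        times a factor of modulus one.\<close>
      have "- (real b / real q + \<beta>) * of_int t = - (real b / real q) * of_int t + - \<beta> * of_int t"
        by (simp add: algebra_simps)
      then have "twisted X (real b / real q + \<beta>) - st q b * O' \<beta>
         = (expsum X (real b / real q + \<beta>) - local_sum s F \<kappa> q b * osc_integral s F (deriv \<Psi>) \<beta> X)
            * (e (- (real b / real q) * of_int t) * e (- \<beta> * of_int t))"
        unfolding twisted_def st_def O'_def by (simp only: e_add) (simp add: algebra_simps)
      then show ?thesis using True E[of \<beta>] by (simp add: norm_mult abs_le_iff)
    qed simp
  qed
  also have "\<dots> = 2 * \<delta> * E" using \<delta>0 by simp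
  finally show ?thesis unfolding 1 O'_def .
qed

lemma card_arc_index: "real (card (arc_index B X)) \<le> (ln X powr B)\<^sup>2"
proof -
  define n where "n = nat \<lfloor>ln X powr B\<rfloor>"
  have n: "real n \<le> ln X powr B" by (simp add: n_def)
  have "card (arc_index B X) = (\<Sum>q\<in>{1..n}. card (totatives q))"
    by (simp add: arc_index_def n_def)
  also have "\<dots> \<le> (\<Sum>q\<in>{1..n}. n)"
  proof (rule sum_mono)
    fix q assume "q \<in> {1..n}"
    then show "card (totatives q) \<le> n" using totient_le[of q] by (simp add: totient_def)
  qed
  finally have "real (card (arc_index B X)) \<le> real (n * n)" by (simp only: of_nat_le_iff) simp
  also have "\<dots> \<le> (ln X powr B)\<^sup>2" using n by (simp add: power2_eq_square mult_mono)
  finally show ?thesis .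
qed

lemma singular_integral_eq:
  "singular_integral s F t \<psi> B X = (LINT l:{- (ln X powr B / X\<^sup>2)..ln X powr B / X\<^sup>2}|lborel. osc_integral s F \<psi> l X * e (- l * of_int t))"
  by (simp add: singular_integral_def Let_def)

text \<open>Three errors: minor arcs, replacement of the generating function on the major arcs, and
  truncation of the singular series at P. Only the last one multiplies the singular integral, which
  is the source of the second error term.\<close>

theorem asymptotic_formula:
  assumes K: "K > 0" and SS: "c0 \<ge> 0"
    "\<And>N. N \<ge> 1 \<Longrightarrow> cmod ((\<Sum>q\<in>{1..N}. sterm q) - of_real SS) \<le> c0 * real N powr (-1/8)"
  shows "\<exists>B\<^sub>0. \<forall>B\<ge>B\<^sub>0. \<exists>m. \<forall>\<Psi>. smooth_approximation a m \<Psi> \<longrightarrow>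
      (\<lambda>X. cmod (of_real (rep_count s F t a X) - of_real SS * singular_integral s F t (deriv \<Psi>) B X))
        \<in> O(\<lambda>X. wsum a X ^ s / X\<^sup>2 * ln X powr (- K) + cmod (singular_integral s F t (deriv \<Psi>) B X) * ln X powr (- K))"
proof -
  obtain C c where C: "C > 0"
    and minor: "\<And>B. B > 0 \<Longrightarrow> eventually (\<lambda>X. \<forall>\<alpha>\<in>unit_arc B X - (\<Union>u\<in>arc_index B X. major_arc B X u).
       cmod (expsum X \<alpha>) \<le> C * (wsum a X ^ s * ln X powr (c - B / 2)) * bump_sum X \<alpha>) at_top"
    by (rule minor_pointwise) blast
  \<comment> \<open>8K makes P to the power -1/8, the tail of the series, at most L^-K. The
    condition B \<ge> 2(K + c + 1) makes c - B/2 + 1 \<le> -K, where the 1 is the logarithm from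
    integrating the bumps.\<close>
  define B0 where "B0 = max 1 (max (8 * K) (2 * (K + c + 1)))"
  show ?thesis
  proof (intro exI[of _ B0] allI impI)
    fix B assume "B \<ge> B0"
    then have B: "B \<ge> 1" "B \<ge> 8 * K" "B \<ge> 2 * (K + c + 1)" by (auto simp: B0_def)
    \<comment> \<open>At most P^2 arcs of length 2P/X^2 contribute L^(3B), and the approximation
      contributes L^(B s + 2 s + B - m); the sum of the exponents must not exceed -K.\<close>
    define m where "m = nat \<lceil>K + 4 * B + B * s + 2 * s\<rceil>"
    have m: "K + 4 * B + B * s + 2 * s \<le> real m" by (simp add: m_def real_nat_ceiling_ge)
    show "\<exists>m. \<forall>\<Psi>. smooth_approximation a m \<Psi> \<longrightarrow>
      (\<lambda>X. cmod (of_real (rep_count s F t a X) - of_real SS * singular_integral s F t (deriv \<Psi>) B X))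
        \<in> O(\<lambda>X. wsum a X ^ s / X\<^sup>2 * ln X powr (- K) + cmod (singular_integral s F t (deriv \<Psi>) B X) * ln X powr (- K))"
    proof (intro exI[of _ m] allI impI)
      fix \<Psi> assume sa: "smooth_approximation a m \<Psi>"
      obtain D where D: "D \<ge> 0"
        "eventually (\<lambda>X. \<forall>q\<ge>1. real q \<le> ln X powr B \<longrightarrow> (\<forall>b \<beta>. \<bar>\<beta>\<bar> \<le> ln X powr B / X\<^sup>2 \<longrightarrow>
         cmod (expsum X (real b / real q + \<beta>) - local_sum s F \<kappa> q b * osc_integral s F (deriv \<Psi>) \<beta> X)
           \<le> D * (wsum a X ^ s * ln X powr (B * s + 2 * s + B - m)))) at_top"
      proof (rule major_arc_approx[OF sa, of B])
        show "B > 0" "s \<ge> 1" using B s_ge_10 by auto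
      qed
      define J where "J X = singular_integral s F t (deriv \<Psi>) B X" for X
      define g where "g X = wsum a X ^ s / X\<^sup>2 * ln X powr (- K) + cmod (J X) * ln X powr (- K)" for X
      have "B > 0" using B by simp
      define C' where "C' = 8 * pi * C + 2 * D + 2 * c0"
      have "eventually (\<lambda>X. 2 * (ln X powr B / X\<^sup>2) * (ln X powr B)\<^sup>2 < 1) at_top"
        using B by real_asymp
      moreover have "eventually (\<lambda>X::real. ln X \<ge> 1) at_top" by real_asymp
      ultimately have "eventually (\<lambda>X. cmod (of_real (rep_count s F t a X) - of_real SS * J X) \<le> C' * g X) at_top"
        using D(2) minor[OF \<open>B > 0\<close>] eventually_ge_at_top[of 3]
      proof eventually_elim
        case (elim X)
        define L where "L = ln X"
        define P where "P = L powr B"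
        define \<delta> where "\<delta> = P / X\<^sup>2"
        define A where "A = wsum a X"
        define M where "M = (\<Sum>u\<in>arc_index B X. LINT \<alpha>:major_arc B X u|lborel. twisted X \<alpha>)"
        define N where "N = nat \<lfloor>P\<rfloor>"
        have X: "X \<ge> 3" and L: "L \<ge> 1" using elim by (auto simp: L_def)
        have P: "P \<ge> 1" using L B by (simp add: P_def ge_one_powr_ge_zero)
        have A: "A ^ s \<ge> 0" unfolding A_def using a_nonneg by (intro zero_le_power wsum_nonneg)
        have AX: "A ^ s / X\<^sup>2 \<ge> 0" using A by simp
        have J: "J X = (LINT l:{-\<delta>..\<delta>}|lborel. osc_integral s F (deriv \<Psi>) l X * e (- l * of_int t))"
          by (simp add: J_def singular_integral_eq \<delta>_def P_def L_def)
        have err1: "cmod (of_real (rep_count s F t a X) - M) \<le> 8 * pi * C * (A ^ s / X\<^sup>2 * L powr (- K))"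
        proof -
          have "cmod (of_real (rep_count s F t a X) - M) \<le> (C * (A ^ s * L powr (c - B / 2))) * (4 * pi * (1 + ln X) / X\<^sup>2)"
            unfolding M_def using X P elim C A
            by (intro circle_decomposition) (auto simp: P_def L_def A_def)
          also have "\<dots> \<le> (C * (A ^ s * L powr (c - B / 2))) * (4 * pi * (2 * L) / X\<^sup>2)"
            using C A L by (intro mult_left_mono divide_right_mono) (auto simp: L_def)
          also have "\<dots> = 8 * pi * C * (A ^ s / X\<^sup>2 * (L powr (c - B / 2) * L powr 1))"
            using L by simp
          also have "L powr (c - B / 2) * L powr 1 = L powr (c - B / 2 + 1)" by (simp only: powr_add)
          also have "8 * pi * C * (A ^ s / X\<^sup>2 * L powr (c - B / 2 + 1)) \<le> 8 * pi * C * (A ^ s / X\<^sup>2 * L powr (- K))"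
            using L B C AX by (intro mult_left_mono powr_mono) auto
          finally show ?thesis .
        qed
        have err2: "cmod (M - (\<Sum>q\<in>{1..N}. sterm q) * J X) \<le> 2 * D * (A ^ s / X\<^sup>2 * L powr (- K))"
        proof -
          define E where "E = D * (A ^ s * L powr (B * s + 2 * s + B - m))"
          have E0: "E \<ge> 0" using D A by (simp add: E_def)
          have "(\<Sum>q\<in>{1..N}. sterm q) * J X = (\<Sum>u\<in>arc_index B X. st (fst u) (snd u) * J X)"
            by (simp add: singular_term_eq arc_index_def N_def P_def L_def sum.Sigma sum_distrib_right case_prod_unfold)
          then have "cmod (M - (\<Sum>q\<in>{1..N}. sterm q) * J X)
            = cmod (\<Sum>u\<in>arc_index B X. (LINT \<alpha>:major_arc B X u|lborel. twisted X \<alpha>) - st (fst u) (snd u) * J X)"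
            by (simp add: M_def sum_subtractf)
          also have "\<dots> \<le> (\<Sum>u\<in>arc_index B X. 2 * \<delta> * E)"
          proof (rule sum_norm_le)
            fix u assume u: "u \<in> arc_index B X"
            have "cmod ((LINT \<alpha>:major_arc B X (fst u, snd u)|lborel. twisted X \<alpha>) - st (fst u) (snd u) * J X) \<le> 2 * \<delta> * E"
              unfolding J using arc_index_le[OF u] elim(3)
              by (intro major_arc_integral[OF sa]) (auto simp: \<delta>_def P_def L_def E_def A_def)
            then show "cmod ((LINT \<alpha>:major_arc B X u|lborel. twisted X \<alpha>) - st (fst u) (snd u) * J X) \<le> 2 * \<delta> * E" by simp
          qed
          also have "\<dots> = real (card (arc_index B X)) * (2 * \<delta> * E)" by simp
          also have "\<dots> \<le> P\<^sup>2 * (2 * \<delta> * E)"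
            using card_arc_index[of B X] E0 P by (intro mult_right_mono) (auto simp: P_def L_def \<delta>_def)
          also have "\<dots> = 2 * D * (A ^ s / X\<^sup>2 * (P ^ 3 * L powr (B * s + 2 * s + B - m)))"
            by (simp add: \<delta>_def E_def power2_eq_square power3_eq_cube)
          also have "P ^ 3 = L powr (3 * B)"
            using L by (simp add: P_def powr_realpow[symmetric] powr_powr mult.commute)
          also have "L powr (3 * B) * L powr (B * s + 2 * s + B - m) = L powr (3 * B + (B * s + 2 * s + B - m))"
            by (simp only: powr_add)
          also have "2 * D * (A ^ s / X\<^sup>2 * L powr (3 * B + (B * s + 2 * s + B - m))) \<le> 2 * D * (A ^ s / X\<^sup>2 * L powr (- K))"
            using L m D(1) AX by (intro mult_left_mono powr_mono) auto
          finally show ?thesis .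
        qed
        have err3: "cmod (((\<Sum>q\<in>{1..N}. sterm q) - of_real SS) * J X) \<le> 2 * c0 * (cmod (J X) * L powr (- K))"
        proof -
          have "N \<ge> 1" using P by (simp add: N_def le_nat_floor)
          moreover have "real N > P - 1" using P unfolding N_def by linarith
          \<comment> \<open>N is the integer part of P \<ge> 1 and hence at least P/2; the resulting
            factor, a power 1/8 of 2, is rounded up to 2.\<close>
          ultimately have N: "N \<ge> 1" "real N \<ge> P / 2" by linarith+
          have "cmod ((\<Sum>q\<in>{1..N}. sterm q) - of_real SS) \<le> c0 * real N powr (-1/8)" by (rule SS(2)[OF N(1)])
          also have "real N powr (-1/8) \<le> (P / 2) powr (-1/8)" using N P by (intro powr_mono2') auto
          also have "(P / 2) powr (-1/8) = P powr (-1/8) * (1 / 2) powr (-1/8)"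
            using P powr_mult[of P "1 / 2" "-1/8"] by simp
          also have "P powr (-1/8) = L powr (- (B / 8))" by (simp add: P_def powr_powr)
          also have "L powr (- (B / 8)) * (1 / 2) powr (-1/8) \<le> L powr (- K) * 2"
          proof (intro mult_mono)
            show "L powr (- (B / 8)) \<le> L powr (- K)" using L B by (intro powr_mono) auto
            have "(1 / 2 :: real) powr (-1/8) \<le> (1 / 2) powr (-1)" by (intro powr_mono') auto
            then show "(1 / 2 :: real) powr (-1/8) \<le> 2" by (simp add: powr_minus)
          qed auto
          finally have "cmod ((\<Sum>q\<in>{1..N}. sterm q) - of_real SS) \<le> c0 * (L powr (- K) * 2)"
            using SS(1) by (simp add: mult_left_mono)
          then have "cmod ((\<Sum>q\<in>{1..N}. sterm q) - of_real SS) * cmod (J X) \<le> c0 * (L powr (- K) * 2) * cmod (J X)"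
            by (rule mult_right_mono) simp
          then show ?thesis by (simp add: norm_mult mult_ac)
        qed
        have "of_real (rep_count s F t a X) - of_real SS * J X = (of_real (rep_count s F t a X) - M)
           + (M - (\<Sum>q\<in>{1..N}. sterm q) * J X) + ((\<Sum>q\<in>{1..N}. sterm q) - of_real SS) * J X"
          by (simp add: algebra_simps)
        then have "cmod (of_real (rep_count s F t a X) - of_real SS * J X) \<le> cmod (of_real (rep_count s F t a X) - M)
           + cmod (M - (\<Sum>q\<in>{1..N}. sterm q) * J X) + cmod (((\<Sum>q\<in>{1..N}. sterm q) - of_real SS) * J X)"
          by (metis norm_triangle_ineq norm_triangle_mono order_refl)
        also have "\<dots> \<le> 8 * pi * C * (A ^ s / X\<^sup>2 * L powr (- K)) + 2 * D * (A ^ s / X\<^sup>2 * L powr (- K)) + 2 * c0 * (cmod (J X) * L powr (- K))"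
          using err1 err2 err3 by (intro add_mono)
        also have "\<dots> = (8 * pi * C + 2 * D) * (A ^ s / X\<^sup>2 * L powr (- K)) + 2 * c0 * (cmod (J X) * L powr (- K))"
          by (simp add: algebra_simps)
        also have "\<dots> \<le> C' * (A ^ s / X\<^sup>2 * L powr (- K)) + C' * (cmod (J X) * L powr (- K))"
          using C D(1) SS(1) A by (intro add_mono mult_right_mono) (auto simp: C'_def)
        also have "\<dots> = C' * g X" by (simp add: g_def A_def L_def algebra_simps)
        finally show ?case .
      qed
      moreover have "C' \<ge> 0" using C D(1) SS(1) by (simp add: C'_def)
      moreover have "C' * g X \<le> C' * norm (g X)" if "C' \<ge> 0" for X using that by (intro mult_left_mono) auto
      ultimately have "(\<lambda>X. cmod (of_real (rep_count s F t a X) - of_real SS * J X)) \<in> O(g)"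
        by (intro bigoI[where c = C']) (auto elim!: eventually_mono intro: order_trans)
      then show "(\<lambda>X. cmod (of_real (rep_count s F t a X) - of_real SS * singular_integral s F t (deriv \<Psi>) B X))
        \<in> O(\<lambda>X. wsum a X ^ s / X\<^sup>2 * ln X powr (- K) + cmod (singular_integral s F t (deriv \<Psi>) B X) * ln X powr (- K))"
        by (simp add: J_def g_def[abs_def])
    qed
  qed
qed

end

theorem theorem1p1:
  fixes s :: nat and F :: "real mat" and t :: int
    and a :: "nat \<Rightarrow> real" and Q\<^sub>D :: "real \<Rightarrow> real" and \<kappa> :: "nat \<Rightarrow> int \<Rightarrow> real"
    and K :: real
  assumes "integral_form_matrix s F"
    and "Determinant.det F \<noteq> 0"
    and "condition_L1 s F"
    and "\<And>x. a x \<ge> 0"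
    and "filterlim (wsum a) at_top at_top"
    and "condition_D a Q\<^sub>D \<kappa>"
    and "level_beyond_log_powers Q\<^sub>D"
    and "condition_C Q\<^sub>D \<kappa>"
    and "condition_K \<kappa>"
    and "condition_L2 a"
    and "smoothly_approximable a"
    and "K > 0"
  shows "\<exists>\<SS>::real. \<SS> \<ge> 0 \<and>
    (\<lambda>q. singular_term s F t \<kappa> (Suc q)) sums of_real \<SS> \<and>
    (\<forall>p. prime p \<longrightarrow> convergent (\<lambda>m. real (p ^ m) * local_mass s F t \<kappa> (p ^ m))) \<and>
    (\<lambda>p. if prime p then lim (\<lambda>m. real (p ^ m) * local_mass s F t \<kappa> (p ^ m)) else 1)
      has_prod \<SS> \<and>
    (\<exists>B\<^sub>0. \<forall>B\<ge>B\<^sub>0. \<exists>m. \<forall>\<Psi>. smooth_approximation a m \<Psi> \<longrightarrow>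
      (\<lambda>X. cmod (of_real (rep_count s F t a X)
                  - of_real \<SS> * singular_integral s F t (deriv \<Psi>) B X))
        \<in> O(\<lambda>X. wsum a X ^ s / X\<^sup>2 * ln X powr (- K)
                  + cmod (singular_integral s F t (deriv \<Psi>) B X) * ln X powr (- K)))"
proof -
  interpret circle_problem a Q\<^sub>D \<kappa> s F t
    by unfold_locales (use assms in auto)
  show ?thesis
  proof (rule singular_series)
    fix SS c
    assume SS: "SS \<ge> 0" "(\<lambda>q. sterm (Suc q)) sums of_real SS"
      "\<And>p. prime p \<Longrightarrow> convergent (\<lambda>m. real (p ^ m) * local_mass s F t \<kappa> (p ^ m))"
      "(\<lambda>p. if prime p then lim (\<lambda>m. real (p ^ m) * local_mass s F t \<kappa> (p ^ m)) else 1) has_prod SS"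
      "c \<ge> 0" "\<And>N. N \<ge> 1 \<Longrightarrow> cmod ((\<Sum>q\<in>{1..N}. sterm q) - of_real SS) \<le> c * real N powr (-1/8)"
    \<comment> \<open>The quantitative tail bound of the series is what links its sum to the
      asymptotic formula; the other clauses pass through unchanged.\<close>
    from asymptotic_formula[OF \<open>K > 0\<close> SS(5,6)] SS(1-4) show ?thesis by blast
  qed
qed

end
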